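(* Let $n\ge2$, $A\in\mathbb{R}^{n\times n}$, $\sigma_1,\dots,\sigma_n>0$, and let $X(t)$ be the stochastic replicator dynamics on $\Delta$ with pay-off matrix $A$ and noise coefficients $\sigma_1,\dots,\sigma_n$ (see context). Let $\mathbf{p}\in\overline{\Delta}$ be an ESS for the modified pay-off matrix $A-\mathrm{diag}(\sigma_1^2,\dots,\sigma_n^2)$, and suppose that $A-\mathrm{diag}(\frac12\sigma_1^2,\dots,\frac12\sigma_n^2)$ is conditionally negative definite. Let $\overline{A}=\frac12[A+A^T-\mathrm{diag}(\sigma_1^2,\dots,\sigma_n^2)]$ and let $\lambda_2'$ be the second largest eigenvalue of $$\overline{A}-\frac1n\overline{A}\mathbf{1}\mathbf{1}^T-\frac1n\mathbf{1}\mathbf{1}^T\overline{A}+\frac{\mathbf{1}^T\overline{A}\mathbf{1}}{n^2}\mathbf{1}\mathbf{1}^T.$$ Then for every initial state $\mathbf{x}\in\Delta$ and every $t>0$, $$E_{\mathbf{x}}\frac1t\int_0^t\|X(s)-\mathbf{p}\|^2ds\le\frac{1}{|\lambda_2'|}\Big\{\frac{d(\mathbf{x},\mathbf{p})}{t}+\frac12\sum_{j=1}^np_j(1-p_j)\sigma_j^2\Big\}.$$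
   Context: $\Delta=\{\mathbf{y}\in(0,1)^n:\sum y_j=1\}$, $\overline{\Delta}$ its closure; $\mathbf{1}$ the all-ones vector; $\|\cdot\|$ the Euclidean norm. The stochastic replicator dynamics is the solution $X(t)\in\Delta$ of $dX(t)=\mathbf{b}(X(t))dt+C(X(t))dW(t)$, with $W$ an $n$-dimensional standard Brownian motion, $\mathbf{b}(\mathbf{x})=[\mathrm{diag}(x_1,\dots,x_n)-\mathbf{x}\mathbf{x}^T][A-\mathrm{diag}(\sigma_1^2,\dots,\sigma_n^2)]\mathbf{x}$, $C(\mathbf{x})=[\mathrm{diag}(x_1,\dots,x_n)-\mathbf{x}\mathbf{x}^T]\mathrm{diag}(\sigma_1,\dots,\sigma_n)$. $E_{\mathbf{x}}$ is expectation for the process with $X(0)=\mathbf{x}$. For a matrix $M$, $\mathbf{p}\in\overline{\Delta}$ is an ESS for $M$ if (i) $\mathbf{p}^TM\mathbf{p}\ge\mathbf{q}^TM\mathbf{p}$ for all $\mathbf{q}\in\overline\Delta$ and (ii) whenever $\mathbf{q}\ne\mathbf{p}$ and $\mathbf{p}^TM\mathbf{p}=\mathbf{q}^TM\mathbf{p}$, then $\mathbf{p}^TM\mathbf{q}>\mathbf{q}^TM\mathbf{q}$. $M$ is conditionally negative definite if $\mathbf{y}^TM\mathbf{y}<0$ for all nonzero $\mathbf{y}$ with $\mathbf{1}^T\mathbf{y}=0$. $d(\mathbf{x},\mathbf{p})=\sum_{j:p_j>0}p_j\log(p_j/x_j)$. *)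

theory Defs
  imports "HOL-Probability.Probability"
begin

definition diagv :: "real^'n \<Rightarrow> real^'n^'n" where
  "diagv v = (\<chi> i j. if i = j then v $ i else 0)"

definition outer :: "real^'n \<Rightarrow> real^'n \<Rightarrow> real^'n^'n" where
  "outer x y = (\<chi> i j. x $ i * y $ j)"

definition ones :: "real^'n" where
  "ones = (\<chi> i. 1)"

definition sq_vec :: "real^'n \<Rightarrow> real^'n" where
  "sq_vec s = (\<chi> i. (s $ i)^2)"

definition open_Delta :: "(real^'n) set" where
  "open_Delta = {y. (\<forall>i. 0 < y $ i \<and> y $ i < 1) \<and> (\<Sum>i\<in>UNIV. y $ i) = 1}"

definition cl_Delta :: "(real^'n) set" where
  "cl_Delta = {y. (\<forall>i. 0 \<le> y $ i) \<and> (\<Sum>i\<in>UNIV. y $ i) = 1}"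

definition is_ESS :: "real^'n^'n \<Rightarrow> real^'n \<Rightarrow> bool" where
  "is_ESS M p \<longleftrightarrow> p \<in> cl_Delta \<and>
     (\<forall>q\<in>cl_Delta. p \<bullet> (M *v p) \<ge> q \<bullet> (M *v p)) \<and>
     (\<forall>q\<in>cl_Delta. q \<noteq> p \<and> p \<bullet> (M *v p) = q \<bullet> (M *v p)
         \<longrightarrow> p \<bullet> (M *v q) > q \<bullet> (M *v q))"

definition cond_neg_def :: "real^'n^'n \<Rightarrow> bool" where
  "cond_neg_def M \<longleftrightarrow> (\<forall>y. y \<noteq> 0 \<and> ones \<bullet> y = 0 \<longrightarrow> y \<bullet> (M *v y) < 0)"

definition is_eigenvalue :: "real^'n^'n \<Rightarrow> real \<Rightarrow> bool" where
  "is_eigenvalue M l \<longleftrightarrow> (\<exists>v. v \<noteq> 0 \<and> M *v v = l *\<^sub>R v)"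

text \<open>Second largest eigenvalue, eigenvalues counted with multiplicity
  (for the symmetric matrices to which it is applied, algebraic multiplicity
  equals the dimension of the eigenspace).\<close>
definition second_largest_eigenvalue :: "real^'n^'n \<Rightarrow> real" where
  "second_largest_eigenvalue M =
     (let l1 = Max {l. is_eigenvalue M l} in
      if dim {v. M *v v = l1 *\<^sub>R v} \<ge> 2 then l1
      else Max {l. is_eigenvalue M l \<and> l < l1})"

definition rel_entropy :: "real^'n \<Rightarrow> real^'n \<Rightarrow> real" where
  "rel_entropy x p = (\<Sum>j\<in>{j. p $ j > 0}. p $ j * ln (p $ j / x $ j))"

definition drift :: "real^'n^'n \<Rightarrow> real^'n \<Rightarrow> real^'n \<Rightarrow> real^'n" where
  "drift A \<sigma> x = ((diagv x - outer x x) ** (A - diagv (sq_vec \<sigma>))) *v x"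

definition diffusion :: "real^'n \<Rightarrow> real^'n \<Rightarrow> real^'n^'n" where
  "diffusion \<sigma> x = (diagv x - outer x x) ** diagv \<sigma>"

definition is_filtration :: "'a measure \<Rightarrow> (real \<Rightarrow> 'a measure) \<Rightarrow> bool" where
  "is_filtration M F \<longleftrightarrow> (\<forall>t. subalgebra M (F t)) \<and>
     (\<forall>s t. s \<le> t \<longrightarrow> sets (F s) \<subseteq> sets (F t))"

definition gauss_density :: "real \<Rightarrow> real^'n \<Rightarrow> real" where
  "gauss_density h x = (2 * pi * h) powr (- real CARD('n) / 2) * exp (- (((norm x) ^ 2) / (2 * h)))"

definition is_brownian_motion ::
  "'a measure \<Rightarrow> (real \<Rightarrow> 'a measure) \<Rightarrow> (real \<Rightarrow> 'a \<Rightarrow> real^'n) \<Rightarrow> bool" where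
  "is_brownian_motion M F W \<longleftrightarrow>
     (\<forall>\<omega>\<in>space M. W 0 \<omega> = 0) \<and>
     (\<forall>\<omega>\<in>space M. continuous_on {0..} (\<lambda>t. W t \<omega>)) \<and>
     (\<forall>t\<ge>0. W t \<in> borel_measurable (F t)) \<and>
     (\<forall>s t. 0 \<le> s \<and> s < t \<longrightarrow>
        (\<forall>E\<in>sets (F s). \<forall>B\<in>sets borel.
           measure M (E \<inter> {\<omega>\<in>space M. W t \<omega> - W s \<omega> \<in> B}) =
           measure M E * measure (density lborel (\<lambda>x. ennreal (gauss_density (t - s) x))) B))"

text \<open>The Ito integral of the continuous, bounded, adapted integrand C(X(s)) against W
  over [0,t] is the L^2-limit of the left-endpoint Riemann sums along uniform partitions.\<close>
definition ito_riemann_sum ::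
  "(real \<Rightarrow> 'a \<Rightarrow> real^'n^'n) \<Rightarrow> (real \<Rightarrow> 'a \<Rightarrow> real^'n) \<Rightarrow> real \<Rightarrow> nat \<Rightarrow> 'a \<Rightarrow> real^'n" where
  "ito_riemann_sum H W t N \<omega> =
     (\<Sum>k<N. H (real k * t / real N) \<omega> *v
        (W (real (Suc k) * t / real N) \<omega> - W (real k * t / real N) \<omega>))"

definition solves_replicator_sde ::
  "'a measure \<Rightarrow> (real \<Rightarrow> 'a measure) \<Rightarrow> (real \<Rightarrow> 'a \<Rightarrow> real^'n) \<Rightarrow>
   real^'n^'n \<Rightarrow> real^'n \<Rightarrow> real^'n \<Rightarrow> (real \<Rightarrow> 'a \<Rightarrow> real^'n) \<Rightarrow> bool" where
  "solves_replicator_sde M F W A \<sigma> x X \<longleftrightarrow>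
     (\<forall>t\<ge>0. \<forall>\<omega>\<in>space M. X t \<omega> \<in> open_Delta) \<and>
     (\<forall>\<omega>\<in>space M. X 0 \<omega> = x) \<and>
     (\<forall>\<omega>\<in>space M. continuous_on {0..} (\<lambda>t. X t \<omega>)) \<and>
     (\<forall>t\<ge>0. X t \<in> borel_measurable (F t)) \<and>
     (\<forall>t\<ge>0.
        let err = (\<lambda>N \<omega>. norm (X t \<omega> - X 0 \<omega> - integral {0..t} (\<lambda>s. drift A \<sigma> (X s \<omega>))
                      - ito_riemann_sum (\<lambda>s \<omega>. diffusion \<sigma> (X s \<omega>)) W t N \<omega>) ^ 2)
        in (\<forall>N. integrable M (err N)) \<and> (\<lambda>N. integral\<^sup>L M (err N)) \<longlonglongrightarrow> 0)"

end

theory Submission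
  imports Defs
begin

text \<open>
  The relative entropy \<open>V(x) = d(x,p)\<close> is a Lyapunov function. Since \<open>p\<close> is a best reply to itself for
  \<open>A - diag \<sigma>\<^sup>2\<close>, the generator satisfies
  \<open>LV(x) \<le> (x - p)\<^sup>T (A - diag \<sigma>\<^sup>2 / 2) (x - p) + \<Sum>\<^sub>j p\<^sub>j (1 - p\<^sub>j) \<sigma>\<^sub>j\<^sup>2 / 2\<close>, and on vectors orthogonal
  to \<open>1\<close> the quadratic form is at most \<open>\<lambda>\<^sub>2' |x - p|\<^sup>2\<close> with \<open>\<lambda>\<^sub>2' < 0\<close>. Integrating in time and using \<open>V \<ge> 0\<close>
  gives the claim.

  The Ito formula is needed only in expectation, for functions of one coordinate. Replacing the stochastic
  integral by its left-endpoint sums turns the coordinate into a process with explicit Gaussian increments, to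
  which Taylor's theorem applies directly; by orthogonality of increments, the mean-square error at each grid
  point is at most the error at the final time, which vanishes in the limit. The singularity of the logarithm
  is removed by working with \<open>- ln (e\<^sup>2 + y\<^sup>2) / 2\<close> and letting \<open>e\<close> tend to \<open>0\<close>.
\<close>

section \<open>Eigenvalues of symmetric matrices\<close>

text \<open>The hypothesis on the noise integral concerns one final time at a time: its
  left-endpoint sums on uniform grids of that interval converge in mean square. It is silent about
  intermediate grid points and about the martingale property. Both are recovered from commensurable
  grids: at a grid point the partial sums of a refined grid are themselves sums of the kind covered
  by the hypothesis for that earlier time. One step of length \<open>h\<close> then costs an error
  of order \<open>h powr (3/2)\<close> in Taylor's formula, so that a whole interval costs order
  \<open>sqrt h\<close>. Single coordinates suffice because the relative entropy is a weighted sum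
  of the functions \<open>- ln (x $ i)\<close> plus a constant. Integrability of the logarithm at
  the final time is avoided: the regularised entropy is bounded below by a multiple of
  \<open>- e\<close>, so the limit in \<open>e\<close> is taken only at the deterministic initial
  state and in the time integral. There it is harmless, since drift and noise of coordinate
  \<open>i\<close> carry a factor \<open>x $ i\<close> that cancels the growth of the derivatives of
  the logarithm.\<close>

lemma finite_eigenvalues_symmetric:
  fixes S :: "real^'n^'n"
  assumes sym: "\<And>u v. u \<bullet> (S *v v) = (S *v u) \<bullet> v"
  shows "finite {l. is_eigenvalue S l}"
proof -
  \<comment> \<open>One eigenvector is picked for each eigenvalue. Symmetry makes the picks pairwise
    orthogonal, hence independent, and a nonzero vector cannot serve two eigenvalues. Finiteness
    gives the \<open>Max\<close> in \<open>second_largest_eigenvalue\<close> its meaning.\<close>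
  define e where "e = (\<lambda>l. SOME v. v \<noteq> 0 \<and> S *v v = l *\<^sub>R v)"
  have e: "e l \<noteq> 0 \<and> S *v e l = l *\<^sub>R e l" if "is_eigenvalue S l" for l
    using that someI_ex[of "\<lambda>v. v \<noteq> 0 \<and> S *v v = l *\<^sub>R v"]
    unfolding is_eigenvalue_def e_def by blast
  have orth: "e l \<bullet> e m = 0" if "is_eigenvalue S l" "is_eigenvalue S m" "l \<noteq> m" for l m
    using sym[of "e l" "e m"] e[OF that(1)] e[OF that(2)] that(3) by auto
  let ?E = "{l. is_eigenvalue S l}"
  have "pairwise orthogonal (e ` ?E)"
    unfolding pairwise_def orthogonal_def using orth by blast
  moreover have "0 \<notin> e ` ?E"
    using e by force
  ultimately have "finite (e ` ?E)"
    using pairwise_orthogonal_independent independent_bound by blast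
  moreover have "inj_on e ?E"
  proof (rule inj_onI)
    fix l m assume "l \<in> ?E" "m \<in> ?E" "e l = e m"
    then show "l = m" using orth[of l m] e[of l] by auto
  qed
  ultimately show ?thesis
    using finite_imageD by blast
qed

text \<open>First variation of the Rayleigh quotient: the residual \<open>z\<close> of the
  eigenvalue equation lies in \<open>V\<close>, and moving from \<open>y0\<close> to
  \<open>y0 + r *\<^sub>R z\<close> changes the nonpositive form
  \<open>y \<bullet> (S *v y) - \<mu> * (y \<bullet> y)\<close> from 0 to
  \<open>2 * r * (z \<bullet> z) + r^2 * a\<close>. For small positive \<open>r\<close> this is
  positive unless \<open>z = 0\<close>.\<close>

lemma eigenvector_of_max_quadratic_form:
  fixes S :: "real^'n^'n"
  assumes sym: "\<And>u v. u \<bullet> (S *v v) = (S *v u) \<bullet> v"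
    and inv: "\<And>u. u \<in> V \<Longrightarrow> S *v u \<in> V" and V: "subspace V"
    and y0: "y0 \<in> V" "y0 \<bullet> (S *v y0) = \<mu> * (y0 \<bullet> y0)"
    and le: "\<And>y. y \<in> V \<Longrightarrow> y \<bullet> (S *v y) \<le> \<mu> * (y \<bullet> y)"
  shows "S *v y0 = \<mu> *\<^sub>R y0"
proof -
  define z where "z = S *v y0 - \<mu> *\<^sub>R y0"
  have zV: "z \<in> V"
    unfolding z_def using y0 inv V by (auto intro: subspace_diff subspace_scale)
  define a where "a = z \<bullet> (S *v z) - \<mu> * (z \<bullet> z)"
  have *: "2 * r * (z \<bullet> z) + r^2 * a \<le> 0" for r
  proof -
    have "y0 + r *\<^sub>R z \<in> V"
      using V y0 zV by (auto intro: subspace_add subspace_scale)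
    from le[OF this]
    have "y0 \<bullet> (S *v y0) + r * (y0 \<bullet> (S *v z)) + r * (z \<bullet> (S *v y0)) + r^2 * (z \<bullet> (S *v z))
        \<le> \<mu> * (y0 \<bullet> y0) + 2 * r * \<mu> * (z \<bullet> y0) + r^2 * \<mu> * (z \<bullet> z)"
      by (simp add: matrix_vector_right_distrib matrix_vector_mult_scaleR inner_add_left
          inner_add_right algebra_simps power2_eq_square inner_commute)
    moreover have "y0 \<bullet> (S *v z) = z \<bullet> (S *v y0)"
      using sym[of y0 z] by (simp add: inner_commute)
    moreover have "z \<bullet> (S *v y0) - \<mu> * (z \<bullet> y0) = z \<bullet> z"
      by (simp add: z_def inner_diff_right)
    then have "z \<bullet> (S *v y0) = \<mu> * (z \<bullet> y0) + z \<bullet> z" by simp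
    ultimately show ?thesis
      using y0(2) unfolding a_def by (simp add: algebra_simps)
  qed
  have "z \<bullet> z = 0"
  proof (rule ccontr)
    assume "z \<bullet> z \<noteq> 0"
    then have pos: "z \<bullet> z > 0" by simp
    \<comment> \<open>This size gives \<open>r * \<bar>a\<bar> \<le> z \<bullet> z\<close>, so the
      linear term wins; the added 1 covers \<open>a = 0\<close>.\<close>
    define r where "r = (z \<bullet> z) / (\<bar>a\<bar> + 1)"
    have r: "r > 0" using pos by (simp add: r_def)
    have "r * (2 * (z \<bullet> z) + r * a) \<le> 0"
      using *[of r] by (simp add: algebra_simps power2_eq_square)
    then have "2 * (z \<bullet> z) + r * a \<le> 0"
      using r by (simp add: mult_le_0_iff)
    moreover have "r * \<bar>a\<bar> \<le> z \<bullet> z"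
      using pos by (simp add: r_def field_simps)
    moreover have "- (r * \<bar>a\<bar>) \<le> r * a"
      using r by (metis abs_ge_minus_self abs_mult abs_of_pos minus_le_iff)
    ultimately show False using pos by linarith
  qed
  then show ?thesis by (simp add: z_def)
qed

text \<open>The line of \<open>ones\<close> and its orthogonal complement \<open>V\<close> are both
  invariant under \<open>S\<close>. The form vanishes on the line and is negative on
  \<open>V\<close>, so 0 is the largest eigenvalue with a one-dimensional eigenspace, and the next
  one is governed by the Rayleigh quotient on \<open>V\<close>.\<close>

lemma second_largest_eigenvalue_bound:
  fixes S :: "real^'n^'n"
  assumes card: "CARD('n) \<ge> 2"
    and sym: "\<And>u v. u \<bullet> (S *v v) = (S *v u) \<bullet> v"
    and ones: "S *v ones = 0"
    and neg: "\<And>y. y \<noteq> 0 \<Longrightarrow> ones \<bullet> y = 0 \<Longrightarrow> y \<bullet> (S *v y) < 0"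
  shows "second_largest_eigenvalue S < 0"
    and "\<And>y. ones \<bullet> y = 0 \<Longrightarrow> y \<bullet> (S *v y) \<le> second_largest_eigenvalue S * (norm y)\<^sup>2"
proof -
  define V where "V = {y::real^'n. ones \<bullet> y = 0}"
  have V: "subspace V"
    unfolding V_def by (rule subspace_hyperplane)
  have ones_nz: "(ones::real^'n) \<noteq> 0"
    by (simp add: ones_def vec_eq_iff)
  have ones_sq: "(ones::real^'n) \<bullet> ones > 0"
    using ones_nz by simp
  have inv: "S *v u \<in> V" for u
    unfolding V_def using sym[of ones u] ones by simp
  have decomp: "\<exists>a y. v = a *\<^sub>R ones + y \<and> y \<in> V" for v :: "real^'n"
  proof -
    let ?a = "(ones \<bullet> v) / (ones \<bullet> (ones::real^'n))"
    have "v - ?a *\<^sub>R ones \<in> V"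
      using ones_sq by (simp add: V_def inner_diff_right)
    then show ?thesis by (metis add.commute diff_add_cancel)
  qed
  have quad: "v \<bullet> (S *v v) = y \<bullet> (S *v y)" if "v = a *\<^sub>R ones + y" "y \<in> V" for v a y
    using that ones sym[of ones y]
    by (simp add: matrix_vector_right_distrib matrix_vector_mult_scaleR inner_add_left)
  have fin: "finite {l. is_eigenvalue S l}"
    using sym by (rule finite_eigenvalues_symmetric)
  have le0: "l \<le> 0" if l: "is_eigenvalue S l" for l
  proof -
    obtain v where v: "v \<noteq> 0" "S *v v = l *\<^sub>R v"
      using l unfolding is_eigenvalue_def by blast
    obtain a y where y: "v = a *\<^sub>R ones + y" "y \<in> V" using decomp[of v] by blast
    have "y \<bullet> (S *v y) \<le> 0"
      using neg[of y] y(2) unfolding V_def by (cases "y = 0") auto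
    then have "l * (v \<bullet> v) \<le> 0"
      using quad[OF y] v(2) by simp
    moreover have "v \<bullet> v > 0" using v(1) by simp
    ultimately show ?thesis by (auto simp: mult_le_0_iff)
  qed
  have ev0: "is_eigenvalue S 0"
    unfolding is_eigenvalue_def using ones ones_nz by auto
  have Max0: "Max {l. is_eigenvalue S l} = 0"
    using fin le0 ev0 by (intro Max_eqI) auto
  have "{v. S *v v = 0 *\<^sub>R v} \<subseteq> span {ones}"
  proof
    fix v assume v: "v \<in> {v. S *v v = 0 *\<^sub>R v}"
    obtain a y where y: "v = a *\<^sub>R ones + y" "y \<in> V" using decomp[of v] by blast
    have "y \<bullet> (S *v y) = 0" using quad[OF y] v by simp
    then have "y = 0" using neg[of y] y(2) unfolding V_def by auto
    then show "v \<in> span {ones}" using y by (simp add: span_base span_scale)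
  qed
  \<comment> \<open>An eigenspace of dimension at most one excludes the first branch of
    \<open>second_largest_eigenvalue\<close>; what is left is the maximum of the negative
    eigenvalues.\<close>
  then have "dim {v. S *v v = 0 *\<^sub>R v} \<le> card {ones::real^'n}"
    by (intro dim_le_card) auto
  then have second: "second_largest_eigenvalue S = Max {l. is_eigenvalue S l \<and> l < 0}"
    unfolding second_largest_eigenvalue_def Let_def Max0 by simp
  \<comment> \<open>Two distinct indices provide a nonzero vector of \<open>V\<close>, so the unit
    sphere of \<open>V\<close> on which the form is maximised is nonempty.\<close>
  have "\<not> card (UNIV :: 'n set) \<le> Suc 0"
    using card by simp
  then have "\<exists>i j::'n. i \<noteq> j"
    using card_le_Suc0_iff_eq[of "UNIV :: 'n set"] by auto
  then obtain i j :: 'n where "i \<noteq> j" by blast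
  define w :: "real^'n" where "w = axis i 1 - axis j 1"
  have w: "w \<in> V" "w \<noteq> 0"
  proof -
    show "w \<in> V" by (simp add: V_def w_def inner_diff_right inner_axis ones_def)
    have "w $ i = 1" using \<open>i \<noteq> j\<close> by (simp add: w_def axis_def)
    then show "w \<noteq> 0" by auto
  qed
  let ?K = "sphere 0 1 \<inter> V"
  have "compact ?K"
    unfolding V_def by (intro compact_Int_closed compact_sphere closed_hyperplane)
  moreover have "(1 / norm w) *\<^sub>R w \<in> ?K"
    using w V by (auto intro: subspace_scale)
  then have "?K \<noteq> {}" by blast
  moreover have "continuous_on ?K (\<lambda>y. y \<bullet> (S *v y))"
    by (intro continuous_intros matrix_vector_mult_linear_continuous_on)
  ultimately obtain y0 where y0: "y0 \<in> ?K" and max: "\<And>y. y \<in> ?K \<Longrightarrow> y \<bullet> (S *v y) \<le> y0 \<bullet> (S *v y0)"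
    using continuous_attains_sup[of ?K "\<lambda>y. y \<bullet> (S *v y)"] by blast
  define \<mu> where "\<mu> = y0 \<bullet> (S *v y0)"
  have y0n: "y0 \<bullet> y0 = 1" "y0 \<noteq> 0"
    using y0 by (auto simp: dot_square_norm)
  have le: "y \<bullet> (S *v y) \<le> \<mu> * (y \<bullet> y)" if "y \<in> V" for y
  proof (cases "y = 0")
    case False
    have "(1 / norm y) *\<^sub>R y \<in> ?K"
      using that False V by (auto intro: subspace_scale)
    from max[OF this] have "(y \<bullet> (S *v y)) / (norm y)\<^sup>2 \<le> \<mu>"
      by (simp add: \<mu>_def matrix_vector_mult_scaleR power2_eq_square)
    then show ?thesis
      using False by (simp add: divide_le_eq dot_square_norm mult.commute)
  qed simp
  have "S *v y0 = \<mu> *\<^sub>R y0"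
    using y0 y0n sym inv V le by (intro eigenvector_of_max_quadratic_form[of S V]) (auto simp: \<mu>_def)
  then have "is_eigenvalue S \<mu>"
    unfolding is_eigenvalue_def using y0n by auto
  moreover have "\<mu> < 0"
    using neg[of y0] y0 y0n by (auto simp: \<mu>_def V_def)
  ultimately have \<mu>: "\<mu> \<in> {l. is_eigenvalue S l \<and> l < 0}" by simp
  have fin': "finite {l. is_eigenvalue S l \<and> l < 0}"
    using fin by (rule rev_finite_subset) auto
  have "Max {l. is_eigenvalue S l \<and> l < 0} \<in> {l. is_eigenvalue S l \<and> l < 0}"
    using \<mu> fin' by (intro Max_in) auto
  then show "second_largest_eigenvalue S < 0"
    unfolding second by blast
  \<comment> \<open>The maximum of the form on the unit sphere of \<open>V\<close> is itself a
    negative eigenvalue, so the \<open>Max\<close> over these dominates it.\<close>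
  have "\<mu> \<le> second_largest_eigenvalue S"
    unfolding second using \<mu> fin' by simp
  then show "y \<bullet> (S *v y) \<le> second_largest_eigenvalue S * (norm y)\<^sup>2" if "ones \<bullet> y = 0" for y
    using le[of y] that mult_right_mono[of \<mu> "second_largest_eigenvalue S" "y \<bullet> y"]
    unfolding V_def by (simp add: dot_square_norm)
qed

section \<open>Gaussian moments\<close>

text \<open>The coordinates of a centred Gaussian with covariance \<open>h\<close> times the
  identity are independent; this factorisation reduces all moments to those of
  \<open>normal_density\<close>.\<close>

lemma gauss_density_eq_prod:
  fixes x :: "real^'n"
  assumes h: "h > 0"
  shows "gauss_density h x = (\<Prod>b\<in>Basis. normal_density 0 (sqrt h) (x \<bullet> b))"
proof -
  have norm2: "(norm x)\<^sup>2 = (\<Sum>b\<in>Basis. (x \<bullet> b)\<^sup>2)"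
    unfolding power2_norm_eq_inner euclidean_inner[of x x] by (simp add: power2_eq_square)
  have "(\<Prod>b\<in>Basis. normal_density 0 (sqrt h) (x \<bullet> b))
      = (1 / sqrt (2 * pi * h)) ^ CARD('n) * exp (\<Sum>b\<in>Basis. - ((x \<bullet> b)\<^sup>2 / (2 * h)))"
    using h by (simp add: normal_density_def prod.distrib exp_sum real_sqrt_mult power_mult_distrib power_divide prod_dividef)
  also have "(\<Sum>b\<in>Basis. - ((x \<bullet> b)\<^sup>2 / (2 * h))) = - ((norm x)\<^sup>2 / (2 * h))"
    by (simp add: sum_negf sum_divide_distrib [symmetric] norm2)
  also have "(1 / sqrt (2 * pi * h)) ^ CARD('n) = (2 * pi * h) powr (- real CARD('n) / 2)"
  proof -
    have "(1 / sqrt (2 * pi * h)) ^ CARD('n) = ((2 * pi * h) powr (-(1/2))) powr real CARD('n)"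
      using h by (simp add: powr_minus powr_half_sqrt powr_realpow field_simps)
    then show ?thesis by (simp add: powr_powr)
  qed
  finally show ?thesis unfolding gauss_density_def by simp
qed

lemma borel_measurable_gauss_density [measurable]:
  "(gauss_density h :: real^'n \<Rightarrow> real) \<in> borel_measurable borel"
  unfolding gauss_density_def[abs_def] by measurable

lemma gauss_density_nonneg: "0 \<le> gauss_density h x"
  unfolding gauss_density_def by simp

text \<open>Fubini for a factorised density: \<open>lborel\<close> is the image of a product of
  one-dimensional Lebesgue measures under the coordinate map \<open>?T\<close>, so the moment of a
  monomial is a product of one-dimensional moments.\<close>

lemma has_bochner_integral_gauss_monomial:
  fixes k :: "real^'n \<Rightarrow> nat"
  assumes h: "h > 0"
    and m: "\<And>b. b \<in> Basis \<Longrightarrow> (\<integral>y. normal_density 0 (sqrt h) y * y ^ k b \<partial>lborel) = m b"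
  shows "has_bochner_integral (density lborel (\<lambda>x. ennreal (gauss_density h x)))
           (\<lambda>x. \<Prod>b\<in>Basis. (x \<bullet> b) ^ k b) (\<Prod>b\<in>Basis. m b)"
proof -
  interpret product_sigma_finite "\<lambda>_::real^'n. lborel :: real measure"
    by standard
  let ?g = "\<lambda>b y. normal_density 0 (sqrt h) y * y ^ k b"
  let ?T = "\<lambda>f. \<Sum>b\<in>Basis. f b *\<^sub>R b :: real^'n"
  have int: "integrable lborel (?g b)" for b
    using integrable_normal_moment[of "sqrt h" 0 "k b"] h by simp
  have T: "?T f \<bullet> b = f b" if "b \<in> Basis" for f b
    using that by (simp add: inner_sum_left inner_Basis if_distrib sum.delta cong: if_cong)
  have "has_bochner_integral (Pi\<^sub>M Basis (\<lambda>_. lborel))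
      (\<lambda>f. \<Prod>b\<in>Basis. ?g b (f b)) (\<Prod>b\<in>Basis. m b)"
    using product_integrable_prod[of Basis ?g] product_integral_prod[of Basis ?g] int m
    by (simp add: has_bochner_integral_iff)
  then have "has_bochner_integral (Pi\<^sub>M Basis (\<lambda>_. lborel))
      (\<lambda>f. \<Prod>b\<in>Basis. ?g b (?T f \<bullet> b)) (\<Prod>b\<in>Basis. m b)"
    by (simp add: T cong: prod.cong)
  then have "has_bochner_integral lborel
      (\<lambda>x::real^'n. \<Prod>b\<in>Basis. ?g b (x \<bullet> b)) (\<Prod>b\<in>Basis. m b)"
    by (subst lborel_eq) (simp add: has_bochner_integral_distr)
  then show ?thesis
    using gauss_density_nonneg[of h]
    by (intro has_bochner_integral_density) (auto simp: gauss_density_eq_prod[OF h] prod.distrib)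
qed

text \<open>The first moment kills the linear Taylor term, the covariances produce the second-order
  term of the generator, and the fourth moment bounds the remainder.\<close>

lemma
  fixes i :: "'n::finite"
  assumes h: "h > 0"
  defines "N \<equiv> density lborel (\<lambda>x::real^'n. ennreal (gauss_density h x))"
  shows gauss_moment1: "has_bochner_integral N (\<lambda>x. x $ i) 0"
    and gauss_moment2: "has_bochner_integral N (\<lambda>x. x $ i * x $ j) (if i = j then h else 0)"
    and gauss_moment4: "has_bochner_integral N (\<lambda>x. (x $ i) ^ 4) (3 * h\<^sup>2)"
proof -
  have s: "sqrt h > 0" using h by simp
  have m0: "(\<integral>y. normal_density 0 (sqrt h) y * y ^ 0 \<partial>lborel) = 1"
    using s by simp
  have m1: "(\<integral>y. normal_density 0 (sqrt h) y * y ^ 1 \<partial>lborel) = 0"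
    using integral_normal_moment_odd[OF s, of 0 0] by simp
  have m2: "(\<integral>y. normal_density 0 (sqrt h) y * y ^ 2 \<partial>lborel) = h"
    using integral_normal_moment_even[OF s, of 0 1] h by (simp add: power2_eq_square)
  have m4: "(\<integral>y. normal_density 0 (sqrt h) y * y ^ 4 \<partial>lborel) = 3 * h\<^sup>2"
    using integral_normal_moment_even[OF s, of 0 2] h by (simp add: fact_numeral power2_eq_square)
  have delta: "(\<Prod>b\<in>Basis. c b ^ (if b = axis i 1 then k else 0)) = c (axis i 1) ^ k"
    for c :: "real^'n \<Rightarrow> real" and k :: nat
    by (simp add: if_distrib prod.delta axis_in_Basis_iff cong: if_cong)
  have delta': "(\<Prod>b\<in>Basis. if b = (axis i 1 :: real^'n) then c else 1) = c" for c :: real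
    by (simp add: prod.delta axis_in_Basis_iff)
  show "has_bochner_integral N (\<lambda>x. x $ i) 0"
    using has_bochner_integral_gauss_monomial[OF h, of "\<lambda>b. if b = axis i 1 then 1 else 0"
      "\<lambda>b. if b = axis i 1 then 0 else 1"] m0 m1
    unfolding delta delta' N_def by (simp add: inner_axis)
  show "has_bochner_integral N (\<lambda>x. (x $ i) ^ 4) (3 * h\<^sup>2)"
    using has_bochner_integral_gauss_monomial[OF h, of "\<lambda>b. if b = axis i 1 then 4 else 0"
      "\<lambda>b. if b = axis i 1 then 3 * h\<^sup>2 else 1"] m0 m4
    unfolding delta delta' N_def by (simp add: inner_axis)
  show "has_bochner_integral N (\<lambda>x. x $ i * x $ j) (if i = j then h else 0)"
  proof (cases "i = j")
    case True
    then show ?thesis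
      using has_bochner_integral_gauss_monomial[OF h, of "\<lambda>b. if b = axis i 1 then 2 else 0"
        "\<lambda>b. if b = axis i 1 then h else 1"] m0 m2
      unfolding delta delta' N_def by (simp add: inner_axis power2_eq_square)
  next
    case False
    let ?P = "\<lambda>b::real^'n. b = axis i 1 \<or> b = axis j 1"
    have ne: "axis i (1::real) \<noteq> axis j 1"
      using False by (simp add: axis_eq_axis)
    have eq1: "(\<Prod>b\<in>Basis. (x \<bullet> b) ^ (if ?P b then 1 else 0)) = x $ i * x $ j" for x :: "real^'n"
    proof -
      have "(\<Prod>b\<in>Basis. (x \<bullet> b) ^ (if ?P b then 1 else 0))
          = (\<Prod>b\<in>{axis i 1, axis j 1}. (x \<bullet> b) ^ (if ?P b then 1 else 0))"
        by (rule prod.mono_neutral_right) (auto simp: axis_in_Basis_iff)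
      then show ?thesis using ne by (simp add: inner_axis)
    qed
    have eq2: "(\<Prod>b\<in>Basis. if ?P b then 0 else 1 :: real) = 0"
      by (rule prod_zero) (auto simp: axis_in_Basis_iff intro!: bexI[of _ "axis i 1"])
    have "has_bochner_integral N (\<lambda>x. \<Prod>b\<in>Basis. (x \<bullet> b) ^ (if ?P b then 1 else 0))
        (\<Prod>b\<in>Basis. if ?P b then 0 else 1)"
      unfolding N_def using m0 m1 by (intro has_bochner_integral_gauss_monomial h) auto
    then show ?thesis
      unfolding eq1 eq2 using False by simp
  qed
qed

section \<open>Brownian increments\<close>

lemma borel_measurable_vec_nth [measurable (raw)]:
  fixes f :: "'a \<Rightarrow> real^'n"
  assumes "f \<in> borel_measurable M"
  shows "(\<lambda>x. f x $ i) \<in> borel_measurable M"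
proof -
  have "(\<lambda>x. f x \<bullet> axis i 1) \<in> borel_measurable M"
    using assms by measurable
  then show ?thesis by (simp add: inner_axis)
qed

locale brownian_motion = prob_space M for M :: "'a measure" +
  fixes F :: "real \<Rightarrow> 'a measure" and W :: "real \<Rightarrow> 'a \<Rightarrow> real^'n"
  assumes filtration: "is_filtration M F" and brownian: "is_brownian_motion M F W"
begin

lemma filtration_measurable: "f \<in> measurable (F s) N \<Longrightarrow> f \<in> measurable M N"
  using filtration measurable_from_subalg unfolding is_filtration_def by blast

lemma filtration_mono:
  assumes "s \<le> r" "f \<in> measurable (F s) N"
  shows "f \<in> measurable (F r) N"
proof (rule measurable_from_subalg[OF _ assms(2)])
  show "subalgebra (F r) (F s)"
    using filtration assms(1) unfolding is_filtration_def subalgebra_def by auto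
qed

lemma W_measurable: "0 \<le> s \<Longrightarrow> W s \<in> borel_measurable (F s)"
  using brownian unfolding is_brownian_motion_def by blast

lemma increment_measurable:
  assumes "0 \<le> s" "0 \<le> r"
  shows "(\<lambda>\<omega>. W r \<omega> - W s \<omega>) \<in> borel_measurable M"
  using assms by (intro borel_measurable_diff filtration_measurable[OF W_measurable]) auto

lemma increment_prob:
  assumes "0 \<le> s" "s < r" "E \<in> sets (F s)" "B \<in> sets borel"
  shows "prob (E \<inter> {\<omega> \<in> space M. W r \<omega> - W s \<omega> \<in> B}) =
    prob E * measure (density lborel (\<lambda>x. ennreal (gauss_density (r - s) x))) B"
  using brownian assms unfolding is_brownian_motion_def by blast

lemma space_in_filtration: "space M \<in> sets (F s)"
  using filtration sets.top[of "F s"] unfolding is_filtration_def subalgebra_def by simp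

lemma increment_distr:
  assumes s: "0 \<le> s" "s < r"
  shows "distr M borel (\<lambda>\<omega>. W r \<omega> - W s \<omega>) = density lborel (\<lambda>x. ennreal (gauss_density (r - s) x))"
    (is "?D = ?N")
proof -
  have meas: "(\<lambda>\<omega>. W r \<omega> - W s \<omega>) \<in> borel_measurable M"
    using s by (intro increment_measurable) auto
  have eq: "measure ?N B = measure ?D B" if "B \<in> sets borel" for B
  proof -
    have "measure ?D B = prob (space M \<inter> {\<omega> \<in> space M. W r \<omega> - W s \<omega> \<in> B})"
      using meas that by (auto simp: measure_distr intro!: arg_cong[where f = prob])
    also have "\<dots> = measure ?N B"
      using increment_prob[OF s space_in_filtration that] by (simp add: prob_space)
    finally show ?thesis ..
  qed
  interpret D: prob_space ?D
    using meas by (rule prob_space_distr)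
  have "measure ?N UNIV = 1"
    using eq[of UNIV] D.prob_space by simp
  \<comment> \<open>\<open>measure\<close> takes the default value 0 on sets of infinite mass, so
    the value 1 already excludes an infinite total mass.\<close>
  then have "emeasure ?N UNIV \<noteq> \<infinity>"
    by (auto simp: measure_def)
  then interpret N: finite_measure ?N
    by (intro finite_measureI) simp
  show ?thesis
    by (rule measure_eqI) (auto simp: N.emeasure_eq_measure D.emeasure_eq_measure eq)
qed

text \<open>\<open>is_brownian_motion\<close> expresses independence of the past as a product
  formula for events of \<open>F s\<close>. The preimages of Borel sets already form a
  sigma-algebra, so the formula on them is the independence of the two random variables.\<close>

lemma increment_indep:
  fixes G :: "'a \<Rightarrow> 'b::topological_space" and g :: "real^'n \<Rightarrow> 'b"
  assumes s: "0 \<le> s" "s < r" and G: "G \<in> borel_measurable (F s)" and g: "g \<in> borel_measurable borel"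
  shows "indep_var borel G borel (\<lambda>\<omega>. g (W r \<omega> - W s \<omega>))"
proof -
  let ?w = "\<lambda>\<omega>. g (W r \<omega> - W s \<omega>)"
  have w: "?w \<in> borel_measurable M"
    using s by (intro measurable_compose[OF increment_measurable g]) auto
  have GM: "G \<in> borel_measurable M"
    using G by (rule filtration_measurable)
  have sp: "space (F s) = space M"
    using filtration unfolding is_filtration_def subalgebra_def by simp
  have 1: "sigma_sets (space M) {f -` A \<inter> space M |A. A \<in> sets borel} = {f -` A \<inter> space M |A. A \<in> sets borel}"
    for f :: "'a \<Rightarrow> 'b"
    using sigma_sets_vimage_commute[of f "space M" UNIV "sets borel"] sets.sigma_sets_eq[of "borel :: 'b measure"]
    by (simp add: space_borel)
  have "prob (a \<inter> b) = prob a * prob b"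
    if "a \<in> {G -` A \<inter> space M |A. A \<in> sets borel}" "b \<in> {?w -` A \<inter> space M |A. A \<in> sets borel}" for a b
  proof -
    obtain A B where AB: "A \<in> sets borel" "a = G -` A \<inter> space M" "B \<in> sets borel" "b = ?w -` B \<inter> space M"
      using \<open>a \<in> _\<close> \<open>b \<in> _\<close> by blast
    have b: "b = {\<omega> \<in> space M. W r \<omega> - W s \<omega> \<in> g -` B}" using AB by auto
    have B: "g -` B \<in> sets borel"
      using measurable_sets[OF g AB(3)] by simp
    have "a \<in> sets (F s)"
      using measurable_sets[OF G AB(1)] AB(2) sp by simp
    \<comment> \<open>The second instance, with the whole space as past event, identifies the
      Gaussian factor with \<open>prob b\<close>.\<close>
    from increment_prob[OF s this B] increment_prob[OF s space_in_filtration B]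
    show ?thesis
      unfolding b by (simp add: prob_space Int_absorb1)
  qed
  then show ?thesis
    unfolding indep_var_eq 1 using w GM
    by (intro conjI indep_setI) (auto intro: measurable_sets)
qed

text \<open>Integrated form of the rule that a factor known at time \<open>s\<close> leaves the
  conditional expectation. The moment lemmas below are instances, with a suitable weight
  \<open>G\<close> and a Gaussian moment \<open>v\<close>.\<close>

lemma has_bochner_integral_increment:
  fixes G :: "'a \<Rightarrow> real" and g :: "real^'n \<Rightarrow> real"
  assumes s: "0 \<le> s" "s < r" and G: "G \<in> borel_measurable (F s)" "integrable M G"
    and g: "has_bochner_integral (density lborel (\<lambda>x. ennreal (gauss_density (r - s) x))) g v"
  shows "has_bochner_integral M (\<lambda>\<omega>. G \<omega> * g (W r \<omega> - W s \<omega>)) (expectation G * v)"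
proof -
  let ?w = "\<lambda>\<omega>. W r \<omega> - W s \<omega>"
  have w: "?w \<in> borel_measurable M"
    using s by (intro increment_measurable) auto
  have gm: "g \<in> borel_measurable borel"
    using borel_measurable_has_bochner_integral[OF g] by simp
  have "has_bochner_integral (distr M borel ?w) g v"
    using g increment_distr[OF s] by simp
  then have gw: "has_bochner_integral M (\<lambda>\<omega>. g (?w \<omega>)) v"
    unfolding has_bochner_integral_iff integrable_distr_eq[OF w gm] integral_distr[OF w gm] .
  have "indep_var borel G borel (\<lambda>\<omega>. g (?w \<omega>))"
    using s G(1) gm by (rule increment_indep)
  from indep_var_lebesgue_integral[OF this G(2)] indep_var_integrable[OF this G(2)] gw
  show ?thesis by (simp add: has_bochner_integral_iff)
qed

text \<open>In each coordinate the bounded factor \<open>c \<omega> $ i\<close> is absorbed into the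
  past weight, and the remaining increment has mean zero.\<close>

lemma increment_inner_moment1:
  fixes G :: "'a \<Rightarrow> real"
  assumes s: "0 \<le> s" "s < r" and G: "G \<in> borel_measurable (F s)" "integrable M G"
    and c: "c \<in> borel_measurable (F s)" "\<And>\<omega>. \<omega> \<in> space M \<Longrightarrow> norm (c \<omega>) \<le> K"
  shows "has_bochner_integral M (\<lambda>\<omega>. G \<omega> * (c \<omega> \<bullet> (W r \<omega> - W s \<omega>))) 0"
proof -
  have h: "r - s > 0" using s by simp
  have cM [measurable]: "c \<in> borel_measurable M" using c(1) by (rule filtration_measurable)
  have "has_bochner_integral M (\<lambda>\<omega>. (G \<omega> * c \<omega> $ i) * (W r \<omega> - W s \<omega>) $ i) 0" for i
  proof -
    have "integrable M (\<lambda>\<omega>. G \<omega> * c \<omega> $ i)"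
    proof (rule Bochner_Integration.integrable_bound)
      show "integrable M (\<lambda>\<omega>. K * G \<omega>)" using G by simp
      show "(\<lambda>\<omega>. G \<omega> * c \<omega> $ i) \<in> borel_measurable M"
        using borel_measurable_integrable[OF G(2)] by measurable
      show "AE \<omega> in M. norm (G \<omega> * c \<omega> $ i) \<le> norm (K * G \<omega>)"
      proof (rule AE_I2)
        fix \<omega> assume "\<omega> \<in> space M"
        then have "\<bar>c \<omega> $ i\<bar> \<le> \<bar>K\<bar>"
          using c(2)[of \<omega>] component_le_norm_cart[of "c \<omega>" i] by linarith
        then show "norm (G \<omega> * c \<omega> $ i) \<le> norm (K * G \<omega>)"
          using mult_right_mono[of "\<bar>c \<omega> $ i\<bar>" "\<bar>K\<bar>" "\<bar>G \<omega>\<bar>"] by (simp add: abs_mult mult.commute)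
      qed
    qed
    then show ?thesis
      using has_bochner_integral_increment[OF s _ _ gauss_moment1[OF h, of i], of "\<lambda>\<omega>. G \<omega> * c \<omega> $ i"] G c
      by simp
  qed
  then have "has_bochner_integral M (\<lambda>\<omega>. \<Sum>i\<in>UNIV. (G \<omega> * c \<omega> $ i) * (W r \<omega> - W s \<omega>) $ i) (\<Sum>i\<in>(UNIV::'n set). 0)"
    by (intro has_bochner_integral_sum)
  then show ?thesis
    by (simp add: inner_vec_def sum_distrib_left mult.assoc)
qed

text \<open>One step of the Ito isometry with a past weight: when the square is expanded, only the
  diagonal covariances survive.\<close>

lemma increment_inner_moment2:
  fixes G :: "'a \<Rightarrow> real"
  assumes s: "0 \<le> s" "s < r" and G: "G \<in> borel_measurable (F s)" "integrable M G"
    and c: "c \<in> borel_measurable (F s)" "\<And>\<omega>. \<omega> \<in> space M \<Longrightarrow> norm (c \<omega>) \<le> K"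
  shows "has_bochner_integral M (\<lambda>\<omega>. G \<omega> * (c \<omega> \<bullet> (W r \<omega> - W s \<omega>))\<^sup>2)
    ((r - s) * expectation (\<lambda>\<omega>. G \<omega> * (c \<omega> \<bullet> c \<omega>)))"
proof -
  have h: "r - s > 0" using s by simp
  have cM [measurable]: "c \<in> borel_measurable M" using c(1) by (rule filtration_measurable)
  have int: "integrable M (\<lambda>\<omega>. G \<omega> * (c \<omega> $ i * c \<omega> $ j))" for i j
  proof (rule Bochner_Integration.integrable_bound)
    show "integrable M (\<lambda>\<omega>. K\<^sup>2 * G \<omega>)" using G by simp
    show "(\<lambda>\<omega>. G \<omega> * (c \<omega> $ i * c \<omega> $ j)) \<in> borel_measurable M"
      using borel_measurable_integrable[OF G(2)] by measurable
    show "AE \<omega> in M. norm (G \<omega> * (c \<omega> $ i * c \<omega> $ j)) \<le> norm (K\<^sup>2 * G \<omega>)"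
    proof (rule AE_I2)
      fix \<omega> assume "\<omega> \<in> space M"
      then have "\<bar>c \<omega> $ i\<bar> \<le> K" "\<bar>c \<omega> $ j\<bar> \<le> K"
        using c(2)[of \<omega>] component_le_norm_cart[of "c \<omega>" i] component_le_norm_cart[of "c \<omega>" j] by linarith+
      then have "\<bar>c \<omega> $ i\<bar> * \<bar>c \<omega> $ j\<bar> \<le> K\<^sup>2"
        unfolding power2_eq_square by (intro mult_mono) auto
      then show "norm (G \<omega> * (c \<omega> $ i * c \<omega> $ j)) \<le> norm (K\<^sup>2 * G \<omega>)"
        using mult_left_mono[of "\<bar>c \<omega> $ i\<bar> * \<bar>c \<omega> $ j\<bar>" "K\<^sup>2" "\<bar>G \<omega>\<bar>"]
        by (simp add: abs_mult mult.commute)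
    qed
  qed
  have "has_bochner_integral M (\<lambda>\<omega>. (G \<omega> * (c \<omega> $ i * c \<omega> $ j)) * ((W r \<omega> - W s \<omega>) $ i * (W r \<omega> - W s \<omega>) $ j))
      (expectation (\<lambda>\<omega>. G \<omega> * (c \<omega> $ i * c \<omega> $ j)) * (if i = j then r - s else 0))" for i j
    using has_bochner_integral_increment[OF s _ int[of i j] gauss_moment2[OF h, of i j]] G c
    by simp
  then have "has_bochner_integral M
      (\<lambda>\<omega>. \<Sum>i\<in>UNIV. \<Sum>j\<in>UNIV. (G \<omega> * (c \<omega> $ i * c \<omega> $ j)) * ((W r \<omega> - W s \<omega>) $ i * (W r \<omega> - W s \<omega>) $ j))
      (\<Sum>i\<in>UNIV. \<Sum>j\<in>UNIV. expectation (\<lambda>\<omega>. G \<omega> * (c \<omega> $ i * c \<omega> $ j)) * (if i = j then r - s else 0))"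
    by (intro has_bochner_integral_sum)
  moreover have "(\<Sum>i\<in>UNIV. \<Sum>j\<in>UNIV. expectation (\<lambda>\<omega>. G \<omega> * (c \<omega> $ i * c \<omega> $ j)) * (if i = j then r - s else 0))
      = (r - s) * expectation (\<lambda>\<omega>. G \<omega> * (c \<omega> \<bullet> c \<omega>))"
    using int by (simp add: inner_vec_def sum_distrib_left Bochner_Integration.integral_sum if_distrib mult.commute cong: if_cong)
  moreover have eq: "(\<Sum>i\<in>UNIV. \<Sum>j\<in>UNIV. (g * (u $ i * u $ j)) * (v $ i * v $ j)) = g * (u \<bullet> v)\<^sup>2"
    for g :: real and u v :: "real^'n"
    by (simp add: inner_vec_def power2_eq_square sum_product sum_distrib_left algebra_simps)
  ultimately show ?thesis unfolding eq by simp
qed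

text \<open>Cauchy-Schwarz yields the factor \<open>K ^ 4\<close>. One factor
  \<open>real CARD('n)\<close> is lost in bounding the fourth power of the norm by the sum of fourth
  powers, the other comes from adding up the coordinate moments
  \<open>3 * (r - s)\<^sup>2\<close>.\<close>

lemma increment_inner_moment4:
  assumes s: "0 \<le> s" "s < r"
    and c: "c \<in> borel_measurable (F s)" "\<And>\<omega>. \<omega> \<in> space M \<Longrightarrow> norm (c \<omega>) \<le> K"
  shows "integrable M (\<lambda>\<omega>. (c \<omega> \<bullet> (W r \<omega> - W s \<omega>)) ^ 4)"
    and "expectation (\<lambda>\<omega>. (c \<omega> \<bullet> (W r \<omega> - W s \<omega>)) ^ 4) \<le> 3 * (real CARD('n))\<^sup>2 * K ^ 4 * (r - s)\<^sup>2"
proof -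
  have h: "r - s > 0" using s by simp
  let ?w = "\<lambda>\<omega>. W r \<omega> - W s \<omega>"
  have cM [measurable]: "c \<in> borel_measurable M" using c(1) by (rule filtration_measurable)
  have w: "?w \<in> borel_measurable M"
    using s by (intro increment_measurable) auto
  have "has_bochner_integral M (\<lambda>\<omega>. 1 * (?w \<omega> $ i) ^ 4) (expectation (\<lambda>_. 1) * (3 * (r - s)\<^sup>2))" for i
    by (rule has_bochner_integral_increment[OF s _ _ gauss_moment4[OF h, of i]]) auto
  then have "has_bochner_integral M (\<lambda>\<omega>. (?w \<omega> $ i) ^ 4) (3 * (r - s)\<^sup>2)" for i
    by (simp add: prob_space)
  then have *: "has_bochner_integral M (\<lambda>\<omega>. K ^ 4 * (real CARD('n) * (\<Sum>i\<in>UNIV. (?w \<omega> $ i) ^ 4)))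
      (K ^ 4 * (real CARD('n) * (\<Sum>i\<in>(UNIV::'n set). 3 * (r - s)\<^sup>2)))"
    by (intro has_bochner_integral_mult_right has_bochner_integral_sum)
  have le: "(c \<omega> \<bullet> ?w \<omega>) ^ 4 \<le> K ^ 4 * (real CARD('n) * (\<Sum>i\<in>UNIV. (?w \<omega> $ i) ^ 4))"
    if "\<omega> \<in> space M" for \<omega>
  proof -
    have "\<bar>c \<omega> \<bullet> ?w \<omega>\<bar> \<le> K * norm (?w \<omega>)"
      using Cauchy_Schwarz_ineq2[of "c \<omega>" "?w \<omega>"] c(2)[OF that]
      by (meson mult_right_mono norm_ge_zero order_trans)
    then have "\<bar>c \<omega> \<bullet> ?w \<omega>\<bar> ^ 4 \<le> (K * norm (?w \<omega>)) ^ 4"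
      by (intro power_mono) auto
    moreover have "norm (?w \<omega>) ^ 4 \<le> real CARD('n) * (\<Sum>i\<in>UNIV. (?w \<omega> $ i) ^ 4)"
    proof -
      have "norm (?w \<omega>) ^ 4 = (\<Sum>i\<in>UNIV. (?w \<omega> $ i)\<^sup>2)\<^sup>2"
        unfolding norm_vec_def L2_set_def
        by (simp add: power4_eq_xxxx power2_eq_square sum_nonneg)
      also have "\<dots> \<le> real CARD('n) * (\<Sum>i\<in>UNIV. ((?w \<omega> $ i)\<^sup>2)\<^sup>2)"
        using sum_squared_le_sum_of_squares[of "\<lambda>i. (?w \<omega> $ i)\<^sup>2" UNIV] by (simp add: mult.commute)
      finally show ?thesis by simp
    qed
    then have "K ^ 4 * norm (?w \<omega>) ^ 4 \<le> K ^ 4 * (real CARD('n) * (\<Sum>i\<in>UNIV. (?w \<omega> $ i) ^ 4))"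
      by (intro mult_left_mono) auto
    ultimately show ?thesis
      by (simp add: power_mult_distrib)
  qed
  show int: "integrable M (\<lambda>\<omega>. (c \<omega> \<bullet> ?w \<omega>) ^ 4)"
  proof (rule Bochner_Integration.integrable_bound)
    show "integrable M (\<lambda>\<omega>. K ^ 4 * (real CARD('n) * (\<Sum>i\<in>UNIV. (?w \<omega> $ i) ^ 4)))"
      using * by (rule integrable.intros)
    show "(\<lambda>\<omega>. (c \<omega> \<bullet> ?w \<omega>) ^ 4) \<in> borel_measurable M"
      using cM w by (intro borel_measurable_power borel_measurable_inner)
    show "AE \<omega> in M. norm ((c \<omega> \<bullet> ?w \<omega>) ^ 4)
        \<le> norm (K ^ 4 * (real CARD('n) * (\<Sum>i\<in>UNIV. (?w \<omega> $ i) ^ 4)))"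
      using le by (intro AE_I2) (smt (verit) real_norm_def zero_le_even_power even_numeral)
  qed
  have "expectation (\<lambda>\<omega>. (c \<omega> \<bullet> ?w \<omega>) ^ 4) \<le> K ^ 4 * (real CARD('n) * (\<Sum>i\<in>(UNIV::'n set). 3 * (r - s)\<^sup>2))"
    using integral_mono_AE[OF int, of "\<lambda>\<omega>. K ^ 4 * (real CARD('n) * (\<Sum>i\<in>UNIV. (?w \<omega> $ i) ^ 4))"] * le
    by (auto simp: has_bochner_integral_iff)
  then show "expectation (\<lambda>\<omega>. (c \<omega> \<bullet> ?w \<omega>) ^ 4) \<le> 3 * (real CARD('n))\<^sup>2 * K ^ 4 * (r - s)\<^sup>2"
    by (simp add: power2_eq_square algebra_simps)
qed

end

section \<open>Riemann sums, Taylor bounds and square-integrable random variables\<close>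

lemma integral_uniform_partition:
  fixes f :: "real \<Rightarrow> real"
  assumes f: "f integrable_on {0..t}" and t: "t \<ge> 0" and m: "m \<le> N"
  shows "integral {0..real m * t / real N} f
    = (\<Sum>k<m. integral {real k * t / real N..real (Suc k) * t / real N} f)"
  using m
proof (induction m)
  case (Suc m)
  let ?s = "\<lambda>k. real k * t / real N"
  have le: "?s m \<le> ?s (Suc m)"
    using t by (intro divide_right_mono mult_right_mono) auto
  have "real (Suc m) * t \<le> real N * t"
    using Suc.prems t by (intro mult_right_mono) auto
  then have "?s (Suc m) \<le> t"
    using Suc.prems by (simp add: divide_le_eq mult.commute)
  then have "f integrable_on {0..?s (Suc m)}"
    using f by (auto intro: integrable_on_subinterval)
  moreover have "0 \<le> ?s m" using t by simp
  ultimately have "integral {0..?s m} f + integral {?s m..?s (Suc m)} f = integral {0..?s (Suc m)} f"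
    using le by (intro Henstock_Kurzweil_Integration.integral_combine) auto
  then show ?case using Suc by simp
qed simp

lemma abs_integral_le:
  fixes f :: "real \<Rightarrow> real"
  assumes "a \<le> b" "continuous_on {a..b} f" "\<And>x. x \<in> {a..b} \<Longrightarrow> \<bar>f x\<bar> \<le> B"
  shows "\<bar>integral {a..b} f\<bar> \<le> B * (b - a)"
  using integral_bound[of a b f B] assms by simp

text \<open>Since \<open>h\<close> is integrated exactly over each cell, only the oscillation of
  \<open>g\<close> has to be controlled, by uniform continuity. The case \<open>h = 1\<close> gives
  ordinary left-endpoint sums; for the drift term, \<open>h\<close> is the drift.\<close>

lemma Riemann_Stieltjes_sum_tendsto:
  fixes g h :: "real \<Rightarrow> real"
  assumes t: "t \<ge> 0" and g: "continuous_on {0..t} g" and h: "continuous_on {0..t} h"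
  shows "(\<lambda>N. \<Sum>k<N. g (real k * t / real N) *
      integral {real k * t / real N..real (Suc k) * t / real N} h)
    \<longlonglongrightarrow> integral {0..t} (\<lambda>u. g u * h u)"
proof (rule LIMSEQ_I)
  fix e :: real assume e: "e > 0"
  have "bounded (h ` {0..t})"
    using h by (intro compact_imp_bounded compact_continuous_image) auto
  then obtain B where B: "B > 0" "\<And>u. u \<in> {0..t} \<Longrightarrow> \<bar>h u\<bar> \<le> B"
    unfolding bounded_pos by auto
  \<comment> \<open>The total error will be \<open>e' * B * t\<close>, that is
    \<open>(e / 2) * (t / (t + 1))\<close>; the shift \<open>t + 1\<close> covers
    \<open>t = 0\<close>.\<close>
  define e' where "e' = e / (2 * B * (t + 1))"
  have e': "e' > 0" using e B t by (simp add: e'_def)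
  have "uniformly_continuous_on {0..t} g"
    using g by (intro compact_uniformly_continuous) auto
  then obtain d where d: "d > 0"
    and d': "\<And>u v. u \<in> {0..t} \<Longrightarrow> v \<in> {0..t} \<Longrightarrow> dist v u < d \<Longrightarrow> dist (g v) (g u) < e'"
    using e' unfolding uniformly_continuous_on_def by blast
  obtain N0 where N0: "real N0 > t / d" using reals_Archimedean2 by blast
  show "\<exists>no. \<forall>N\<ge>no. norm ((\<Sum>k<N. g (real k * t / real N) *
      integral {real k * t / real N..real (Suc k) * t / real N} h) - integral {0..t} (\<lambda>u. g u * h u)) < e"
  \<comment> \<open>The successor guarantees a positive number of cells.\<close>
  proof (intro exI[of _ "Suc N0"] allI impI)
    fix N assume N: "N \<ge> Suc N0"
    let ?s = "\<lambda>k. real k * t / real N"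
    have Npos: "real N > 0" using N by simp
    have "t / d < real N" using N N0 by simp
    then have mesh: "t / real N < d" using Npos d by (simp add: field_simps)
    have s0: "0 \<le> ?s k" for k using t by simp
    have sle: "?s k \<le> ?s (Suc k)" for k
      using t by (intro divide_right_mono mult_right_mono) auto
    have st: "?s (Suc k) \<le> t" if "k < N" for k
    proof -
      have "real (Suc k) * t \<le> real N * t"
        using that t by (intro mult_right_mono) auto
      then show ?thesis using Npos by (simp add: divide_le_eq mult.commute)
    qed
    have step: "?s (Suc k) - ?s k = t / real N" for k
      by (simp add: field_simps add_divide_distrib)
    have sub: "{?s k..?s (Suc k)} \<subseteq> {0..t}" if "k < N" for k
      using s0[of k] st[OF that] by auto
    have gh: "continuous_on {0..t} (\<lambda>u. g u * h u)"
      using g h by (rule continuous_on_mult)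
    have "integral {0..t} (\<lambda>u. g u * h u) = (\<Sum>k<N. integral {?s k..?s (Suc k)} (\<lambda>u. g u * h u))"
      using integral_uniform_partition[OF integrable_continuous_interval[OF gh] t, of N N] Npos by simp
    then have "\<bar>(\<Sum>k<N. g (?s k) * integral {?s k..?s (Suc k)} h) - integral {0..t} (\<lambda>u. g u * h u)\<bar>
        = \<bar>\<Sum>k<N. g (?s k) * integral {?s k..?s (Suc k)} h - integral {?s k..?s (Suc k)} (\<lambda>u. g u * h u)\<bar>"
      by (simp add: sum_subtractf)
    also have "\<dots> \<le> (\<Sum>k<N. \<bar>g (?s k) * integral {?s k..?s (Suc k)} h - integral {?s k..?s (Suc k)} (\<lambda>u. g u * h u)\<bar>)"
      by (rule sum_abs)
    also have "\<dots> \<le> (\<Sum>k<N. e' * B * (t / real N))"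
    proof (rule sum_mono)
      fix k assume "k \<in> {..<N}"
      then have k: "k < N" by simp
      have hk: "continuous_on {?s k..?s (Suc k)} h" and gk: "continuous_on {?s k..?s (Suc k)} g"
        using continuous_on_subset[OF h sub[OF k]] continuous_on_subset[OF g sub[OF k]] by auto
      have "g (?s k) * integral {?s k..?s (Suc k)} h - integral {?s k..?s (Suc k)} (\<lambda>u. g u * h u)
          = integral {?s k..?s (Suc k)} (\<lambda>u. g (?s k) * h u) - integral {?s k..?s (Suc k)} (\<lambda>u. g u * h u)"
        by simp
      also have "\<dots> = integral {?s k..?s (Suc k)} (\<lambda>u. g (?s k) * h u - g u * h u)"
        using hk gk
        by (intro integral_diff[symmetric] integrable_continuous_interval continuous_intros) auto
      finally have eq: "g (?s k) * integral {?s k..?s (Suc k)} h - integral {?s k..?s (Suc k)} (\<lambda>u. g u * h u)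
          = integral {?s k..?s (Suc k)} (\<lambda>u. g (?s k) * h u - g u * h u)" .
      have "\<bar>integral {?s k..?s (Suc k)} (\<lambda>u. g (?s k) * h u - g u * h u)\<bar> \<le> e' * B * (?s (Suc k) - ?s k)"
      proof (rule abs_integral_le)
        show "continuous_on {?s k..?s (Suc k)} (\<lambda>u. g (?s k) * h u - g u * h u)"
          using hk gk by (intro continuous_intros)
        fix u assume u: "u \<in> {?s k..?s (Suc k)}"
        then have ut: "u \<in> {0..t}" "?s k \<in> {0..t}" using sub[OF k] sle[of k] by auto
        have "dist (?s k) u < d" using u step[of k] mesh by (auto simp: dist_real_def)
        from d'[OF ut this] have "\<bar>g (?s k) - g u\<bar> \<le> e'" by (simp add: dist_real_def)
        then have "\<bar>g (?s k) - g u\<bar> * \<bar>h u\<bar> \<le> e' * B"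
          using B(2)[OF ut(1)] e' by (intro mult_mono) auto
        then show "\<bar>g (?s k) * h u - g u * h u\<bar> \<le> e' * B"
          by (simp add: abs_mult left_diff_distrib[symmetric])
      qed (use sle in auto)
      then show "\<bar>g (?s k) * integral {?s k..?s (Suc k)} h - integral {?s k..?s (Suc k)} (\<lambda>u. g u * h u)\<bar>
          \<le> e' * B * (t / real N)"
        unfolding eq step .
    qed
    also have "\<dots> = e' * B * t" using Npos by simp
    also have "\<dots> < e"
    proof -
      have "e' * B * t = (e / 2) * (t / (t + 1))" using B t by (simp add: e'_def)
      also have "\<dots> \<le> (e / 2) * 1" using e t by (intro mult_left_mono) auto
      also have "\<dots> < e" using e by simp
      finally show ?thesis .
    qed
    finally show "norm ((\<Sum>k<N. g (?s k) * integral {?s k..?s (Suc k)} h) - integral {0..t} (\<lambda>u. g u * h u)) < e"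
      by simp
  qed
qed

text \<open>Lagrange remainder of order three for the shifted function
  \<open>\<lambda>y. f (z + y)\<close>. The quadratic term is kept exactly because it becomes the
  Ito correction.\<close>

lemma taylor_order2_bound:
  fixes f f' f'' f''' :: "real \<Rightarrow> real"
  assumes d: "\<And>y. (f has_real_derivative f' y) (at y)" "\<And>y. (f' has_real_derivative f'' y) (at y)"
    "\<And>y. (f'' has_real_derivative f''' y) (at y)" and B: "\<And>y. \<bar>f''' y\<bar> \<le> L"
  shows "\<bar>f (z + u) - f z - f' z * u - f'' z * u\<^sup>2 / 2\<bar> \<le> L * \<bar>u\<bar> ^ 3 / 6"
proof -
  define D where "D = (\<lambda>(m::nat) y. if m = 0 then f (z + y) else if m = 1 then f' (z + y)
    else if m = 2 then f'' (z + y) else f''' (z + y))"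
  have dd: "((\<lambda>y. g (z + y)) has_real_derivative g' (z + y)) (at y)"
    if "\<And>y. (g has_real_derivative g' y) (at y)" for g g' :: "real \<Rightarrow> real" and y
    using DERIV_at_within_shift[of g "g' (z + y)" z y UNIV] that by (simp add: surj_def) 
  have "\<exists>v. \<bar>v\<bar> \<le> \<bar>u\<bar> \<and> D 0 u = (\<Sum>m<3. D m 0 / fact m * u ^ m) + D 3 v / fact 3 * u ^ 3"
  proof (rule Maclaurin_bi_le)
    show "\<forall>m y. m < 3 \<and> \<bar>y\<bar> \<le> \<bar>u\<bar> \<longrightarrow> (D m has_real_derivative D (Suc m) y) (at y)"
    proof (intro allI impI)
      fix m :: nat and y :: real assume "m < 3 \<and> \<bar>y\<bar> \<le> \<bar>u\<bar>"
      then consider "m = 0" | "m = 1" | "m = 2" by linarith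
      then show "(D m has_real_derivative D (Suc m) y) (at y)"
        by cases (simp_all add: D_def dd d)
    qed
  qed simp
  then obtain v where "D 0 u = (\<Sum>m<3. D m 0 / fact m * u ^ m) + D 3 v / fact 3 * u ^ 3" by blast
  then have "f (z + u) - f z - f' z * u - f'' z * u\<^sup>2 / 2 = f''' (z + v) * u ^ 3 / 6"
    by (simp add: D_def eval_nat_numeral lessThan_Suc fact_numeral)
  moreover have "\<bar>f''' (z + v) * u ^ 3 / 6\<bar> \<le> L * \<bar>u\<bar> ^ 3 / 6"
    using B[of "z + v"] by (simp add: abs_mult power_abs mult_right_mono)
  ultimately show ?thesis by (simp only:)
qed

section \<open>Second moments and the Cauchy-Schwarz inequality\<close>

context prob_space
begin

definition square_integrable :: "('a \<Rightarrow> real) \<Rightarrow> bool" where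
  "square_integrable f \<longleftrightarrow> f \<in> borel_measurable M \<and> integrable M (\<lambda>\<omega>. (f \<omega>)\<^sup>2)"

lemma square_integrable_bounded:
  assumes [measurable]: "f \<in> borel_measurable M" and "\<And>\<omega>. \<omega> \<in> space M \<Longrightarrow> \<bar>f \<omega>\<bar> \<le> B"
  shows "square_integrable f"
  unfolding square_integrable_def
proof
  have "(f \<omega>)\<^sup>2 \<le> B\<^sup>2" if "\<omega> \<in> space M" for \<omega>
    using power_mono[OF assms(2)[OF that], of 2] by simp
  then show "integrable M (\<lambda>\<omega>. (f \<omega>)\<^sup>2)"
    by (intro integrable_const_bound[where B = "B\<^sup>2"]) auto
qed fact

lemma square_integrable_mult:
  assumes "square_integrable f" "square_integrable g"
  shows "integrable M (\<lambda>\<omega>. f \<omega> * g \<omega>)"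
proof (rule Bochner_Integration.integrable_bound)
  show "integrable M (\<lambda>\<omega>. (f \<omega>)\<^sup>2 + (g \<omega>)\<^sup>2)"
    using assms by (simp add: square_integrable_def)
  show "(\<lambda>\<omega>. f \<omega> * g \<omega>) \<in> borel_measurable M"
    using assms by (auto simp: square_integrable_def)
  have "\<bar>f \<omega> * g \<omega>\<bar> \<le> (f \<omega>)\<^sup>2 + (g \<omega>)\<^sup>2" for \<omega>
  proof -
    have "2 * \<bar>f \<omega> * g \<omega>\<bar> \<le> (f \<omega>)\<^sup>2 + (g \<omega>)\<^sup>2"
      using sum_squares_bound[of "\<bar>f \<omega>\<bar>" "\<bar>g \<omega>\<bar>"] by (simp add: abs_mult)
    then show ?thesis using abs_ge_zero[of "f \<omega> * g \<omega>"] by linarith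
  qed
  then show "AE \<omega> in M. norm (f \<omega> * g \<omega>) \<le> norm ((f \<omega>)\<^sup>2 + (g \<omega>)\<^sup>2)"
    by (intro AE_I2) simp
qed

lemma square_integrable_integrable: "square_integrable f \<Longrightarrow> integrable M f"
  using square_integrable_mult[of f "\<lambda>_. 1"] by (simp add: square_integrable_def)

lemma square_integrable_add:
  assumes "square_integrable f" "square_integrable g"
  shows "square_integrable (\<lambda>\<omega>. f \<omega> + g \<omega>)"
  using assms square_integrable_mult[OF assms]
  by (auto simp: square_integrable_def power2_sum mult.assoc)

lemma square_integrable_diff:
  assumes "square_integrable f" "square_integrable g"
  shows "square_integrable (\<lambda>\<omega>. f \<omega> - g \<omega>)"
  using assms square_integrable_mult[OF assms]
  by (auto simp: square_integrable_def power2_diff mult.assoc)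

lemma expectation_Cauchy_Schwarz:
  assumes f: "square_integrable f" and g: "square_integrable g"
  shows "(expectation (\<lambda>\<omega>. f \<omega> * g \<omega>))\<^sup>2 \<le> expectation (\<lambda>\<omega>. (f \<omega>)\<^sup>2) * expectation (\<lambda>\<omega>. (g \<omega>)\<^sup>2)"
proof -
  define a b c where "a = expectation (\<lambda>\<omega>. (f \<omega>)\<^sup>2)" and "b = expectation (\<lambda>\<omega>. (g \<omega>)\<^sup>2)"
    and "c = expectation (\<lambda>\<omega>. f \<omega> * g \<omega>)"
  have *: "0 \<le> x\<^sup>2 * a + 2 * x * c + y" if "y = b" for x y
  proof -
    have "0 \<le> expectation (\<lambda>\<omega>. (x * f \<omega> + g \<omega>)\<^sup>2)"
      by (rule Bochner_Integration.integral_nonneg) simp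
    also have "\<dots> = expectation (\<lambda>\<omega>. x\<^sup>2 * (f \<omega>)\<^sup>2 + 2 * x * (f \<omega> * g \<omega>) + (g \<omega>)\<^sup>2)"
      by (simp add: power2_sum power_mult_distrib algebra_simps)
    also have "\<dots> = x\<^sup>2 * a + 2 * x * c + b"
      using f g square_integrable_mult[OF f g] by (simp add: square_integrable_def a_def b_def c_def)
    finally show ?thesis using that by simp
  qed
  have a0: "a \<ge> 0"
    unfolding a_def by simp
  have "c\<^sup>2 \<le> a * b"
  proof (cases "a = 0")
    case True
    have "c = 0"
    proof (rule ccontr)
      assume "c \<noteq> 0"
      \<comment> \<open>At this point the affine function \<open>2 * x * c + b\<close> takes the
        value -1.\<close>
      then show False using *[of b "- (b + 1) / (2 * c)"] True by (simp add: field_simps)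
    qed
    then show ?thesis using True by simp
  next
    case False
    then have "0 \<le> (c / a)\<^sup>2 * a - 2 * (c / a) * c + b" using *[of b "- c / a"] by simp
    also have "\<dots> = b - c\<^sup>2 / a" using False by (simp add: field_simps power2_eq_square)
    finally show ?thesis using False a0 by (simp add: field_simps)
  qed
  then show ?thesis unfolding a_def b_def c_def .
qed

lemma expectation_abs_le_sqrt:
  assumes "square_integrable f"
  shows "expectation (\<lambda>\<omega>. \<bar>f \<omega>\<bar>) \<le> sqrt (expectation (\<lambda>\<omega>. (f \<omega>)\<^sup>2))"
proof -
  have 1: "square_integrable (\<lambda>\<omega>. \<bar>f \<omega>\<bar>)" "square_integrable (\<lambda>_. 1)"
    using assms by (auto simp: square_integrable_def)
  from expectation_Cauchy_Schwarz[OF this] show ?thesis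
    by (intro real_le_rsqrt) (simp add: prob_space)
qed

end

section \<open>Left-endpoint sums of the stochastic integral\<close>

context brownian_motion
begin

lemma space_filtration: "space (F s) = space M"
  using filtration unfolding is_filtration_def subalgebra_def by simp

text \<open>The integral is a pointwise limit of left-endpoint sums, which read \<open>g\<close>
  only at times up to \<open>r\<close>. Continuity of the paths takes the place of joint
  measurability.\<close>

lemma integral_adapted_measurable:
  fixes g :: "real \<Rightarrow> 'a \<Rightarrow> real"
  assumes r: "0 \<le> r"
    and cont: "\<And>\<omega>. \<omega> \<in> space M \<Longrightarrow> continuous_on {0..} (\<lambda>s. g s \<omega>)"
    and adapted: "\<And>s. 0 \<le> s \<Longrightarrow> g s \<in> borel_measurable (F s)"
  shows "(\<lambda>\<omega>. integral {0..r} (\<lambda>s. g s \<omega>)) \<in> borel_measurable (F r)"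
proof (rule borel_measurable_LIMSEQ_metric)
  show "(\<lambda>\<omega>. \<Sum>k<N. g (real k * r / real N) \<omega> *
      integral {real k * r / real N..real (Suc k) * r / real N} (\<lambda>_. 1)) \<in> borel_measurable (F r)" for N
  proof (intro borel_measurable_sum borel_measurable_times borel_measurable_const)
    fix k assume "k \<in> {..<N}"
    then have "real k * r \<le> real N * r" "real N > 0"
      using r by (auto intro: mult_right_mono)
    then have "real k * r / real N \<le> r"
      by (simp add: divide_le_eq mult.commute)
    then show "g (real k * r / real N) \<in> borel_measurable (F r)"
      using r by (intro filtration_mono[OF _ adapted]) auto
  qed
  fix \<omega> assume "\<omega> \<in> space (F r)"
  then have "continuous_on {0..r} (\<lambda>s. g s \<omega>)"
    using cont[of \<omega>] by (auto simp: space_filtration intro: continuous_on_subset)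
  from Riemann_Stieltjes_sum_tendsto[OF r this continuous_on_const, of 1]
  show "(\<lambda>N. \<Sum>k<N. g (real k * r / real N) \<omega> *
      integral {real k * r / real N..real (Suc k) * r / real N} (\<lambda>_. 1))
    \<longlonglongrightarrow> integral {0..r} (\<lambda>s. g s \<omega>)" by simp
qed

end

text \<open>Encodes \<open>dY = b dt + c \<bullet> dW\<close>.\<close>

locale ito_process = brownian_motion M F W
  for M :: "'a measure" and F and W :: "real \<Rightarrow> 'a \<Rightarrow> real^'n" +
  fixes Y b :: "real \<Rightarrow> 'a \<Rightarrow> real" and c :: "real \<Rightarrow> 'a \<Rightarrow> real^'n" and y0 K :: real
  assumes Y_zero: "\<And>\<omega>. \<omega> \<in> space M \<Longrightarrow> Y 0 \<omega> = y0"
    and Y_cont: "\<And>\<omega>. \<omega> \<in> space M \<Longrightarrow> continuous_on {0..} (\<lambda>s. Y s \<omega>)"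
    and b_cont: "\<And>\<omega>. \<omega> \<in> space M \<Longrightarrow> continuous_on {0..} (\<lambda>s. b s \<omega>)"
    and c_cont: "\<And>\<omega>. \<omega> \<in> space M \<Longrightarrow> continuous_on {0..} (\<lambda>s. c s \<omega>)"
    and Y_bound: "\<And>s \<omega>. 0 \<le> s \<Longrightarrow> \<omega> \<in> space M \<Longrightarrow> \<bar>Y s \<omega>\<bar> \<le> K"
    and b_bound: "\<And>s \<omega>. 0 \<le> s \<Longrightarrow> \<omega> \<in> space M \<Longrightarrow> \<bar>b s \<omega>\<bar> \<le> K"
    and c_bound: "\<And>s \<omega>. 0 \<le> s \<Longrightarrow> \<omega> \<in> space M \<Longrightarrow> norm (c s \<omega>) \<le> K"
    and Y_adapted: "\<And>s. 0 \<le> s \<Longrightarrow> Y s \<in> borel_measurable (F s)"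
    and b_adapted: "\<And>s. 0 \<le> s \<Longrightarrow> b s \<in> borel_measurable (F s)"
    and c_adapted: "\<And>s. 0 \<le> s \<Longrightarrow> c s \<in> borel_measurable (F s)"
    and mean_square: "\<And>r. 0 < r \<Longrightarrow> (\<lambda>N. expectation (\<lambda>\<omega>.
        (Y r \<omega> - y0 - integral {0..r} (\<lambda>s. b s \<omega>)
          - (\<Sum>k<N. c (real k * r / real N) \<omega> \<bullet>
              (W (real (Suc k) * r / real N) \<omega> - W (real k * r / real N) \<omega>)))\<^sup>2)) \<longlonglongrightarrow> 0"
begin

text \<open>This residual plays the part of the stochastic integral of \<open>c\<close> against
  \<open>W\<close> up to time \<open>r\<close>; it is accessible only as a mean-square limit of
  sums.\<close>

definition mart :: "real \<Rightarrow> 'a \<Rightarrow> real" where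
  "mart r \<omega> = Y r \<omega> - y0 - integral {0..r} (\<lambda>s. b s \<omega>)"

definition incr :: "real \<Rightarrow> nat \<Rightarrow> nat \<Rightarrow> 'a \<Rightarrow> real" where
  "incr r N k \<omega> = c (real k * r / real N) \<omega> \<bullet>
     (W (real (Suc k) * r / real N) \<omega> - W (real k * r / real N) \<omega>)"

definition psum :: "real \<Rightarrow> nat \<Rightarrow> nat \<Rightarrow> 'a \<Rightarrow> real" where
  "psum r N m \<omega> = (\<Sum>k<m. incr r N k \<omega>)"

text \<open>The locale assumption controls exactly this error, at the final time of the grid;
  \<open>psum_error_le\<close> transfers the control to inner grid points.\<close>

definition err :: "real \<Rightarrow> nat \<Rightarrow> real" where
  "err r N = expectation (\<lambda>\<omega>. (psum r N N \<omega> - mart r \<omega>)\<^sup>2)"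

lemma err_tendsto: "0 < r \<Longrightarrow> err r \<longlonglongrightarrow> 0"
  using mean_square[of r]
  unfolding err_def[abs_def] psum_def incr_def mart_def power2_commute[of "sum _ _"] .

lemma K_nonneg: "0 \<le> K"
proof -
  obtain \<omega> where "\<omega> \<in> space M" using not_empty by blast
  then show ?thesis using Y_bound[of 0 \<omega>] abs_ge_zero[of "Y 0 \<omega>"] by linarith
qed

lemma b_integral_bound:
  assumes "0 \<le> u" "u \<le> v" "\<omega> \<in> space M"
  shows "\<bar>integral {u..v} (\<lambda>s. b s \<omega>)\<bar> \<le> K * (v - u)"
  using assms
  by (intro abs_integral_le continuous_on_subset[OF b_cont] b_bound) auto

lemma mart_measurable: "0 \<le> r \<Longrightarrow> mart r \<in> borel_measurable (F r)"
  unfolding mart_def[abs_def]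
  by (intro borel_measurable_diff borel_measurable_const Y_adapted
      integral_adapted_measurable b_cont b_adapted)

lemma mart_square_integrable:
  assumes "0 \<le> r"
  shows "square_integrable (mart r)"
proof (rule square_integrable_bounded)
  show "mart r \<in> borel_measurable M"
    using mart_measurable[OF assms] by (rule filtration_measurable)
  show "\<bar>mart r \<omega>\<bar> \<le> K + \<bar>y0\<bar> + K * r" if "\<omega> \<in> space M" for \<omega>
    using Y_bound[OF assms that] b_integral_bound[of 0 r \<omega>] assms that
    unfolding mart_def by auto
qed

lemma grid:
  assumes "0 < r" "0 < N"
  shows "0 \<le> real k * r / real N" "real k * r / real N < real (Suc k) * r / real N"
    "real (Suc k) * r / real N - real k * r / real N = r / real N"
    "k \<le> m \<Longrightarrow> real k * r / real N \<le> real m * r / real N"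
proof -
  show step: "real (Suc k) * r / real N - real k * r / real N = r / real N"
    by (simp add: field_simps add_divide_distrib)
  have "0 < r / real N" using assms by simp
  with step show "real k * r / real N < real (Suc k) * r / real N" by linarith
qed (use assms in \<open>auto intro!: divide_right_mono mult_right_mono\<close>)

text \<open>Step \<open>k\<close> reads \<open>W\<close> at grid point \<open>k + 1\<close>, hence
  the strict inequality \<open>k < m\<close>.\<close>

lemma incr_measurable:
  assumes "0 < r" "0 < N" "k < m"
  shows "incr r N k \<in> borel_measurable (F (real m * r / real N))"
proof -
  note g = grid[OF assms(1,2)]
  have "k \<le> m" "Suc k \<le> m" using assms(3) by auto
  then have "real k * r / real N \<le> real m * r / real N" "real (Suc k) * r / real N \<le> real m * r / real N"
    by (blast intro: g(4))+
  then show ?thesis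
    unfolding incr_def[abs_def] using g(1)[of k] g(1)[of "Suc k"]
    by (intro borel_measurable_inner borel_measurable_diff filtration_mono[OF _ c_adapted]
        filtration_mono[OF _ W_measurable])
qed

lemma psum_measurable:
  assumes "0 < r" "0 < N"
  shows "psum r N m \<in> borel_measurable (F (real m * r / real N))"
  unfolding psum_def[abs_def] using assms by (intro borel_measurable_sum incr_measurable) auto

lemma incr_mean:
  assumes "0 < r" "0 < N" and G: "G \<in> borel_measurable (F (real k * r / real N))" "integrable M G"
  shows "has_bochner_integral M (\<lambda>\<omega>. G \<omega> * incr r N k \<omega>) 0"
proof -
  note g = grid(1,2)[OF assms(1,2), of k]
  from increment_inner_moment1[OF g G c_adapted[OF g(1)] c_bound[OF g(1)]]
  show ?thesis unfolding incr_def .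
qed

lemma incr_variance:
  assumes "0 < r" "0 < N" and G: "G \<in> borel_measurable (F (real k * r / real N))" "integrable M G"
  shows "has_bochner_integral M (\<lambda>\<omega>. G \<omega> * (incr r N k \<omega>)\<^sup>2)
    (r / real N * expectation (\<lambda>\<omega>. G \<omega> * (norm (c (real k * r / real N) \<omega>))\<^sup>2))"
proof -
  note g = grid(1-3)[OF assms(1,2), of k]
  from increment_inner_moment2[OF g(1,2) G c_adapted[OF g(1)] c_bound[OF g(1)]]
  show ?thesis unfolding incr_def g(3) dot_square_norm .
qed

lemma incr_fourth_moment:
  assumes "0 < r" "0 < N"
  shows "integrable M (\<lambda>\<omega>. (incr r N k \<omega>) ^ 4)"
    and "expectation (\<lambda>\<omega>. (incr r N k \<omega>) ^ 4) \<le> 3 * (real CARD('n))\<^sup>2 * K ^ 4 * (r / real N)\<^sup>2"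
proof -
  note g = grid(1-3)[OF assms, of k]
  note m = increment_inner_moment4[OF g(1,2) c_adapted[OF g(1)] c_bound[OF g(1)]]
  show "integrable M (\<lambda>\<omega>. (incr r N k \<omega>) ^ 4)"
    using m(1) unfolding incr_def .
  show "expectation (\<lambda>\<omega>. (incr r N k \<omega>) ^ 4) \<le> 3 * (real CARD('n))\<^sup>2 * K ^ 4 * (r / real N)\<^sup>2"
    using m(2) unfolding incr_def g(3) .
qed

lemma incr_second_moment:
  assumes "0 < r" "0 < N"
  shows "integrable M (\<lambda>\<omega>. (incr r N k \<omega>)\<^sup>2)"
    and "expectation (\<lambda>\<omega>. (incr r N k \<omega>)\<^sup>2) \<le> K\<^sup>2 * (r / real N)"
proof -
  have *: "has_bochner_integral M (\<lambda>\<omega>. (incr r N k \<omega>)\<^sup>2)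
    (r / real N * expectation (\<lambda>\<omega>. (norm (c (real k * r / real N) \<omega>))\<^sup>2))"
    using incr_variance[OF assms borel_measurable_const integrable_const, of 1 k]
    unfolding mult_1 .
  then show "integrable M (\<lambda>\<omega>. (incr r N k \<omega>)\<^sup>2)"
    by (rule integrable.intros)
  have c: "c (real k * r / real N) \<in> borel_measurable M"
    using c_adapted[OF grid(1)[OF assms, of k]] by (rule filtration_measurable)
  have le: "(norm (c (real k * r / real N) \<omega>))\<^sup>2 \<le> K\<^sup>2" if "\<omega> \<in> space M" for \<omega>
    using c_bound[OF grid(1)[OF assms, of k] that] by (intro power_mono) auto
  have int: "integrable M (\<lambda>\<omega>. (norm (c (real k * r / real N) \<omega>))\<^sup>2)"
    using c le by (intro integrable_const_bound[where B = "K\<^sup>2"]) auto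
  have "expectation (\<lambda>\<omega>. (norm (c (real k * r / real N) \<omega>))\<^sup>2) \<le> expectation (\<lambda>_. K\<^sup>2)"
    using int le by (intro integral_mono) auto
  then have "r / real N * expectation (\<lambda>\<omega>. (norm (c (real k * r / real N) \<omega>))\<^sup>2) \<le> r / real N * K\<^sup>2"
    using assms by (intro mult_left_mono) (auto simp: prob_space)
  then show "expectation (\<lambda>\<omega>. (incr r N k \<omega>)\<^sup>2) \<le> K\<^sup>2 * (r / real N)"
    unfolding has_bochner_integral_integral_eq[OF *] by (simp only: mult.commute)
qed

lemma incr_square_integrable:
  assumes "0 < r" "0 < N"
  shows "square_integrable (incr r N k)"
  unfolding square_integrable_def
  using incr_second_moment(1)[OF assms] filtration_measurable[OF incr_measurable[OF assms, of k "Suc k"]]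
  by simp

lemma psum_square_integrable:
  assumes "0 < r" "0 < N"
  shows "square_integrable (psum r N m)"
proof (induction m)
  case 0
  then show ?case unfolding psum_def[abs_def] by (simp add: square_integrable_def)
next
  case (Suc m)
  from square_integrable_add[OF this incr_square_integrable[OF assms, of m]]
  show ?case by (simp add: psum_def)
qed

text \<open>Everything known at grid point \<open>m\<close> is still known at the start of each
  later step, whose increment then has mean zero against it.\<close>

lemma psum_orthogonal:
  assumes "0 < r" "0 < N" "m \<le> m'"
    and D: "D \<in> borel_measurable (F (real m * r / real N))" "integrable M D"
  shows "has_bochner_integral M (\<lambda>\<omega>. D \<omega> * (psum r N m' \<omega> - psum r N m \<omega>)) 0"
proof -
  have "has_bochner_integral M (\<lambda>\<omega>. \<Sum>k\<in>{m..<m'}. D \<omega> * incr r N k \<omega>) (\<Sum>k\<in>{m..<m'}. 0)"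
  proof (rule has_bochner_integral_sum)
    fix k assume "k \<in> {m..<m'}"
    then have "D \<in> borel_measurable (F (real k * r / real N))"
      using assms by (intro filtration_mono[OF _ D(1)] grid(4)) auto
    then show "has_bochner_integral M (\<lambda>\<omega>. D \<omega> * incr r N k \<omega>) 0"
      using assms by (intro incr_mean) auto
  qed
  moreover have "(\<Sum>k\<in>{m..<m'}. D \<omega> * incr r N k \<omega>) = D \<omega> * (psum r N m' \<omega> - psum r N m \<omega>)" for \<omega>
  proof -
    have "psum r N m' \<omega> - psum r N m \<omega> = (\<Sum>k\<in>{m..<m'}. incr r N k \<omega>)"
      using assms(3) unfolding psum_def
      by (metis (no_types, lifting) add_diff_cancel_left' atLeast0LessThan sum.atLeastLessThan_concat zero_le)
    then show ?thesis by (simp add: sum_distrib_left)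
  qed
  ultimately show ?thesis by simp
qed

text \<open>A uniform partition of \<open>[0, mr/N]\<close> into \<open>mL\<close> pieces is an initial part of the
  uniform partition of \<open>[0, r]\<close> into \<open>NL\<close> pieces, so increments of \<open>mart\<close> between grid
  points are themselves mean-square limits of left-endpoint sums.\<close>

lemma mart_orthogonal:
  assumes r: "0 < r" and N: "0 < N" and m: "0 < m" "m \<le> N"
    and D: "D \<in> borel_measurable (F (real m * r / real N))" "square_integrable D"
  shows "expectation (\<lambda>\<omega>. D \<omega> * (mart r \<omega> - mart (real m * r / real N) \<omega>)) = 0"
proof -
  define s where "s = real m * r / real N"
  have s: "0 < s" using r N m by (simp add: s_def)
  \<comment> \<open>The difference of the two approximation errors. Since the sums agree up to
    \<open>s\<close>, the increment of \<open>mart\<close> is a later increment of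
    \<open>psum\<close> minus \<open>R L\<close>; the former is orthogonal to \<open>D\<close>, so
    only \<open>R L\<close> contributes to \<open>x\<close>, and it vanishes in mean square.\<close>
  define R where "R = (\<lambda>L \<omega>. (psum r (N * L) (N * L) \<omega> - mart r \<omega>) - (psum s (m * L) (m * L) \<omega> - mart s \<omega>))"
  define x where "x = expectation (\<lambda>\<omega>. D \<omega> * (mart r \<omega> - mart s \<omega>))"
  have psum_eq: "psum r (N * L) (m * L) = psum s (m * L) (m * L)" if "0 < L" for L
  proof -
    have "real k * r / real (N * L) = real k * s / real (m * L)" for k
      using that m N by (simp add: s_def field_simps)
    note eq = this
    show ?thesis unfolding psum_def[abs_def] incr_def eq ..
  qed
  have sq: "square_integrable (\<lambda>\<omega>. psum r (N * L) (N * L) \<omega> - mart r \<omega>)"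
    "square_integrable (\<lambda>\<omega>. psum s (m * L) (m * L) \<omega> - mart s \<omega>)" if "0 < L" for L
    using that r N m s by (auto intro!: square_integrable_diff psum_square_integrable mart_square_integrable)
  have xR: "x = - expectation (\<lambda>\<omega>. D \<omega> * R L \<omega>)" and
    ER: "expectation (\<lambda>\<omega>. (R L \<omega>)\<^sup>2) \<le> 2 * err r (N * L) + 2 * err s (m * L)" and
    R2: "square_integrable (R L)" if L: "0 < L" for L
  proof -
    have Dm: "D \<in> borel_measurable (F (real (m * L) * r / real (N * L)))"
      using D(1) L by simp
    have 0: "has_bochner_integral M (\<lambda>\<omega>. D \<omega> * (psum r (N * L) (N * L) \<omega> - psum r (N * L) (m * L) \<omega>)) 0"
      using r N m L by (intro psum_orthogonal Dm square_integrable_integrable D) auto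
    show R2: "square_integrable (R L)"
      unfolding R_def by (intro square_integrable_diff[OF sq[OF L]])
    have "D \<omega> * (mart r \<omega> - mart s \<omega>) = D \<omega> * (psum r (N * L) (N * L) \<omega> - psum r (N * L) (m * L) \<omega>) - D \<omega> * R L \<omega>" for \<omega>
      unfolding R_def psum_eq[OF L] by (simp add: algebra_simps)
    then have "x = expectation (\<lambda>\<omega>. D \<omega> * (psum r (N * L) (N * L) \<omega> - psum r (N * L) (m * L) \<omega>) - D \<omega> * R L \<omega>)"
      unfolding x_def by simp
    also have "\<dots> = - expectation (\<lambda>\<omega>. D \<omega> * R L \<omega>)"
      using 0 square_integrable_mult[OF D(2) R2] by (simp add: has_bochner_integral_iff)
    finally show "x = - expectation (\<lambda>\<omega>. D \<omega> * R L \<omega>)" .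
    have "expectation (\<lambda>\<omega>. (R L \<omega>)\<^sup>2) \<le> expectation (\<lambda>\<omega>. 2 * (psum r (N * L) (N * L) \<omega> - mart r \<omega>)\<^sup>2
        + 2 * (psum s (m * L) (m * L) \<omega> - mart s \<omega>)\<^sup>2)"
    proof (rule integral_mono)
      show "integrable M (\<lambda>\<omega>. (R L \<omega>)\<^sup>2)" using R2 by (simp add: square_integrable_def)
      show "integrable M (\<lambda>\<omega>. 2 * (psum r (N * L) (N * L) \<omega> - mart r \<omega>)\<^sup>2
        + 2 * (psum s (m * L) (m * L) \<omega> - mart s \<omega>)\<^sup>2)"
        using sq[OF L] by (simp add: square_integrable_def)
      have "(u - v)\<^sup>2 \<le> 2 * u\<^sup>2 + 2 * v\<^sup>2" for u v :: real
        using zero_le_power2[of "u + v"] by (simp add: power2_sum power2_diff)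
      then show "(R L \<omega>)\<^sup>2 \<le> 2 * (psum r (N * L) (N * L) \<omega> - mart r \<omega>)\<^sup>2
        + 2 * (psum s (m * L) (m * L) \<omega> - mart s \<omega>)\<^sup>2" for \<omega>
        unfolding R_def .
    qed
    also have "\<dots> = 2 * err r (N * L) + 2 * err s (m * L)"
      unfolding err_def using sq[OF L] by (simp add: square_integrable_def)
    finally show "expectation (\<lambda>\<omega>. (R L \<omega>)\<^sup>2) \<le> 2 * err r (N * L) + 2 * err s (m * L)" .
  qed
  \<comment> \<open>The cell numbers \<open>N * Suc L\<close> and \<open>m * Suc L\<close> run
    through subsequences of the two error sequences; \<open>Suc\<close> keeps them positive.\<close>
  have mono: "strict_mono (\<lambda>L. n * Suc L)" if "0 < n" for n :: nat
    using that by (simp add: strict_mono_def)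
  have "(\<lambda>L. err r (N * Suc L)) \<longlonglongrightarrow> 0" "(\<lambda>L. err s (m * Suc L)) \<longlonglongrightarrow> 0"
    using LIMSEQ_subseq_LIMSEQ[OF err_tendsto[OF r] mono[OF N]]
      LIMSEQ_subseq_LIMSEQ[OF err_tendsto[OF s] mono[OF m(1)]] by (simp_all add: comp_def)
  then have lim: "(\<lambda>L. expectation (\<lambda>\<omega>. (D \<omega>)\<^sup>2) * (2 * err r (N * Suc L) + 2 * err s (m * Suc L)))
      \<longlonglongrightarrow> expectation (\<lambda>\<omega>. (D \<omega>)\<^sup>2) * (2 * 0 + 2 * 0)"
    by (intro tendsto_intros)
  have "x\<^sup>2 \<le> expectation (\<lambda>\<omega>. (D \<omega>)\<^sup>2) * (2 * err r (N * Suc L) + 2 * err s (m * Suc L))" for L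
  proof -
    have "x\<^sup>2 = (expectation (\<lambda>\<omega>. D \<omega> * R (Suc L) \<omega>))\<^sup>2" using xR[of "Suc L"] by simp
    also have "\<dots> \<le> expectation (\<lambda>\<omega>. (D \<omega>)\<^sup>2) * expectation (\<lambda>\<omega>. (R (Suc L) \<omega>)\<^sup>2)"
      by (intro expectation_Cauchy_Schwarz D R2) simp
    also have "\<dots> \<le> expectation (\<lambda>\<omega>. (D \<omega>)\<^sup>2) * (2 * err r (N * Suc L) + 2 * err s (m * Suc L))"
      using ER[of "Suc L"] by (intro mult_left_mono) auto
    finally show ?thesis .
  qed
  then have "x\<^sup>2 \<le> expectation (\<lambda>\<omega>. (D \<omega>)\<^sup>2) * (2 * 0 + 2 * 0)"
    by (intro LIMSEQ_le_const[OF lim]) blast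
  then show ?thesis unfolding x_def s_def by simp
qed

text \<open>Pythagoras for the error process: its value \<open>D\<close> is known at the grid point
  and its later change \<open>R\<close> is orthogonal to it, so the mean square at the end is the
  sum of both.\<close>

lemma psum_error_le:
  assumes r: "0 < r" and N: "0 < N" and m: "m \<le> N"
  shows "expectation (\<lambda>\<omega>. (psum r N m \<omega> - mart (real m * r / real N) \<omega>)\<^sup>2) \<le> err r N"
proof (cases "m = 0")
  case True
  \<comment> \<open>At time 0 both processes vanish. The case is treated apart because
    \<open>mart_orthogonal\<close> subdivides the interval up to the grid point and requires
    \<open>0 < m\<close>.\<close>
  have "expectation (\<lambda>\<omega>. (psum r N m \<omega> - mart (real m * r / real N) \<omega>)\<^sup>2) = expectation (\<lambda>_. 0)"
    using True Y_zero by (intro Bochner_Integration.integral_cong) (auto simp: psum_def mart_def)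
  then show ?thesis unfolding err_def by simp
next
  case False
  define s where "s = real m * r / real N"
  have s: "0 \<le> s" using r by (simp add: s_def)
  define D where "D = (\<lambda>\<omega>. psum r N m \<omega> - mart s \<omega>)"
  define R where "R = (\<lambda>\<omega>. (psum r N N \<omega> - psum r N m \<omega>) - (mart r \<omega> - mart s \<omega>))"
  have D2: "square_integrable D"
    unfolding D_def using r N s by (intro square_integrable_diff psum_square_integrable mart_square_integrable)
  have R2: "square_integrable R"
    unfolding R_def using r N s
    by (intro square_integrable_diff psum_square_integrable mart_square_integrable) auto
  have Dm: "D \<in> borel_measurable (F s)"
    unfolding D_def using psum_measurable[OF r N, of m] mart_measurable[OF s]
    by (intro borel_measurable_diff) (auto simp: s_def)
  have 1: "has_bochner_integral M (\<lambda>\<omega>. D \<omega> * (psum r N N \<omega> - psum r N m \<omega>)) 0"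
    using r N m Dm square_integrable_integrable[OF D2] by (intro psum_orthogonal) (auto simp: s_def)
  have 2: "expectation (\<lambda>\<omega>. D \<omega> * (mart r \<omega> - mart s \<omega>)) = 0"
    using r N m False Dm D2 unfolding s_def by (intro mart_orthogonal) auto
  have int: "integrable M (\<lambda>\<omega>. D \<omega> * (mart r \<omega> - mart s \<omega>))"
    using r s by (intro square_integrable_mult D2 square_integrable_diff mart_square_integrable) auto
  have DR: "expectation (\<lambda>\<omega>. D \<omega> * R \<omega>) = 0"
    unfolding R_def right_diff_distrib[of "D _" "psum r N N _ - psum r N m _"]
    using 1 2 int by (simp add: has_bochner_integral_iff)
  have "err r N = expectation (\<lambda>\<omega>. (D \<omega>)\<^sup>2 + (R \<omega>)\<^sup>2 + 2 * (D \<omega> * R \<omega>))"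
    unfolding err_def
  proof (intro Bochner_Integration.integral_cong refl)
    fix \<omega>
    have "psum r N N \<omega> - mart r \<omega> = D \<omega> + R \<omega>" by (simp add: D_def R_def)
    then show "(psum r N N \<omega> - mart r \<omega>)\<^sup>2 = (D \<omega>)\<^sup>2 + (R \<omega>)\<^sup>2 + 2 * (D \<omega> * R \<omega>)"
      by (simp add: power2_sum)
  qed
  also have "\<dots> = expectation (\<lambda>\<omega>. (D \<omega>)\<^sup>2) + expectation (\<lambda>\<omega>. (R \<omega>)\<^sup>2)"
    using D2 R2 square_integrable_mult[OF D2 R2] DR by (simp add: square_integrable_def)
  finally show ?thesis
    unfolding D_def s_def by simp
qed

end

section \<open>Ito formula in expectation\<close>

lemma lipschitz_of_bounded_derivative:
  fixes g g' :: "real \<Rightarrow> real"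
  assumes "\<And>y. (g has_real_derivative g' y) (at y)" "\<And>y. \<bar>g' y\<bar> \<le> L"
  shows "\<bar>g u - g v\<bar> \<le> L * \<bar>u - v\<bar>"
  using field_differentiable_bound[of UNIV g g' L u v] assms by simp

text \<open>Here \<open>q\<close> is the square root of the step length, \<open>B\<close> the drift
  increment and \<open>w\<close> the noise increment. With \<open>w\<^sup>2\<close> of mean order
  \<open>q\<^sup>2\<close> and \<open>w ^ 4\<close> of mean order \<open>q ^ 4\<close>, each of the
  three terms on the right is of mean order \<open>q ^ 3\<close>. Only even powers of
  \<open>w\<close> occur, as these are the moments at hand.\<close>

lemma taylor_increment_bound:
  fixes f f' f'' f''' :: "real \<Rightarrow> real"
  assumes d: "\<And>y. (f has_real_derivative f' y) (at y)" "\<And>y. (f' has_real_derivative f'' y) (at y)"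
    "\<And>y. (f'' has_real_derivative f''' y) (at y)"
    and L: "\<And>y. \<bar>f'' y\<bar> \<le> L" "\<And>y. \<bar>f''' y\<bar> \<le> L"
    and q: "0 < q" "q \<le> 1" and K: "0 \<le> K" and B: "\<bar>B\<bar> \<le> K * q\<^sup>2"
  shows "\<bar>f (z + (B + w)) - f z - f' z * B - f' z * w - f'' z * w\<^sup>2 / 2\<bar>
    \<le> L * (2 * K\<^sup>2 + K ^ 4 + 2) * (q ^ 3 + q * w\<^sup>2 + w ^ 4 / q)"
proof -
  define u where "u = B + w"
  have L0: "0 \<le> L" using L(1)[of 0] abs_ge_zero[of "f'' 0"] by linarith
  have q3: "q ^ 4 \<le> q ^ 3"
    using q by (intro power_decreasing) auto
  have B2: "B\<^sup>2 \<le> K\<^sup>2 * q ^ 4"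
  proof -
    have "\<bar>B\<bar>\<^sup>2 \<le> (K * q\<^sup>2)\<^sup>2" using B by (intro power_mono) auto
    then show ?thesis by (simp add: power_mult_distrib)
  qed
  have B2': "B\<^sup>2 \<le> K\<^sup>2 * q ^ 3"
    using B2 mult_left_mono[OF q3, of "K\<^sup>2"] by simp
  have B4: "B ^ 4 \<le> K ^ 4 * q ^ 4"
  proof -
    have "\<bar>B\<bar> ^ 4 \<le> (K * q\<^sup>2) ^ 4" using B by (intro power_mono) auto
    also have "\<dots> = K ^ 4 * q ^ 8" by (simp add: power_mult_distrib)
    also have "\<dots> \<le> K ^ 4 * q ^ 4"
      using q by (intro mult_left_mono power_decreasing) auto
    finally show ?thesis by simp
  qed
  \<comment> \<open>Young's inequality, applied to \<open>K * q\<close> and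
    \<open>\<bar>w\<bar>\<close> after one factor \<open>q\<close> is split off, so that both
    resulting terms have order \<open>q ^ 3\<close>.\<close>
  have Bw: "\<bar>B * w\<bar> \<le> (K\<^sup>2 * q ^ 3 + q * w\<^sup>2) / 2"
  proof -
    have "\<bar>B * w\<bar> \<le> (K * q\<^sup>2) * \<bar>w\<bar>"
      unfolding abs_mult using B by (intro mult_right_mono) auto
    also have "\<dots> = q / 2 * (2 * (K * q) * \<bar>w\<bar>)" by (simp add: power2_eq_square)
    also have "\<dots> \<le> q / 2 * ((K * q)\<^sup>2 + \<bar>w\<bar>\<^sup>2)"
      using q by (intro mult_left_mono sum_squares_bound) auto
    also have "\<dots> = (K\<^sup>2 * q ^ 3 + q * w\<^sup>2) / 2"
      by (simp add: power_mult_distrib power3_eq_cube power2_eq_square algebra_simps)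
    finally show ?thesis .
  qed
  have u2: "u\<^sup>2 \<le> 2 * B\<^sup>2 + 2 * w\<^sup>2"
    unfolding u_def using zero_le_power2[of "B - w"] by (simp add: power2_sum power2_diff)
  have u4: "u ^ 4 \<le> 8 * B ^ 4 + 8 * w ^ 4"
  proof -
    have "u ^ 4 = (u\<^sup>2)\<^sup>2" by simp
    also have "\<dots> \<le> (2 * B\<^sup>2 + 2 * w\<^sup>2)\<^sup>2" using u2 by (intro power_mono) auto
    also have "\<dots> \<le> 8 * (B\<^sup>2)\<^sup>2 + 8 * (w\<^sup>2)\<^sup>2"
      using zero_le_power2[of "B\<^sup>2 - w\<^sup>2"] by (simp add: power2_sum power2_diff power_mult_distrib)
    finally show ?thesis by simp
  qed
  \<comment> \<open>The odd third power is traded for even ones by Young's inequality for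
    \<open>q * \<bar>u\<bar>\<close> and \<open>u\<^sup>2\<close>; the weight \<open>q\<close>
    balances the two terms at order \<open>q ^ 3\<close>.\<close>
  have u3: "\<bar>u\<bar> ^ 3 \<le> (q * u\<^sup>2 + u ^ 4 / q) / 2"
  proof -
    have cube: "\<bar>u\<bar> ^ 3 = \<bar>u\<bar> * u\<^sup>2"
      by (simp add: power3_eq_cube power2_eq_square mult.assoc)
    have "2 * (q * \<bar>u\<bar>) * (u\<^sup>2) \<le> (q * \<bar>u\<bar>)\<^sup>2 + (u\<^sup>2)\<^sup>2"
      by (rule sum_squares_bound)
    then have "2 * q * \<bar>u\<bar> ^ 3 \<le> q\<^sup>2 * u\<^sup>2 + u ^ 4"
      unfolding cube by (simp add: power_mult_distrib mult.assoc)
    then have "q * (2 * \<bar>u\<bar> ^ 3) \<le> q * (q * u\<^sup>2 + u ^ 4 / q)"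
      using q by (simp add: power2_eq_square algebra_simps)
    then have "2 * \<bar>u\<bar> ^ 3 \<le> q * u\<^sup>2 + u ^ 4 / q"
      using q by (simp only: mult_le_cancel_left_pos)
    then show ?thesis by simp
  qed
  have "u ^ 4 / q \<le> (8 * (K ^ 4 * q ^ 4) + 8 * w ^ 4) / q"
    using u4 B4 q by (intro divide_right_mono) auto
  also have "\<dots> = 8 * (K ^ 4 * q ^ 3) + 8 * (w ^ 4 / q)"
    using q by (simp add: field_simps power_numeral_reduce)
  finally have u4': "u ^ 4 / q \<le> 8 * (K ^ 4 * q ^ 3) + 8 * (w ^ 4 / q)" .
  have "q * u\<^sup>2 \<le> q * (2 * B\<^sup>2 + 2 * w\<^sup>2)"
    using u2 q by (intro mult_left_mono) auto
  moreover have "q * B\<^sup>2 \<le> 1 * B\<^sup>2" using q by (intro mult_right_mono) auto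
  ultimately have u2': "q * u\<^sup>2 \<le> 2 * (K\<^sup>2 * q ^ 3) + 2 * (q * w\<^sup>2)"
    using B2' by (simp add: algebra_simps)
  define S where "S = K\<^sup>2 * q ^ 3 + K ^ 4 * q ^ 3 + q * w\<^sup>2 + w ^ 4 / q"
  have nn: "0 \<le> K\<^sup>2 * q ^ 3" "0 \<le> K ^ 4 * q ^ 3" "0 \<le> q * w\<^sup>2" "0 \<le> w ^ 4 / q" "0 \<le> q ^ 3"
    using q by auto
  have T: "\<bar>f (z + u) - f z - f' z * u - f'' z * u\<^sup>2 / 2\<bar> \<le> L * (\<bar>u\<bar> ^ 3 / 6)"
    using taylor_order2_bound[OF d L(2), of z u] by simp
  have "\<bar>u\<bar> ^ 3 / 6 \<le> S"
  proof -
    have "a / 6 \<le> x + z + y + v" if "a \<le> (b + c) / 2" "b \<le> 2 * x + 2 * y" "c \<le> 8 * z + 8 * v"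
      "0 \<le> x" "0 \<le> z" "0 \<le> y" "0 \<le> v" for a b c x y z v :: real
      using that by argo
    from this[OF u3 u2' u4' nn(1-4)] show ?thesis unfolding S_def .
  qed
  then have T1: "L * (\<bar>u\<bar> ^ 3 / 6) \<le> L * S" using L0 by (rule mult_left_mono)
  have "\<bar>f'' z * (B * w + B\<^sup>2 / 2)\<bar> \<le> L * (\<bar>B * w\<bar> + B\<^sup>2 / 2)"
  proof -
    have "\<bar>B * w + B\<^sup>2 / 2\<bar> \<le> \<bar>B * w\<bar> + B\<^sup>2 / 2"
      using abs_triangle_ineq[of "B * w" "B\<^sup>2 / 2"] by simp
    then show ?thesis
      unfolding abs_mult[of "f'' z"] using L(1)[of z] L0 by (intro mult_mono) auto
  qed
  also have "\<dots> \<le> L * (K\<^sup>2 * q ^ 3 + q * w\<^sup>2)"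
  proof (rule mult_left_mono[OF _ L0])
    have "a + b / 2 \<le> x + y" if "a \<le> (x + y) / 2" "b \<le> x" "0 \<le> y" for a b x y :: real
      using that by argo
    from this[OF Bw B2' nn(3)] show "\<bar>B * w\<bar> + B\<^sup>2 / 2 \<le> K\<^sup>2 * q ^ 3 + q * w\<^sup>2" .
  qed
  finally have T2: "\<bar>f'' z * (B * w + B\<^sup>2 / 2)\<bar> \<le> L * (K\<^sup>2 * q ^ 3 + q * w\<^sup>2)" .
  have "f (z + (B + w)) - f z - f' z * B - f' z * w - f'' z * w\<^sup>2 / 2
      = (f (z + u) - f z - f' z * u - f'' z * u\<^sup>2 / 2) + f'' z * (B * w + B\<^sup>2 / 2)"
    by (simp add: u_def power2_sum algebra_simps add_divide_distrib)
  then have "\<bar>f (z + (B + w)) - f z - f' z * B - f' z * w - f'' z * w\<^sup>2 / 2\<bar>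
      \<le> L * S + L * (K\<^sup>2 * q ^ 3 + q * w\<^sup>2)"
    using T T1 T2 by linarith
  also have "\<dots> = L * (S + (K\<^sup>2 * q ^ 3 + q * w\<^sup>2))" by (simp add: distrib_left)
  also have "\<dots> \<le> L * ((2 * K\<^sup>2 + K ^ 4 + 2) * (q ^ 3 + q * w\<^sup>2 + w ^ 4 / q))"
  proof (rule mult_left_mono[OF _ L0])
    \<comment> \<open>Origin of the constant: with \<open>x = K\<^sup>2\<close> and
      \<open>z = K ^ 4\<close>, the Taylor remainder contributes \<open>x + z\<close> and the cross
      term another \<open>x\<close> to the coefficient of \<open>q ^ 3\<close>, while
      \<open>q * w\<^sup>2\<close> occurs twice.\<close>
    have "x * a + z * a + y + v + (x * a + y) \<le> (2 * x + z + 2) * (a + y + v)"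
      if "0 \<le> x" "0 \<le> z" "0 \<le> y" "0 \<le> v" "0 \<le> a" for x y z v a :: real
    proof -
      have "0 \<le> (2 * x + z) * (y + v) + (2 * a + v)"
        using that by (intro add_nonneg_nonneg mult_nonneg_nonneg) auto
      then show ?thesis by (simp add: algebra_simps)
    qed
    from this[OF _ _ nn(3,4,5), of "K\<^sup>2" "K ^ 4"] K
    show "S + (K\<^sup>2 * q ^ 3 + q * w\<^sup>2) \<le> (2 * K\<^sup>2 + K ^ 4 + 2) * (q ^ 3 + q * w\<^sup>2 + w ^ 4 / q)"
      unfolding S_def by simp
  qed
  finally show ?thesis by (simp only: mult.assoc)
qed

section \<open>Comparison of the process with its left-endpoint version\<close>

context ito_process
begin

text \<open>A difference of integrals from 0, so that \<open>euler\<close> telescopes and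
  measurability follows from \<open>integral_adapted_measurable\<close>; \<open>bint_eq\<close>
  recovers the integral over one cell.\<close>

definition bint :: "real \<Rightarrow> nat \<Rightarrow> nat \<Rightarrow> 'a \<Rightarrow> real" where
  "bint r N k \<omega> = integral {0..real (Suc k) * r / real N} (\<lambda>s. b s \<omega>)
     - integral {0..real k * r / real N} (\<lambda>s. b s \<omega>)"

text \<open>Not the Euler scheme of the equation: \<open>b\<close> and \<open>c\<close> are the true
  coefficient processes, and only the stochastic integral is replaced by its sums. Hence the
  distance from \<open>Y\<close> is exactly the error of \<open>psum\<close>, without any Gronwall
  argument.\<close>

definition euler :: "real \<Rightarrow> nat \<Rightarrow> nat \<Rightarrow> 'a \<Rightarrow> real" where
  "euler r N m \<omega> = y0 + integral {0..real m * r / real N} (\<lambda>s. b s \<omega>) + psum r N m \<omega>"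

lemma euler_0: "euler r N 0 \<omega> = y0"
  by (simp add: euler_def psum_def)

lemma euler_Suc: "euler r N (Suc m) \<omega> = euler r N m \<omega> + (bint r N m \<omega> + incr r N m \<omega>)"
  by (simp add: euler_def bint_def psum_def)

lemma euler_diff: "euler r N m \<omega> - Y (real m * r / real N) \<omega> = psum r N m \<omega> - mart (real m * r / real N) \<omega>"
  by (simp add: euler_def mart_def)

lemma bint_eq:
  assumes "0 < r" "0 < N" "\<omega> \<in> space M"
  shows "bint r N k \<omega> = integral {real k * r / real N..real (Suc k) * r / real N} (\<lambda>s. b s \<omega>)"
proof -
  note g = grid[OF assms(1,2), of k]
  have "(\<lambda>s. b s \<omega>) integrable_on {0..real (Suc k) * r / real N}"
    using assms(3) by (intro integrable_continuous_interval continuous_on_subset[OF b_cont]) auto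
  from Henstock_Kurzweil_Integration.integral_combine[OF g(1) less_imp_le[OF g(2)] this]
  show ?thesis unfolding bint_def by linarith
qed

lemma bint_bound:
  assumes "0 < r" "0 < N" "\<omega> \<in> space M"
  shows "\<bar>bint r N k \<omega>\<bar> \<le> K * (r / real N)"
  using b_integral_bound[OF grid(1)[OF assms(1,2), of k] less_imp_le[OF grid(2)[OF assms(1,2), of k]] assms(3)]
  unfolding bint_eq[OF assms] grid(3)[OF assms(1,2)] .

lemma b_integral_measurable:
  "0 \<le> r \<Longrightarrow> (\<lambda>\<omega>. integral {0..r} (\<lambda>s. b s \<omega>)) \<in> borel_measurable (F r)"
  by (intro integral_adapted_measurable b_cont b_adapted)

lemma bint_measurable:
  assumes "0 < r" "0 < N"
  shows "bint r N k \<in> borel_measurable M"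
  unfolding bint_def[abs_def]
  by (intro borel_measurable_diff filtration_measurable[OF b_integral_measurable] grid(1) assms)

lemma euler_measurable:
  assumes "0 < r" "0 < N"
  shows "euler r N m \<in> borel_measurable (F (real m * r / real N))"
  unfolding euler_def[abs_def]
  by (intro borel_measurable_add borel_measurable_const b_integral_measurable psum_measurable grid(1) assms)

lemma Y_square_integrable: "0 \<le> r \<Longrightarrow> square_integrable (Y r)"
  by (intro square_integrable_bounded[where B = K] filtration_measurable[OF Y_adapted] Y_bound)

lemma euler_error_square_integrable:
  assumes "0 < r" "0 < N"
  shows "square_integrable (\<lambda>\<omega>. euler r N m \<omega> - Y (real m * r / real N) \<omega>)"
  unfolding euler_diff
  by (intro square_integrable_diff psum_square_integrable mart_square_integrable grid(1) assms)

lemma euler_square_integrable: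
  assumes "0 < r" "0 < N"
  shows "square_integrable (euler r N m)"
  using square_integrable_add[OF euler_error_square_integrable[OF assms, of m] Y_square_integrable[OF grid(1)[OF assms, of m]]]
  by simp

lemma euler_error:
  assumes "0 < r" "0 < N" "m \<le> N"
  shows "expectation (\<lambda>\<omega>. \<bar>euler r N m \<omega> - Y (real m * r / real N) \<omega>\<bar>) \<le> sqrt (err r N)"
proof -
  have "expectation (\<lambda>\<omega>. \<bar>euler r N m \<omega> - Y (real m * r / real N) \<omega>\<bar>)
      \<le> sqrt (expectation (\<lambda>\<omega>. (euler r N m \<omega> - Y (real m * r / real N) \<omega>)\<^sup>2))"
    by (intro expectation_abs_le_sqrt euler_error_square_integrable assms)
  also have "\<dots> \<le> sqrt (err r N)"
    unfolding euler_diff using psum_error_le[OF assms] by simp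
  finally show ?thesis .
qed

end

section \<open>Generator terms and Ito formula for functions with three bounded derivatives\<close>

context ito_process
begin

lemma integrable_bounded_mult:
  assumes "g \<in> borel_measurable M" "v \<in> borel_measurable M"
    and "\<And>\<omega>. \<omega> \<in> space M \<Longrightarrow> \<bar>g \<omega>\<bar> \<le> (A::real)" "\<And>\<omega>. \<omega> \<in> space M \<Longrightarrow> \<bar>v \<omega>\<bar> \<le> B"
  shows "integrable M (\<lambda>\<omega>. g \<omega> * v \<omega>)"
  using assms by (intro square_integrable_mult square_integrable_bounded)

lemma c_norm_measurable: "0 \<le> s \<Longrightarrow> (\<lambda>\<omega>. (norm (c s \<omega>))\<^sup>2) \<in> borel_measurable M"
  using filtration_measurable[OF c_adapted, of s] by measurable

lemma c_norm_bound: "0 \<le> s \<Longrightarrow> \<omega> \<in> space M \<Longrightarrow> \<bar>(norm (c s \<omega>))\<^sup>2\<bar> \<le> K\<^sup>2"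
  using c_bound[of s \<omega>] by (auto intro!: power_mono)

context
  fixes f f' f'' f''' :: "real \<Rightarrow> real" and L :: real
  assumes deriv: "\<And>y. (f has_real_derivative f' y) (at y)" "\<And>y. (f' has_real_derivative f'' y) (at y)"
      "\<And>y. (f'' has_real_derivative f''' y) (at y)"
    and bound: "\<And>y. \<bar>f' y\<bar> \<le> L" "\<And>y. \<bar>f'' y\<bar> \<le> L" "\<And>y. \<bar>f''' y\<bar> \<le> L"
begin

lemma L_nonneg: "0 \<le> L"
  using bound(1)[of 0] abs_ge_zero[of "f' 0"] by linarith

lemma f_continuous: "continuous_on S f" "continuous_on S f'" "continuous_on S f''"
  by (rule DERIV_continuous_on[OF has_field_derivative_at_within], rule deriv)+

lemma f_borel: "f \<in> borel_measurable borel" "f' \<in> borel_measurable borel" "f'' \<in> borel_measurable borel"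
  by (rule borel_measurable_continuous_onI, rule f_continuous)+

text \<open>\<open>f\<close> itself may be unbounded, as the regularised logarithm is; the bound on
  \<open>f'\<close> gives linear growth, which an integrable argument can bear.\<close>

lemma f_integrable:
  assumes "square_integrable g"
  shows "integrable M (\<lambda>\<omega>. f (g \<omega>))"
proof (rule Bochner_Integration.integrable_bound)
  have g: "g \<in> borel_measurable M" using assms by (simp add: square_integrable_def)
  show "(\<lambda>\<omega>. f (g \<omega>)) \<in> borel_measurable M"
    using g f_borel(1) by (rule measurable_compose)
  show "integrable M (\<lambda>\<omega>. \<bar>f 0\<bar> + L * \<bar>g \<omega>\<bar>)"
    using square_integrable_integrable[OF assms] by simp
  have "\<bar>f (g \<omega>)\<bar> \<le> \<bar>f 0\<bar> + L * \<bar>g \<omega>\<bar>" for \<omega>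
    using lipschitz_of_bounded_derivative[OF deriv(1) bound(1), of "g \<omega>" 0] by simp
  then show "AE \<omega> in M. norm (f (g \<omega>)) \<le> norm (\<bar>f 0\<bar> + L * \<bar>g \<omega>\<bar>)"
    by (intro AE_I2) (metis abs_ge_self order_trans real_norm_def)
qed

lemma f_measurable:
  assumes "g \<in> borel_measurable N"
  shows "(\<lambda>\<omega>. f' (g \<omega>)) \<in> borel_measurable N" "(\<lambda>\<omega>. f'' (g \<omega>)) \<in> borel_measurable N"
  using measurable_compose[OF assms f_borel(2)] measurable_compose[OF assms f_borel(3)] by auto

lemma generator_terms_integrable:
  assumes "0 < r" "0 < N" and g: "g \<in> borel_measurable M"
  shows "integrable M (\<lambda>\<omega>. f' (g \<omega>) * bint r N k \<omega>)"
    and "integrable M (\<lambda>\<omega>. f'' (g \<omega>) * (norm (c (real k * r / real N) \<omega>))\<^sup>2)"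
proof -
  note s = grid(1)[OF assms(1,2), of k]
  show "integrable M (\<lambda>\<omega>. f' (g \<omega>) * bint r N k \<omega>)"
    by (intro integrable_bounded_mult[where A = L and B = "K * (r / real N)"] f_measurable g
        bint_measurable bound bint_bound assms)
  show "integrable M (\<lambda>\<omega>. f'' (g \<omega>) * (norm (c (real k * r / real N) \<omega>))\<^sup>2)"
    by (intro integrable_bounded_mult[where A = L and B = "K\<^sup>2"] f_measurable g
        c_norm_measurable bound c_norm_bound s)
qed

text \<open>At the grid time \<open>f'\<close> and \<open>f''\<close> are already known, so the
  linear noise term has mean zero and the squared increment is replaced by its conditional mean. The
  drift term stays a product inside the expectation, because \<open>bint r N m\<close> looks beyond
  the grid time.\<close>

lemma euler_step:
  assumes r: "0 < r" and N: "0 < N" and small: "r / real N \<le> 1"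
  shows "\<bar>expectation (\<lambda>\<omega>. f (euler r N (Suc m) \<omega>)) - expectation (\<lambda>\<omega>. f (euler r N m \<omega>))
      - expectation (\<lambda>\<omega>. f' (euler r N m \<omega>) * bint r N m \<omega>)
      - r / real N / 2 * expectation (\<lambda>\<omega>. f'' (euler r N m \<omega>) * (norm (c (real m * r / real N) \<omega>))\<^sup>2)\<bar>
    \<le> L * (2 * K\<^sup>2 + K ^ 4 + 2) * (1 + K\<^sup>2 + 3 * (real CARD('n))\<^sup>2 * K ^ 4) * (r / real N * sqrt (r / real N))"
proof -
  define h where "h = r / real N"
  \<comment> \<open>The scale of the noise increment: the drift increment is bounded by
    \<open>K * q\<^sup>2\<close>, as \<open>taylor_increment_bound\<close> asks.\<close>
  define q where "q = sqrt h"
  have h: "0 < h" using r N by (simp add: h_def)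
  have q: "0 < q" "q \<le> 1" "q\<^sup>2 = h" using h small by (auto simp: q_def h_def)
  define L' where "L' = L * (2 * K\<^sup>2 + K ^ 4 + 2)"
  have L'0: "0 \<le> L'" unfolding L'_def using L_nonneg K_nonneg by simp
  let ?Z = "euler r N m" and ?w = "incr r N m" and ?B = "bint r N m"
  define T where "T = (\<lambda>\<omega>. f (euler r N (Suc m) \<omega>) - f (?Z \<omega>) - f' (?Z \<omega>) * ?B \<omega>
      - f' (?Z \<omega>) * ?w \<omega> - f'' (?Z \<omega>) * (?w \<omega>)\<^sup>2 / 2)"
  define Q where "Q = (\<lambda>\<omega>. L' * (q ^ 3 + q * (?w \<omega>)\<^sup>2 + (?w \<omega>) ^ 4 / q))"
  have Zm: "?Z \<in> borel_measurable (F (real m * r / real N))"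
    using r N by (rule euler_measurable)
  note ZM = filtration_measurable[OF Zm]
  have f'int: "integrable M (\<lambda>\<omega>. f' (?Z \<omega>))" and f''int: "integrable M (\<lambda>\<omega>. f'' (?Z \<omega>))"
    using f_measurable[OF ZM] bound by (auto intro!: integrable_const_bound[where B = L])
  note i1 = f_integrable[OF euler_square_integrable[OF r N, of "Suc m"]]
  note i2 = f_integrable[OF euler_square_integrable[OF r N, of m]]
  note i3 = generator_terms_integrable(1)[OF r N ZM, of m]
  note i4 = incr_mean[OF r N f_measurable(1)[OF Zm] f'int]
  note i5 = incr_variance[OF r N f_measurable(2)[OF Zm] f''int]
  have Tint: "integrable M T"
    unfolding T_def using i1 i2 i3 i4 i5 by (simp add: has_bochner_integral_iff)
  have ET: "expectation T = expectation (\<lambda>\<omega>. f (euler r N (Suc m) \<omega>)) - expectation (\<lambda>\<omega>. f (?Z \<omega>))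
      - expectation (\<lambda>\<omega>. f' (?Z \<omega>) * ?B \<omega>)
      - h / 2 * expectation (\<lambda>\<omega>. f'' (?Z \<omega>) * (norm (c (real m * r / real N) \<omega>))\<^sup>2)"
    unfolding T_def h_def using i1 i2 i3 i4 i5 by (simp add: has_bochner_integral_iff)
  note m2 = incr_second_moment[OF r N, of m] and m4 = incr_fourth_moment[OF r N, of m]
  have Qint: "integrable M Q"
    unfolding Q_def using m2(1) m4(1) by simp
  have TQ: "\<bar>T \<omega>\<bar> \<le> Q \<omega>" if "\<omega> \<in> space M" for \<omega>
  proof -
    have "\<bar>?B \<omega>\<bar> \<le> K * q\<^sup>2"
      using bint_bound[OF r N that, of m] q(3) by (simp add: h_def)
    from taylor_increment_bound[OF deriv bound(2,3) q(1,2) K_nonneg this, of "?Z \<omega>" "?w \<omega>"]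
    show ?thesis unfolding T_def Q_def L'_def euler_Suc .
  qed
  have "\<bar>expectation T\<bar> \<le> expectation (\<lambda>\<omega>. \<bar>T \<omega>\<bar>)"
    by (rule integral_abs_bound)
  also have "\<dots> \<le> expectation Q"
    using Tint Qint TQ by (intro integral_mono) auto
  also have "expectation Q = L' * (q ^ 3 + q * expectation (\<lambda>\<omega>. (?w \<omega>)\<^sup>2) + expectation (\<lambda>\<omega>. (?w \<omega>) ^ 4) / q)"
    unfolding Q_def using m2(1) m4(1) by (simp add: prob_space)
  also have "\<dots> \<le> L' * (q ^ 3 + q * (K\<^sup>2 * h) + (3 * (real CARD('n))\<^sup>2 * K ^ 4 * h\<^sup>2) / q)"
    using m2(2) m4(2) q(1) L'0 unfolding h_def
    by (intro mult_left_mono add_mono divide_right_mono order_refl) auto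
  \<comment> \<open>All three terms are multiples of \<open>h * q\<close>, one factor
    \<open>q\<close> better than the step length; this makes the sum over all steps vanish in the
    limit.\<close>
  also have "\<dots> = L' * (1 + K\<^sup>2 + 3 * (real CARD('n))\<^sup>2 * K ^ 4) * (h * q)"
  proof -
    have 1: "q ^ 3 = 1 * (h * q)" and 2: "q * (K\<^sup>2 * h) = K\<^sup>2 * (h * q)"
      using q(3) by (auto simp: power3_eq_cube power2_eq_square)
    have 3: "(a * h\<^sup>2) / q = a * (h * q)" for a
      unfolding q(3)[symmetric] using q(1) by (simp add: power2_eq_square)
    show ?thesis unfolding 1 2 3 by (simp add: algebra_simps)
  qed
  finally show ?thesis
    unfolding ET L'_def q_def h_def .
qed

text \<open>\<open>f'\<close> and \<open>f''\<close> are Lipschitz with constant \<open>L\<close>,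
  so replacing \<open>euler\<close> by \<open>Y\<close> costs \<open>L\<close> times the mean
  distance, which is at most \<open>sqrt (err r N)\<close> at every grid point.\<close>

lemma generator_terms_lipschitz:
  assumes r: "0 < r" and N: "0 < N" and m: "m \<le> N"
  shows "\<bar>expectation (\<lambda>\<omega>. f' (euler r N m \<omega>) * bint r N m \<omega>)
      - expectation (\<lambda>\<omega>. f' (Y (real m * r / real N) \<omega>) * bint r N m \<omega>)\<bar>
      \<le> L * K * (r / real N) * sqrt (err r N)"
    and "\<bar>expectation (\<lambda>\<omega>. f'' (euler r N m \<omega>) * (norm (c (real m * r / real N) \<omega>))\<^sup>2)
      - expectation (\<lambda>\<omega>. f'' (Y (real m * r / real N) \<omega>) * (norm (c (real m * r / real N) \<omega>))\<^sup>2)\<bar>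
      \<le> L * K\<^sup>2 * sqrt (err r N)"
proof -
  let ?Y = "Y (real m * r / real N)" and ?Z = "euler r N m"
  note s = grid(1)[OF r N, of m]
  have ZM: "?Z \<in> borel_measurable M" and YM: "?Y \<in> borel_measurable M"
    using filtration_measurable[OF euler_measurable[OF r N]] filtration_measurable[OF Y_adapted[OF s]] by auto
  have e2: "integrable M (\<lambda>\<omega>. \<bar>?Z \<omega> - ?Y \<omega>\<bar>)"
    using square_integrable_integrable[OF euler_error_square_integrable[OF r N, of m]] by simp
  have *: "\<bar>expectation (\<lambda>\<omega>. g (?Z \<omega>) * v \<omega>) - expectation (\<lambda>\<omega>. g (?Y \<omega>) * v \<omega>)\<bar> \<le> L * B * sqrt (err r N)"
    if g: "\<And>a b. \<bar>g a - g b\<bar> \<le> L * \<bar>a - b\<bar>" and v: "\<And>\<omega>. \<omega> \<in> space M \<Longrightarrow> \<bar>v \<omega>\<bar> \<le> B"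
      and int: "integrable M (\<lambda>\<omega>. g (?Z \<omega>) * v \<omega>)" "integrable M (\<lambda>\<omega>. g (?Y \<omega>) * v \<omega>)" and B: "0 \<le> B"
    for g :: "real \<Rightarrow> real" and v B
  proof -
    have "\<bar>expectation (\<lambda>\<omega>. g (?Z \<omega>) * v \<omega>) - expectation (\<lambda>\<omega>. g (?Y \<omega>) * v \<omega>)\<bar>
        = \<bar>expectation (\<lambda>\<omega>. g (?Z \<omega>) * v \<omega> - g (?Y \<omega>) * v \<omega>)\<bar>"
      using int by simp
    also have "\<dots> \<le> expectation (\<lambda>\<omega>. \<bar>g (?Z \<omega>) * v \<omega> - g (?Y \<omega>) * v \<omega>\<bar>)"
      by (rule integral_abs_bound)
    also have "\<dots> \<le> expectation (\<lambda>\<omega>. L * B * \<bar>?Z \<omega> - ?Y \<omega>\<bar>)"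
    proof (rule integral_mono)
      show "integrable M (\<lambda>\<omega>. \<bar>g (?Z \<omega>) * v \<omega> - g (?Y \<omega>) * v \<omega>\<bar>)" using int by simp
      show "integrable M (\<lambda>\<omega>. L * B * \<bar>?Z \<omega> - ?Y \<omega>\<bar>)" using e2 by simp
      fix \<omega> assume "\<omega> \<in> space M"
      then have "\<bar>g (?Z \<omega>) - g (?Y \<omega>)\<bar> * \<bar>v \<omega>\<bar> \<le> (L * \<bar>?Z \<omega> - ?Y \<omega>\<bar>) * B"
        using g v L_nonneg by (intro mult_mono) auto
      then show "\<bar>g (?Z \<omega>) * v \<omega> - g (?Y \<omega>) * v \<omega>\<bar> \<le> L * B * \<bar>?Z \<omega> - ?Y \<omega>\<bar>"
        by (simp add: left_diff_distrib[symmetric] abs_mult mult.assoc mult.commute[of B])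
    qed
    also have "\<dots> \<le> L * B * sqrt (err r N)"
      using euler_error[OF r N m] L_nonneg B by (simp add: mult_left_mono)
    finally show ?thesis .
  qed
  show "\<bar>expectation (\<lambda>\<omega>. f' (?Z \<omega>) * bint r N m \<omega>) - expectation (\<lambda>\<omega>. f' (?Y \<omega>) * bint r N m \<omega>)\<bar>
      \<le> L * K * (r / real N) * sqrt (err r N)"
    using *[OF lipschitz_of_bounded_derivative[OF deriv(2) bound(2)] bint_bound[OF r N]
        generator_terms_integrable(1)[OF r N ZM] generator_terms_integrable(1)[OF r N YM]] K_nonneg r
    by (simp add: mult.assoc)
  show "\<bar>expectation (\<lambda>\<omega>. f'' (?Z \<omega>) * (norm (c (real m * r / real N) \<omega>))\<^sup>2)
      - expectation (\<lambda>\<omega>. f'' (?Y \<omega>) * (norm (c (real m * r / real N) \<omega>))\<^sup>2)\<bar>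
      \<le> L * K\<^sup>2 * sqrt (err r N)"
    by (intro * lipschitz_of_bounded_derivative[OF deriv(3) bound(3)] c_norm_bound[OF s]
        generator_terms_integrable(2)[OF r N ZM] generator_terms_integrable(2)[OF r N YM]) auto
qed

text \<open>A Riemann sum for the time integral of the generator along \<open>Y\<close>. The drift
  is integrated exactly over each cell and the second-order term is frozen at the left end, which is
  the form delivered by \<open>euler_step\<close>.\<close>

definition gen_sum :: "real \<Rightarrow> nat \<Rightarrow> 'a \<Rightarrow> real" where
  "gen_sum r N \<omega> = (\<Sum>k<N. f' (Y (real k * r / real N) \<omega>) * bint r N k \<omega>
     + r / real N / 2 * (f'' (Y (real k * r / real N) \<omega>) * (norm (c (real k * r / real N) \<omega>))\<^sup>2))"

text \<open>The expectations of \<open>f\<close> along \<open>euler\<close> telescope. Each step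
  loses \<open>C * h * sqrt h\<close> by Taylor and a multiple of \<open>h * sqrt (err r N)\<close>
  by the passage to \<open>Y\<close>; over \<open>r / h\<close> steps this gives the terms with
  factor \<open>r\<close>. The remaining \<open>L\<close> pays for replacing \<open>euler\<close> by
  \<open>Y\<close> inside \<open>f\<close> at the final time.\<close>

lemma gen_sum_error:
  assumes r: "0 < r" and N: "0 < N" and small: "r / real N \<le> 1"
  defines "C \<equiv> L * (2 * K\<^sup>2 + K ^ 4 + 2) * (1 + K\<^sup>2 + 3 * (real CARD('n))\<^sup>2 * K ^ 4)"
  shows "\<bar>expectation (\<lambda>\<omega>. f (Y r \<omega>)) - f y0 - expectation (gen_sum r N)\<bar>
    \<le> C * r * sqrt (r / real N) + (L + L * K * r + L * K\<^sup>2 * r / 2) * sqrt (err r N)"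
proof -
  define h where "h = r / real N"
  have h0: "0 < h" using r N by (simp add: h_def)
  have Nh: "real N * h = r" using N by (simp add: h_def)
  define e where "e = sqrt (err r N)"
  define E where "E = (\<lambda>m. expectation (\<lambda>\<omega>. f (euler r N m \<omega>)))"
  define a a' where "a = (\<lambda>m. expectation (\<lambda>\<omega>. f' (euler r N m \<omega>) * bint r N m \<omega>))"
    and "a' = (\<lambda>m. expectation (\<lambda>\<omega>. f' (Y (real m * r / real N) \<omega>) * bint r N m \<omega>))"
  define d d' where "d = (\<lambda>m. expectation (\<lambda>\<omega>. f'' (euler r N m \<omega>) * (norm (c (real m * r / real N) \<omega>))\<^sup>2))"
    and "d' = (\<lambda>m. expectation (\<lambda>\<omega>. f'' (Y (real m * r / real N) \<omega>) * (norm (c (real m * r / real N) \<omega>))\<^sup>2))"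
  have step: "\<bar>E (Suc m) - E m - (a' m + h / 2 * d' m)\<bar> \<le> C * (h * sqrt h) + L * K * h * e + h / 2 * (L * K\<^sup>2 * e)"
    if "m < N" for m
  proof -
    have 1: "\<bar>E (Suc m) - E m - a m - h / 2 * d m\<bar> \<le> C * (h * sqrt h)"
      using euler_step[OF r N small, of m] unfolding E_def a_def d_def h_def C_def .
    have 2: "\<bar>a m - a' m\<bar> \<le> L * K * h * e" and "\<bar>d m - d' m\<bar> \<le> L * K\<^sup>2 * e"
      using generator_terms_lipschitz[OF r N, of m] that unfolding a_def a'_def d_def d'_def h_def e_def by auto
    then have "h / 2 * \<bar>d m - d' m\<bar> \<le> h / 2 * (L * K\<^sup>2 * e)"
      using h0 by (intro mult_left_mono) auto
    moreover have "\<bar>h / 2 * d m - h / 2 * d' m\<bar> = h / 2 * \<bar>d m - d' m\<bar>"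
      using h0 by (simp only: right_diff_distrib[symmetric] abs_mult)
    ultimately have 3: "\<bar>h / 2 * d m - h / 2 * d' m\<bar> \<le> h / 2 * (L * K\<^sup>2 * e)"
      by (simp only:)
    show ?thesis using 1 2 3 by linarith
  qed
  have s: "0 \<le> real k * r / real N" for k using grid(1)[OF r N] .
  have YM: "Y (real k * r / real N) \<in> borel_measurable M" for k
    using filtration_measurable[OF Y_adapted[OF s]] .
  have gen: "expectation (gen_sum r N) = (\<Sum>k<N. a' k + h / 2 * d' k)"
    unfolding gen_sum_def[abs_def] a'_def d'_def h_def
    using generator_terms_integrable[OF r N YM] by (simp add: Bochner_Integration.integral_sum)
  have E0: "E 0 = f y0" unfolding E_def by (simp add: euler_0 prob_space)
  have "\<bar>E N - f y0 - expectation (gen_sum r N)\<bar> = \<bar>\<Sum>k<N. E (Suc k) - E k - (a' k + h / 2 * d' k)\<bar>"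
    unfolding gen E0[symmetric] by (simp add: sum_subtractf[of "\<lambda>k. E (Suc k) - E k"] sum_lessThan_telescope)
  also have "\<dots> \<le> (\<Sum>k<N. \<bar>E (Suc k) - E k - (a' k + h / 2 * d' k)\<bar>)"
    by (rule sum_abs)
  also have "\<dots> \<le> (\<Sum>k<N. C * (h * sqrt h) + L * K * h * e + h / 2 * (L * K\<^sup>2 * e))"
    using step by (intro sum_mono) auto
  also have "\<dots> = C * r * sqrt h + L * K * r * e + L * K\<^sup>2 * r / 2 * e"
    unfolding Nh[symmetric] by (simp add: algebra_simps)
  finally have A: "\<bar>E N - f y0 - expectation (gen_sum r N)\<bar> \<le> C * r * sqrt h + L * K * r * e + L * K\<^sup>2 * r / 2 * e" .
  have Nr: "real N * r / real N = r" using N by simp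
  have "\<bar>E N - expectation (\<lambda>\<omega>. f (Y r \<omega>))\<bar> = \<bar>expectation (\<lambda>\<omega>. f (euler r N N \<omega>) - f (Y r \<omega>))\<bar>"
    unfolding E_def
    using f_integrable[OF euler_square_integrable[OF r N, of N]] f_integrable[OF Y_square_integrable, of r] r by simp
  also have "\<dots> \<le> expectation (\<lambda>\<omega>. \<bar>f (euler r N N \<omega>) - f (Y r \<omega>)\<bar>)"
    by (rule integral_abs_bound)
  also have "\<dots> \<le> expectation (\<lambda>\<omega>. L * \<bar>euler r N N \<omega> - Y r \<omega>\<bar>)"
    using f_integrable[OF euler_square_integrable[OF r N, of N]] f_integrable[OF Y_square_integrable, of r] r
      square_integrable_integrable[OF euler_error_square_integrable[OF r N, of N]] Nr
    by (intro integral_mono lipschitz_of_bounded_derivative[OF deriv(1) bound(1)]) auto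
  also have "\<dots> \<le> L * e"
    using euler_error[OF r N, of N] L_nonneg Nr by (simp add: e_def mult_left_mono)
  finally have B: "\<bar>E N - expectation (\<lambda>\<omega>. f (Y r \<omega>))\<bar> \<le> L * e" .
  have "\<bar>expectation (\<lambda>\<omega>. f (Y r \<omega>)) - f y0 - expectation (gen_sum r N)\<bar>
      \<le> C * r * sqrt h + L * K * r * e + L * K\<^sup>2 * r / 2 * e + L * e"
    using A B by linarith
  also have "\<dots> = C * r * sqrt h + (L + L * K * r + L * K\<^sup>2 * r / 2) * e"
    by (simp add: algebra_simps)
  finally show ?thesis unfolding e_def h_def .
qed

lemma generator_continuous:
  assumes "\<omega> \<in> space M"
  shows "continuous_on {0..} (\<lambda>s. f' (Y s \<omega>) * b s \<omega> + f'' (Y s \<omega>) / 2 * (norm (c s \<omega>))\<^sup>2)"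
  using Y_cont[OF assms] b_cont[OF assms] c_cont[OF assms]
  by (intro continuous_intros continuous_on_compose2[OF f_continuous(2)[of UNIV]]
      continuous_on_compose2[OF f_continuous(3)[of UNIV]]) auto

text \<open>Along each path, \<open>Riemann_Stieltjes_sum_tendsto\<close> is applied twice, with the
  drift and with the constant 1 as second function; the bounds on the coefficients dominate all sums
  by one constant.\<close>

lemma gen_sum_tendsto:
  assumes r: "0 < r"
  shows "(\<lambda>N. expectation (gen_sum r N)) \<longlonglongrightarrow> expectation (\<lambda>\<omega>. integral {0..r}
      (\<lambda>s. f' (Y s \<omega>) * b s \<omega> + f'' (Y s \<omega>) / 2 * (norm (c s \<omega>))\<^sup>2))"
proof (rule integral_dominated_convergence)
  let ?G = "\<lambda>s \<omega>. f' (Y s \<omega>) * b s \<omega> + f'' (Y s \<omega>) / 2 * (norm (c s \<omega>))\<^sup>2"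
  have "?G s \<in> borel_measurable (F s)" if "0 \<le> s" for s
    using f_measurable[OF Y_adapted[OF that]] b_adapted[OF that] c_adapted[OF that] by measurable
  then show "(\<lambda>\<omega>. integral {0..r} (\<lambda>s. ?G s \<omega>)) \<in> borel_measurable M"
    using r generator_continuous by (intro filtration_measurable[OF integral_adapted_measurable]) auto
  have s: "0 \<le> real k * r / real N" for k N using r by simp
  show "gen_sum r N \<in> borel_measurable M" for N
  proof (cases "N = 0")
    case True then show ?thesis by (simp add: gen_sum_def[abs_def])
  next
    case False
    then have "integrable M (gen_sum r N)"
      unfolding gen_sum_def[abs_def]
      using generator_terms_integrable[OF r, of N, OF _ filtration_measurable[OF Y_adapted[OF s]]] by simp
    then show ?thesis by simp
  qed
  define B where "B = L * K * r + L * K\<^sup>2 * r / 2"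
  have B0: "0 \<le> B" unfolding B_def using L_nonneg K_nonneg r by simp
  show "integrable M (\<lambda>_. B)" by simp
  have le: "\<bar>gen_sum r N \<omega>\<bar> \<le> B" if \<omega>: "\<omega> \<in> space M" for N \<omega>
  proof (cases "N = 0")
    case True then show ?thesis using B0 by (simp add: gen_sum_def)
  next
    case False
    then have N: "0 < N" by simp
    define h where "h = r / real N"
    have h0: "0 < h" using r N by (simp add: h_def)
    have "\<bar>gen_sum r N \<omega>\<bar> \<le> (\<Sum>k<N. \<bar>f' (Y (real k * r / real N) \<omega>) * bint r N k \<omega>
     + r / real N / 2 * (f'' (Y (real k * r / real N) \<omega>) * (norm (c (real k * r / real N) \<omega>))\<^sup>2)\<bar>)"
      unfolding gen_sum_def by (rule sum_abs)
    also have "\<dots> \<le> (\<Sum>k<N. L * (K * h) + h / 2 * (L * K\<^sup>2))"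
    proof (rule sum_mono)
      fix k assume "k \<in> {..<N}"
      let ?y = "Y (real k * r / real N) \<omega>" and ?c = "(norm (c (real k * r / real N) \<omega>))\<^sup>2"
      have 1: "\<bar>f' ?y * bint r N k \<omega>\<bar> \<le> L * (K * h)"
        unfolding abs_mult h_def using bint_bound[OF r N \<omega>, of k] bound(1) L_nonneg by (intro mult_mono) auto
      have 2: "\<bar>f'' ?y * ?c\<bar> \<le> L * K\<^sup>2"
        unfolding abs_mult using c_norm_bound[OF s \<omega>, of k N] bound(2) L_nonneg by (intro mult_mono) auto
      have "\<bar>h / 2 * (f'' ?y * ?c)\<bar> = h / 2 * \<bar>f'' ?y * ?c\<bar>"
        using h0 by (simp add: abs_mult)
      also have "\<dots> \<le> h / 2 * (L * K\<^sup>2)"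
        using 2 h0 by (intro mult_left_mono) auto
      finally show "\<bar>f' ?y * bint r N k \<omega> + r / real N / 2 * (f'' ?y * ?c)\<bar> \<le> L * (K * h) + h / 2 * (L * K\<^sup>2)"
        using 1 unfolding h_def[symmetric] by linarith
    qed
    also have "\<dots> = B" unfolding B_def h_def using N by (simp add: field_simps)
    finally show ?thesis .
  qed
  then show "AE \<omega> in M. norm (gen_sum r N \<omega>) \<le> B" for N by simp
  show "AE \<omega> in M. (\<lambda>N. gen_sum r N \<omega>) \<longlonglongrightarrow> integral {0..r} (\<lambda>s. ?G s \<omega>)"
  proof (rule AE_I2)
    fix \<omega> assume \<omega>: "\<omega> \<in> space M"
    let ?s = "\<lambda>N k. real k * r / real N"
    let ?g = "\<lambda>s. f'' (Y s \<omega>) / 2 * (norm (c s \<omega>))\<^sup>2"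
    have sub: "{0..r} \<subseteq> {0..}" by auto
    note Yc = continuous_on_subset[OF Y_cont[OF \<omega>] sub] and bc = continuous_on_subset[OF b_cont[OF \<omega>] sub]
      and cc = continuous_on_subset[OF c_cont[OF \<omega>] sub]
    have c1: "continuous_on {0..r} (\<lambda>s. f' (Y s \<omega>))"
      by (intro continuous_on_compose2[OF f_continuous(2)[of UNIV] Yc]) auto
    have c2: "continuous_on {0..r} ?g"
      by (intro continuous_intros continuous_on_compose2[OF f_continuous(3)[of UNIV] Yc] cc) auto
    have "(\<lambda>N. (\<Sum>k<N. f' (Y (?s N k) \<omega>) * integral {?s N k..?s N (Suc k)} (\<lambda>s. b s \<omega>))
        + (\<Sum>k<N. ?g (?s N k) * integral {?s N k..?s N (Suc k)} (\<lambda>_. 1)))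
      \<longlonglongrightarrow> integral {0..r} (\<lambda>s. f' (Y s \<omega>) * b s \<omega>) + integral {0..r} (\<lambda>s. ?g s * 1)"
      using r by (intro tendsto_add Riemann_Stieltjes_sum_tendsto c1 c2 bc continuous_on_const) auto
    also have "integral {0..r} (\<lambda>s. f' (Y s \<omega>) * b s \<omega>) + integral {0..r} (\<lambda>s. ?g s * 1)
        = integral {0..r} (\<lambda>s. ?G s \<omega>)"
      unfolding mult_1_right
      by (intro integral_add[symmetric] integrable_continuous_interval continuous_on_mult[OF c1 bc] c2)
    also have "(\<lambda>N. (\<Sum>k<N. f' (Y (?s N k) \<omega>) * integral {?s N k..?s N (Suc k)} (\<lambda>s. b s \<omega>))
        + (\<Sum>k<N. ?g (?s N k) * integral {?s N k..?s N (Suc k)} (\<lambda>_. 1))) = (\<lambda>N. gen_sum r N \<omega>)"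
    proof
      fix N
      show "(\<Sum>k<N. f' (Y (?s N k) \<omega>) * integral {?s N k..?s N (Suc k)} (\<lambda>s. b s \<omega>))
        + (\<Sum>k<N. ?g (?s N k) * integral {?s N k..?s N (Suc k)} (\<lambda>_. 1)) = gen_sum r N \<omega>"
      proof (cases "N = 0")
        case True then show ?thesis by (simp add: gen_sum_def)
      next
        case False
        then have N: "0 < N" by simp
        have "integral {?s N k..?s N (Suc k)} (\<lambda>_. 1) = r / real N" for k
          using grid(2,3)[OF r N, of k] by (simp del: of_nat_Suc)
        then show ?thesis
          unfolding gen_sum_def bint_eq[OF r N \<omega>] sum.distrib by (simp add: algebra_simps del: of_nat_Suc)
      qed
    qed
    finally show "(\<lambda>N. gen_sum r N \<omega>) \<longlonglongrightarrow> integral {0..r} (\<lambda>s. ?G s \<omega>)" .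
  qed
qed

text \<open>The two sources of error vanish for different reasons: the mesh
  \<open>r / real N\<close> by itself, \<open>err r\<close> by the mean-square assumption.\<close>

theorem ito_formula:
  assumes r: "0 < r"
  shows "expectation (\<lambda>\<omega>. f (Y r \<omega>)) = f y0 + expectation (\<lambda>\<omega>. integral {0..r}
      (\<lambda>s. f' (Y s \<omega>) * b s \<omega> + f'' (Y s \<omega>) / 2 * (norm (c s \<omega>))\<^sup>2))"
proof -
  define C where "C = L * (2 * K\<^sup>2 + K ^ 4 + 2) * (1 + K\<^sup>2 + 3 * (real CARD('n))\<^sup>2 * K ^ 4)"
  define \<eta> where "\<eta> = (\<lambda>N. C * r * sqrt (r / real N) + (L + L * K * r + L * K\<^sup>2 * r / 2) * sqrt (err r N))"
  let ?q = "\<lambda>N. expectation (\<lambda>\<omega>. f (Y r \<omega>)) - f y0 - expectation (gen_sum r N)"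
  have rN: "(\<lambda>N. r / real N) \<longlonglongrightarrow> 0"
    by (rule lim_const_over_n)
  then have "(\<lambda>N. sqrt (r / real N)) \<longlonglongrightarrow> 0" "(\<lambda>N. sqrt (err r N)) \<longlonglongrightarrow> 0"
    using err_tendsto[OF r] tendsto_real_sqrt by fastforce+
  then have "\<eta> \<longlonglongrightarrow> C * r * 0 + (L + L * K * r + L * K\<^sup>2 * r / 2) * 0"
    unfolding \<eta>_def by (intro tendsto_add tendsto_mult tendsto_const)
  then have \<eta>: "\<eta> \<longlonglongrightarrow> 0" by simp
  have "eventually (\<lambda>N. r / real N < 1) sequentially"
    using rN by (rule order_tendstoD) simp
  then have "eventually (\<lambda>N. norm (?q N) \<le> \<eta> N) sequentially"
    using eventually_gt_at_top[of 0]
  proof eventually_elim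
    case (elim N)
    then show ?case
      using gen_sum_error[OF r, of N] unfolding \<eta>_def C_def by simp
  qed
  then have "?q \<longlonglongrightarrow> 0"
    using \<eta> by (rule Lim_null_comparison)
  moreover have "?q \<longlonglongrightarrow> expectation (\<lambda>\<omega>. f (Y r \<omega>)) - f y0 - expectation (\<lambda>\<omega>. integral {0..r}
      (\<lambda>s. f' (Y s \<omega>) * b s \<omega> + f'' (Y s \<omega>) / 2 * (norm (c s \<omega>))\<^sup>2))"
    by (intro tendsto_diff tendsto_const gen_sum_tendsto r)
  ultimately show ?thesis
    using LIMSEQ_unique by fastforce
qed

end

end

section \<open>The replicator generator and the regularised logarithm\<close>

lemma diagv_mult: "(diagv v *v y) $ i = v $ i * y $ i"
proof -
  have "(diagv v *v y) $ i = (\<Sum>j\<in>UNIV. if i = j then v $ j * y $ j else 0)"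
    unfolding diagv_def matrix_vector_mult_def vec_lambda_beta by (intro sum.cong) auto
  then show ?thesis by simp
qed

lemma outer_mult: "outer x y *v v = (y \<bullet> v) *\<^sub>R x"
  by (simp add: vec_eq_iff outer_def matrix_vector_mult_def inner_vec_def sum_distrib_left mult_ac)

lemma matrix_mult_diagv: "(B ** diagv s) $ i $ j = B $ i $ j * s $ j"
proof -
  have "(B ** diagv s) $ i $ j = (\<Sum>k\<in>UNIV. if k = j then B $ i $ k * s $ k else 0)"
    unfolding diagv_def matrix_matrix_mult_def vec_lambda_beta by (intro sum.cong) auto
  then show ?thesis by simp
qed

lemma inner_transpose_mult: "u \<bullet> (transpose B *v v) = (B *v u) \<bullet> v" for B :: "real^'n^'n"
  by (metis dot_lmul_matrix vector_transpose_matrix)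

lemma scaleR_matrix_vector_mult: "(k *\<^sub>R B) *v v = k *\<^sub>R (B *v v)" for B :: "real^'n^'n"
  by (simp add: vec_eq_iff matrix_vector_mult_def sum_distrib_left mult.assoc)

lemma ones_inner: "ones \<bullet> y = (\<Sum>i\<in>UNIV. y $ i)"
  by (simp add: ones_def inner_vec_def)

lemma drift_component:
  "drift A \<sigma> x $ i = x $ i * (((A - diagv (sq_vec \<sigma>)) *v x) $ i - x \<bullet> ((A - diagv (sq_vec \<sigma>)) *v x))"
  unfolding drift_def
  by (simp add: matrix_vector_mul_assoc[symmetric] matrix_vector_mult_diff_rdistrib diagv_mult outer_mult algebra_simps)

text \<open>The noise coefficient of \<open>ln (x $ i)\<close>: the factor \<open>x $ i\<close> of
  the corresponding row of \<open>diffusion\<close> is divided out, and what remains is bounded on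
  the simplex.\<close>

definition noise_row :: "real^'n \<Rightarrow> 'n \<Rightarrow> real^'n \<Rightarrow> real^'n" where
  "noise_row \<sigma> i x = (\<chi> j. \<sigma> $ j * ((if i = j then 1 else 0) - x $ j))"

lemma diffusion_row: "diffusion \<sigma> x $ i = x $ i *\<^sub>R noise_row \<sigma> i x"
  unfolding diffusion_def vec_eq_iff matrix_mult_diagv
  by (simp add: diagv_def outer_def noise_row_def algebra_simps)

lemma noise_row_norm:
  "(norm (noise_row \<sigma> i x))\<^sup>2 = (1 - 2 * x $ i) * (\<sigma> $ i)\<^sup>2 + (\<Sum>j\<in>UNIV. (x $ j)\<^sup>2 * (\<sigma> $ j)\<^sup>2)"
proof -
  have "(norm (noise_row \<sigma> i x))\<^sup>2
      = (\<Sum>j\<in>UNIV. (if j = i then (1 - 2 * x $ i) * (\<sigma> $ i)\<^sup>2 else 0) + (x $ j)\<^sup>2 * (\<sigma> $ j)\<^sup>2)"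
    unfolding power2_norm_eq_inner inner_vec_def noise_row_def
    by (intro sum.cong) (auto simp: algebra_simps power2_eq_square)
  then show ?thesis by (simp add: sum.distrib)
qed

text \<open>\<open>log_gen A \<sigma> i\<close> is the generator applied to \<open>- ln x\<^sub>i\<close>.\<close>

definition log_gen :: "real^'n^'n \<Rightarrow> real^'n \<Rightarrow> 'n \<Rightarrow> real^'n \<Rightarrow> real" where
  "log_gen A \<sigma> i x = x \<bullet> ((A - diagv (sq_vec \<sigma>)) *v x) - ((A - diagv (sq_vec \<sigma>)) *v x) $ i
     + (norm (noise_row \<sigma> i x))\<^sup>2 / 2"

text \<open>Explains the two different diagonal corrections of \<open>A\<close>: completing the
  square in the Ito terms leaves half of a \<open>\<sigma>\<close>-weighted square of
  \<open>x - p\<close>, which turns \<open>A - diagv (sq_vec \<sigma>)\<close> into the matrix with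
  half the correction. The part linear in \<open>x - p\<close> has the right sign by the equilibrium
  condition on \<open>p\<close>.\<close>

lemma sum_log_gen_le:
  fixes A :: "real^'n^'n"
  assumes ess: "is_ESS (A - diagv (sq_vec \<sigma>)) p" and x: "x \<in> cl_Delta"
  shows "(\<Sum>i\<in>UNIV. p $ i * log_gen A \<sigma> i x)
    \<le> (x - p) \<bullet> ((A - diagv ((1/2) *\<^sub>R sq_vec \<sigma>)) *v (x - p))
      + (1/2) * (\<Sum>j\<in>UNIV. p $ j * (1 - p $ j) * (\<sigma> $ j)\<^sup>2)"
proof -
  define B where "B = A - diagv (sq_vec \<sigma>)"
  define y where "y = x - p"
  have p1: "(\<Sum>i\<in>UNIV. p $ i) = 1"
    using ess by (simp add: is_ESS_def cl_Delta_def)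
  have nash: "y \<bullet> (B *v p) \<le> 0"
    using ess x unfolding is_ESS_def B_def y_def by (auto simp: inner_diff_left)
  have c1: "(\<Sum>i\<in>UNIV. p $ i * k) = k" for k
    using p1 by (simp add: sum_distrib_right[symmetric])
  have "(\<Sum>i\<in>UNIV. p $ i * log_gen A \<sigma> i x)
      = (\<Sum>i\<in>UNIV. p $ i * (x \<bullet> (B *v x))) - (\<Sum>i\<in>UNIV. p $ i * (B *v x) $ i)
        + ((\<Sum>i\<in>UNIV. p $ i * ((1 - 2 * x $ i) * (\<sigma> $ i)\<^sup>2))
           + (\<Sum>i\<in>UNIV. p $ i * (\<Sum>j\<in>UNIV. (x $ j)\<^sup>2 * (\<sigma> $ j)\<^sup>2))) / 2"
  proof -
    define R where "R = (\<Sum>j\<in>UNIV. (x $ j)\<^sup>2 * (\<sigma> $ j)\<^sup>2)"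
    have "p $ i * log_gen A \<sigma> i x = p $ i * (x \<bullet> (B *v x)) - p $ i * (B *v x) $ i
        + (p $ i * ((1 - 2 * x $ i) * (\<sigma> $ i)\<^sup>2) + p $ i * R) / 2" for i
      unfolding log_gen_def B_def[symmetric] noise_row_norm R_def[symmetric] by (simp add: field_simps)
    then show ?thesis
      unfolding R_def[symmetric] by (simp only: sum.distrib sum_subtractf sum_divide_distrib[symmetric])
  qed
  also have "\<dots> = y \<bullet> (B *v x)
      + (\<Sum>i\<in>UNIV. p $ i * ((1 - 2 * x $ i) * (\<sigma> $ i)\<^sup>2) + (x $ i)\<^sup>2 * (\<sigma> $ i)\<^sup>2) / 2"
    unfolding c1 by (simp add: y_def inner_vec_def sum.distrib left_diff_distrib sum_subtractf)
  \<comment> \<open>Completion of the square: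
    \<open>p * (1 - 2 * x) + x\<^sup>2 = p * (1 - p) + (x - p)\<^sup>2\<close> in each
    coordinate.\<close>
  also have "(\<Sum>i\<in>UNIV. p $ i * ((1 - 2 * x $ i) * (\<sigma> $ i)\<^sup>2) + (x $ i)\<^sup>2 * (\<sigma> $ i)\<^sup>2)
      = (\<Sum>i\<in>UNIV. p $ i * (1 - p $ i) * (\<sigma> $ i)\<^sup>2 + (\<sigma> $ i)\<^sup>2 * (y $ i)\<^sup>2)"
    by (intro sum.cong) (auto simp: y_def algebra_simps power2_eq_square)
  also have "y \<bullet> (B *v x) = y \<bullet> (B *v y) + y \<bullet> (B *v p)"
    unfolding y_def by (simp add: matrix_vector_mult_diff_distrib inner_diff_right)
  also have "y \<bullet> (B *v y) + y \<bullet> (B *v p)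
      + (\<Sum>i\<in>UNIV. p $ i * (1 - p $ i) * (\<sigma> $ i)\<^sup>2 + (\<sigma> $ i)\<^sup>2 * (y $ i)\<^sup>2) / 2
    \<le> y \<bullet> (B *v y) + (\<Sum>i\<in>UNIV. (\<sigma> $ i)\<^sup>2 * (y $ i)\<^sup>2) / 2
      + (1/2) * (\<Sum>i\<in>UNIV. p $ i * (1 - p $ i) * (\<sigma> $ i)\<^sup>2)"
    using nash by (simp add: sum.distrib add_divide_distrib)
  also have "y \<bullet> (B *v y) + (\<Sum>i\<in>UNIV. (\<sigma> $ i)\<^sup>2 * (y $ i)\<^sup>2) / 2
      = y \<bullet> ((A - diagv ((1/2) *\<^sub>R sq_vec \<sigma>)) *v y)"
  proof -
    have d: "y \<bullet> (diagv v *v y) = (\<Sum>i\<in>UNIV. v $ i * (y $ i)\<^sup>2)" for v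
      unfolding inner_vec_def by (simp add: diagv_mult power2_eq_square algebra_simps)
    show ?thesis
      unfolding B_def matrix_vector_mult_diff_rdistrib inner_diff_right d
      by (simp add: sq_vec_def sum_divide_distrib[symmetric] mult.assoc sum_distrib_left[symmetric])
  qed
  finally show ?thesis unfolding y_def .
qed

text \<open>\<open>S\<close> is the double centring of \<open>B\<close>: with \<open>P\<close> the
  orthogonal projection onto the complement of \<open>ones\<close>, it equals
  \<open>P ** B ** P\<close>. Hence it is symmetric, annihilates \<open>ones\<close> and has the
  same form as \<open>B\<close> on that complement.\<close>

lemma centred_matrix_bound:
  fixes A :: "real^'n^'n" and \<sigma> :: "real^'n"
  assumes card: "CARD('n) \<ge> 2" and cnd: "cond_neg_def (A - diagv ((1/2) *\<^sub>R sq_vec \<sigma>))"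
  defines "B \<equiv> (1/2) *\<^sub>R (A + transpose A - diagv (sq_vec \<sigma>))"
    and "n \<equiv> real CARD('n)"
  defines "S \<equiv> B - (1/n) *\<^sub>R (B ** outer ones ones) - (1/n) *\<^sub>R (outer ones ones ** B)
      + ((ones \<bullet> (B *v ones)) / n^2) *\<^sub>R outer ones ones"
  shows "second_largest_eigenvalue S < 0"
    and "\<And>y. ones \<bullet> y = 0 \<Longrightarrow> y \<bullet> ((A - diagv ((1/2) *\<^sub>R sq_vec \<sigma>)) *v y)
      \<le> second_largest_eigenvalue S * (norm y)\<^sup>2"
proof -
  have n: "n > 0" "(ones :: real^'n) \<bullet> ones = n"
    by (simp_all add: n_def ones_inner) (simp add: ones_def)
  have Bv: "B *v v = (1/2) *\<^sub>R (A *v v + transpose A *v v - diagv (sq_vec \<sigma>) *v v)" for v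
    unfolding B_def scaleR_matrix_vector_mult
    by (simp add: matrix_vector_mult_diff_rdistrib matrix_vector_mult_add_rdistrib)
  have dsym: "u \<bullet> (diagv w *v v) = (diagv w *v u) \<bullet> v" for u v w :: "real^'n"
    by (simp add: inner_vec_def diagv_mult algebra_simps)
  have Bsym: "u \<bullet> (B *v v) = (B *v u) \<bullet> v" for u v
  proof -
    have "u \<bullet> (A *v v) = (transpose A *v u) \<bullet> v"
      using inner_transpose_mult[of u "transpose A" v] by simp
    then show ?thesis
      unfolding Bv using inner_transpose_mult[of u A v] dsym[of u "sq_vec \<sigma>" v]
      by (simp only: inner_diff_left inner_diff_right inner_add_left inner_add_right
          inner_scaleR_left inner_scaleR_right add.commute)
  qed
  define \<kappa> where "\<kappa> = ones \<bullet> (B *v ones)"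
  have Sv: "S *v v = B *v v - ((ones \<bullet> v) / n) *\<^sub>R (B *v ones) - ((ones \<bullet> (B *v v)) / n) *\<^sub>R ones
      + (\<kappa> * (ones \<bullet> v) / n\<^sup>2) *\<^sub>R ones" for v
    unfolding S_def \<kappa>_def
    by (simp add: matrix_vector_mult_diff_rdistrib matrix_vector_mult_add_rdistrib scaleR_matrix_vector_mult
        matrix_vector_mul_assoc[symmetric] outer_mult matrix_vector_mult_scaleR)
  have uSv: "u \<bullet> (S *v v) = u \<bullet> (B *v v) - (ones \<bullet> v) * ((B *v ones) \<bullet> u) / n
      - ((B *v ones) \<bullet> v) * (ones \<bullet> u) / n + \<kappa> * (ones \<bullet> v) * (ones \<bullet> u) / n\<^sup>2" for u v
    unfolding Sv using Bsym[of ones v]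
    by (simp add: inner_diff_right inner_add_right inner_commute)
  have Ssym: "u \<bullet> (S *v v) = (S *v u) \<bullet> v" for u v
    unfolding inner_commute[of "S *v u" v] uSv using Bsym[of u v] by (simp add: inner_commute algebra_simps)
  have Sones: "S *v ones = 0"
    unfolding Sv n(2) \<kappa>_def[symmetric] using n(1) by (simp add: power2_eq_square)
  \<comment> \<open>Every centring term contains a factor \<open>ones \<bullet> y\<close>, and
    \<open>A\<close> and its transpose have the same quadratic form.\<close>
  have quad: "y \<bullet> (S *v y) = y \<bullet> ((A - diagv ((1/2) *\<^sub>R sq_vec \<sigma>)) *v y)" if "ones \<bullet> y = 0" for y
  proof -
    have "y \<bullet> (transpose A *v y) = y \<bullet> (A *v y)"
      using inner_transpose_mult[of y A y] inner_commute[of "A *v y" y] by (simp only:)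
    moreover have "diagv ((1/2) *\<^sub>R sq_vec \<sigma>) *v y = (1/2) *\<^sub>R (diagv (sq_vec \<sigma>) *v y)"
      by (simp add: vec_eq_iff diagv_mult)
    ultimately show ?thesis
      unfolding uSv that Bv matrix_vector_mult_diff_rdistrib
      by (simp add: inner_diff_right inner_add_right algebra_simps)
  qed
  have neg: "y \<bullet> (S *v y) < 0" if "y \<noteq> 0" "ones \<bullet> y = 0" for y
    unfolding quad[OF that(2)] using cnd that unfolding cond_neg_def_def by blast
  show "second_largest_eigenvalue S < 0"
    by (rule second_largest_eigenvalue_bound(1)[OF card Ssym Sones neg])
  show "y \<bullet> ((A - diagv ((1/2) *\<^sub>R sq_vec \<sigma>)) *v y) \<le> second_largest_eigenvalue S * (norm y)\<^sup>2"
    if "ones \<bullet> y = 0" for y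
    using second_largest_eigenvalue_bound(2)[OF card Ssym Sones neg that] unfolding quad[OF that] .
qed

text \<open>For \<open>e \<noteq> 0\<close> this regularisation of \<open>- ln\<close> is smooth on the whole line, hence can be evaluated on
  the Euler-type process, which need not stay positive; the products \<open>y * reg_log1 e y\<close> and
  \<open>y\<^sup>2 * reg_log2 e y\<close> stay bounded as \<open>e\<close> tends to \<open>0\<close>.\<close>

definition reg_log :: "real \<Rightarrow> real \<Rightarrow> real" where
  "reg_log e y = - ln (e\<^sup>2 + y\<^sup>2) / 2"

definition reg_log1 :: "real \<Rightarrow> real \<Rightarrow> real" where
  "reg_log1 e y = - y / (e\<^sup>2 + y\<^sup>2)"

definition reg_log2 :: "real \<Rightarrow> real \<Rightarrow> real" where
  "reg_log2 e y = (y\<^sup>2 - e\<^sup>2) / (e\<^sup>2 + y\<^sup>2)\<^sup>2"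

definition reg_log3 :: "real \<Rightarrow> real \<Rightarrow> real" where
  "reg_log3 e y = 2 * y * (3 * e\<^sup>2 - y\<^sup>2) / (e\<^sup>2 + y\<^sup>2) ^ 3"

lemma reg_log_deriv:
  assumes e: "0 < e"
  shows "(reg_log e has_real_derivative reg_log1 e y) (at y)"
    and "(reg_log1 e has_real_derivative reg_log2 e y) (at y)"
    and "(reg_log2 e has_real_derivative reg_log3 e y) (at y)"
proof -
  have D: "e\<^sup>2 + y\<^sup>2 > 0" using e by (simp add: add_pos_nonneg)
  show "(reg_log e has_real_derivative reg_log1 e y) (at y)"
    unfolding reg_log_def[abs_def] reg_log1_def
    using D e by (auto intro!: derivative_eq_intros simp: field_simps)
  show "(reg_log1 e has_real_derivative reg_log2 e y) (at y)"
  proof -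
    have "((\<lambda>y. - y / (e\<^sup>2 + y\<^sup>2)) has_real_derivative
        ((- 1) * (e\<^sup>2 + y\<^sup>2) - (- y) * (2 * y)) / ((e\<^sup>2 + y\<^sup>2) * (e\<^sup>2 + y\<^sup>2))) (at y)"
      using D by (intro DERIV_divide) (auto intro!: derivative_eq_intros)
    then show ?thesis
      unfolding reg_log1_def[abs_def] reg_log2_def by (simp add: power2_eq_square)
  qed
  define d where "d = e\<^sup>2 + y\<^sup>2"
  have "(reg_log2 e has_real_derivative (2 * y * d\<^sup>2 - (y\<^sup>2 - e\<^sup>2) * (2 * d * (2 * y))) / (d\<^sup>2 * d\<^sup>2)) (at y)"
    unfolding reg_log2_def[abs_def] d_def
    using D by (intro DERIV_divide) (auto intro!: derivative_eq_intros)
  also have "(2 * y * d\<^sup>2 - (y\<^sup>2 - e\<^sup>2) * (2 * d * (2 * y))) / (d\<^sup>2 * d\<^sup>2)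
      = (d * (2 * y * d - (y\<^sup>2 - e\<^sup>2) * 4 * y)) / (d * d ^ 3)"
    by (rule arg_cong2[where f = "(/)"]) (simp_all add: power2_eq_square power3_eq_cube algebra_simps)
  also have "\<dots> = (2 * y * d - (y\<^sup>2 - e\<^sup>2) * 4 * y) / d ^ 3"
    using D unfolding d_def[symmetric] by (intro mult_divide_mult_cancel_left) auto
  also have "2 * y * d - (y\<^sup>2 - e\<^sup>2) * 4 * y = 2 * y * (3 * e\<^sup>2 - y\<^sup>2)"
    unfolding d_def by (simp add: algebra_simps)
  finally show "(reg_log2 e has_real_derivative reg_log3 e y) (at y)"
    unfolding reg_log3_def d_def .
qed

text \<open>One common bound, as the Ito formula asks for a single \<open>L\<close>; its three
  summands bound the three derivatives in turn. Its growth as \<open>e\<close> tends to 0 is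
  harmless, since \<open>e\<close> is fixed when the formula is applied.\<close>

lemma reg_log_deriv_bound:
  assumes e: "0 < e"
  shows "\<bar>reg_log1 e y\<bar> \<le> 1 / e + 1 / e\<^sup>2 + 6 / e ^ 3"
    and "\<bar>reg_log2 e y\<bar> \<le> 1 / e + 1 / e\<^sup>2 + 6 / e ^ 3"
    and "\<bar>reg_log3 e y\<bar> \<le> 1 / e + 1 / e\<^sup>2 + 6 / e ^ 3"
proof -
  define d where "d = e\<^sup>2 + y\<^sup>2"
  have d: "0 < d" "e\<^sup>2 \<le> d" using e by (auto simp: d_def add_pos_nonneg)
  have inv: "1 / d \<le> 1 / e\<^sup>2" using d e by (simp add: frac_le)
  have nn: "0 \<le> 1 / e" "0 \<le> 1 / e\<^sup>2" "0 \<le> 6 / e ^ 3" using e by auto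
  have "\<bar>y\<bar> * e \<le> d"
  proof -
    have "2 * (\<bar>y\<bar> * e) \<le> d"
      using sum_squares_bound[of e "\<bar>y\<bar>"] by (simp add: d_def mult_ac)
    moreover have "0 \<le> \<bar>y\<bar> * e" using e by simp
    ultimately show ?thesis by linarith
  qed
  then have b1: "\<bar>y\<bar> / d \<le> 1 / e" using d e by (simp add: field_simps)
  have "\<bar>reg_log1 e y\<bar> = \<bar>y\<bar> / d"
    unfolding reg_log1_def d_def[symmetric] using d by (simp add: abs_divide)
  then show "\<bar>reg_log1 e y\<bar> \<le> 1 / e + 1 / e\<^sup>2 + 6 / e ^ 3"
    using b1 nn by linarith
  have "\<bar>reg_log2 e y\<bar> = \<bar>y\<^sup>2 - e\<^sup>2\<bar> / d\<^sup>2"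
    unfolding reg_log2_def d_def[symmetric] by (simp add: abs_divide)
  also have "\<dots> \<le> d / d\<^sup>2"
    unfolding d_def by (intro divide_right_mono) (auto simp: abs_le_iff)
  also have "\<dots> = 1 / d" using d by (simp add: power2_eq_square)
  finally show "\<bar>reg_log2 e y\<bar> \<le> 1 / e + 1 / e\<^sup>2 + 6 / e ^ 3"
    using inv nn by linarith
  have "\<bar>3 * e\<^sup>2 - y\<^sup>2\<bar> \<le> 3 * d" unfolding d_def by (auto simp: abs_le_iff)
  then have "\<bar>2 * y * (3 * e\<^sup>2 - y\<^sup>2)\<bar> \<le> 2 * \<bar>y\<bar> * (3 * d)"
    unfolding abs_mult by (intro mult_mono) auto
  then have "\<bar>reg_log3 e y\<bar> \<le> 2 * \<bar>y\<bar> * (3 * d) / d ^ 3"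
    unfolding reg_log3_def d_def[symmetric] using d by (simp add: abs_divide divide_right_mono)
  also have "\<dots> = 6 * ((\<bar>y\<bar> / d) * (1 / d))" using d by (simp add: power3_eq_cube field_simps)
  also have "\<dots> \<le> 6 * ((1 / e) * (1 / e\<^sup>2))"
    using b1 inv d e by (intro mult_left_mono mult_mono) auto
  also have "\<dots> = 6 / e ^ 3" by (simp add: power2_eq_square power3_eq_cube)
  finally show "\<bar>reg_log3 e y\<bar> \<le> 1 / e + 1 / e\<^sup>2 + 6 / e ^ 3" using nn by linarith
qed

text \<open>Uniform in \<open>e\<close>, which supplies the domination for the limit in
  \<open>e\<close>. If \<open>e\<close> and \<open>y\<close> both vanish, the quotients are 0 by
  convention.\<close>

lemma reg_log_scaled_bound:
  "\<bar>y * reg_log1 e y\<bar> \<le> 1" "\<bar>y\<^sup>2 * reg_log2 e y\<bar> \<le> 1"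
proof -
  define d where "d = e\<^sup>2 + y\<^sup>2"
  have d0: "0 \<le> d" "y\<^sup>2 \<le> d" "\<bar>y\<^sup>2 - e\<^sup>2\<bar> \<le> d" by (auto simp: d_def abs_le_iff)
  have "\<bar>y * reg_log1 e y\<bar> = y\<^sup>2 / d"
    unfolding reg_log1_def d_def[symmetric] using d0 by (simp add: abs_mult abs_divide power2_eq_square)
  also have "\<dots> \<le> 1" using d0 by (auto simp: divide_le_eq_1)
  finally show "\<bar>y * reg_log1 e y\<bar> \<le> 1" .
  have "\<bar>y\<^sup>2 * reg_log2 e y\<bar> = (y\<^sup>2 / d) * (\<bar>y\<^sup>2 - e\<^sup>2\<bar> / d)"
    unfolding reg_log2_def d_def[symmetric] by (simp add: abs_mult abs_divide power2_eq_square)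
  also have "\<dots> \<le> 1 * 1" using d0 by (intro mult_mono) (auto simp: divide_le_eq_1)
  finally show "\<bar>y\<^sup>2 * reg_log2 e y\<bar> \<le> 1" by simp
qed

lemma reg_log_tendsto:
  assumes y: "0 < y" and e: "e \<longlonglongrightarrow> 0"
  shows "(\<lambda>k. reg_log (e k) y) \<longlonglongrightarrow> - ln y"
    and "(\<lambda>k. y * reg_log1 (e k) y) \<longlonglongrightarrow> -1"
    and "(\<lambda>k. y\<^sup>2 * reg_log2 (e k) y) \<longlonglongrightarrow> 1"
proof -
  have "(\<lambda>k. reg_log (e k) y) \<longlonglongrightarrow> - ln (0\<^sup>2 + y\<^sup>2) / 2"
    unfolding reg_log_def using y by (intro tendsto_intros e) auto
  then show "(\<lambda>k. reg_log (e k) y) \<longlonglongrightarrow> - ln y"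
    using y by (simp add: ln_realpow)
  have "(\<lambda>k. y * reg_log1 (e k) y) \<longlonglongrightarrow> y * (- y / (0\<^sup>2 + y\<^sup>2))"
    unfolding reg_log1_def using y by (intro tendsto_intros e) auto
  then show "(\<lambda>k. y * reg_log1 (e k) y) \<longlonglongrightarrow> -1"
    using y by (simp add: power2_eq_square)
  have "(\<lambda>k. y\<^sup>2 * reg_log2 (e k) y) \<longlonglongrightarrow> y\<^sup>2 * ((y\<^sup>2 - 0\<^sup>2) / (0\<^sup>2 + y\<^sup>2)\<^sup>2)"
    unfolding reg_log2_def using y by (intro tendsto_intros e) auto
  then show "(\<lambda>k. y\<^sup>2 * reg_log2 (e k) y) \<longlonglongrightarrow> 1"
    using y by (simp add: power2_eq_square)
qed

text \<open>Replaces nonnegativity of the relative entropy. Each summand is at least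
  \<open>p $ i - y $ i - e\<close>; over the support of \<open>p\<close> the first parts add up to
  1, the second to at most 1, and the last to at most \<open>real CARD('n) * e\<close>.\<close>

lemma reg_log_gibbs:
  fixes p y :: "real^'n"
  assumes e: "0 < e" and p: "p \<in> cl_Delta" and y: "y \<in> open_Delta"
  shows "- (real CARD('n) * e) \<le> (\<Sum>i | 0 < p $ i. p $ i * (reg_log e (y $ i) + ln (p $ i)))"
proof -
  let ?P = "{i. 0 < p $ i}"
  have y0: "0 < y $ i" for i using y by (simp add: open_Delta_def)
  have le: "p $ i - y $ i - e \<le> p $ i * (reg_log e (y $ i) + ln (p $ i))" if "i \<in> ?P" for i
  proof -
    have pi: "0 < p $ i" and ye: "0 < y $ i + e" using that y0[of i] e by auto
    \<comment> \<open>Passes to the logarithm of the shifted point \<open>y $ i + e\<close>, to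
      which \<open>ln z \<le> z - 1\<close> applies with
      \<open>z = (y $ i + e) / p $ i\<close>.\<close>
    have "e\<^sup>2 + (y $ i)\<^sup>2 \<le> (y $ i + e)\<^sup>2"
      using e y0[of i] by (simp add: power2_sum)
    then have "ln (e\<^sup>2 + (y $ i)\<^sup>2) \<le> ln ((y $ i + e)\<^sup>2)"
      using e ye by (intro ln_mono) (auto simp: add_pos_nonneg)
    also have "\<dots> = 2 * ln (y $ i + e)" using ye by (simp add: ln_realpow)
    finally have "- ln (y $ i + e) \<le> reg_log e (y $ i)" unfolding reg_log_def by simp
    moreover have "ln (y $ i + e) - ln (p $ i) \<le> (y $ i + e) / p $ i - 1"
      using ln_le_minus_one[of "(y $ i + e) / p $ i"] pi ye by (simp add: ln_div)
    ultimately have "1 - (y $ i + e) / p $ i \<le> reg_log e (y $ i) + ln (p $ i)" by linarith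
    then have "p $ i * (1 - (y $ i + e) / p $ i) \<le> p $ i * (reg_log e (y $ i) + ln (p $ i))"
      using pi by (intro mult_left_mono) auto
    then show ?thesis using pi by (simp add: right_diff_distrib)
  qed
  have "(\<Sum>i\<in>?P. p $ i) = (\<Sum>i\<in>UNIV. p $ i)"
    using p by (intro sum.mono_neutral_left) (auto simp: cl_Delta_def not_less intro: antisym)
  then have "(\<Sum>i\<in>?P. p $ i) = 1" using p by (simp add: cl_Delta_def)
  moreover have "(\<Sum>i\<in>?P. y $ i) \<le> (\<Sum>i\<in>UNIV. y $ i)"
    using y0 by (intro sum_mono2) (auto intro: less_imp_le)
  then have "(\<Sum>i\<in>?P. y $ i) \<le> 1" using y by (simp add: open_Delta_def)
  moreover have "real (card ?P) * e \<le> real CARD('n) * e"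
    using e by (intro mult_right_mono) (auto intro: card_mono)
  ultimately have "- (real CARD('n) * e) \<le> (\<Sum>i\<in>?P. p $ i - y $ i - e)"
    by (simp add: sum_subtractf)
  also have "\<dots> \<le> (\<Sum>i\<in>?P. p $ i * (reg_log e (y $ i) + ln (p $ i)))"
    using le by (rule sum_mono)
  finally show ?thesis .
qed

section \<open>The relative entropy along the replicator dynamics\<close>

lemma bounded_on_open_Delta:
  fixes \<phi> :: "real^'n \<Rightarrow> 'b::real_normed_vector"
  assumes "continuous_on UNIV \<phi>"
  obtains B where "0 \<le> B" "\<And>y. y \<in> open_Delta \<Longrightarrow> norm (\<phi> y) \<le> B"
proof -
  \<comment> \<open>The open simplex is not compact, so the bound is taken on the unit cube
    containing it.\<close>
  have "compact (\<phi> ` cbox 0 ones)"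
    using assms by (intro compact_continuous_image continuous_on_subset[OF assms]) auto
  then obtain B where B: "\<And>y. y \<in> cbox 0 ones \<Longrightarrow> norm (\<phi> y) \<le> B"
    using compact_imp_bounded bounded_iff by (metis imageI)
  show thesis
  proof (rule that[of "\<bar>B\<bar>"])
    fix y :: "real^'n" assume "y \<in> open_Delta"
    then have "y \<in> cbox 0 ones"
      by (auto simp: open_Delta_def mem_box_cart ones_def less_imp_le)
    from B[OF this] show "norm (\<phi> y) \<le> \<bar>B\<bar>" by simp
  qed simp
qed

lemma matrix_mult_continuous [continuous_intros]:
  fixes B :: "real^'n^'m"
  shows "continuous_on S (\<lambda>x. B *v x)"
  by (rule matrix_vector_mult_linear_continuous_on)

lemma drift_component_continuous: "continuous_on UNIV (\<lambda>x. drift A \<sigma> x $ i)"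
  unfolding drift_component by (intro continuous_intros)

lemma noise_row_continuous: "continuous_on UNIV (noise_row \<sigma> i)"
  unfolding noise_row_def[abs_def] by (intro continuous_intros)

lemma diffusion_row_continuous: "continuous_on UNIV (\<lambda>x. diffusion \<sigma> x $ i)"
  unfolding diffusion_row by (intro continuous_intros noise_row_continuous)

lemma log_gen_continuous: "continuous_on UNIV (log_gen A \<sigma> i)"
  unfolding log_gen_def[abs_def] by (intro continuous_intros noise_row_continuous) auto

text \<open>The integrand that \<open>ito_formula\<close> produces for \<open>reg_log e\<close>
  along coordinate \<open>i\<close>.\<close>

definition reg_log_gen :: "real^'n^'n \<Rightarrow> real^'n \<Rightarrow> 'n \<Rightarrow> real \<Rightarrow> real^'n \<Rightarrow> real" where
  "reg_log_gen A \<sigma> i e x = reg_log1 e (x $ i) * drift A \<sigma> x $ i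
     + reg_log2 e (x $ i) / 2 * (norm (diffusion \<sigma> x $ i))\<^sup>2"

lemma reg_log_gen_eq:
  "reg_log_gen A \<sigma> i e x = (x $ i * reg_log1 e (x $ i)) *
      (((A - diagv (sq_vec \<sigma>)) *v x) $ i - x \<bullet> ((A - diagv (sq_vec \<sigma>)) *v x))
    + ((x $ i)\<^sup>2 * reg_log2 e (x $ i)) * (norm (noise_row \<sigma> i x))\<^sup>2 / 2"
  unfolding reg_log_gen_def drift_component diffusion_row by (simp add: power_mult_distrib)

lemma reg_log_gen_continuous:
  assumes "0 < e"
  shows "continuous_on UNIV (reg_log_gen A \<sigma> i e)"
proof -
  have "e\<^sup>2 + y\<^sup>2 \<noteq> 0" for y using assms by (simp add: add_pos_nonneg order_less_imp_not_eq2)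
  then show ?thesis
    unfolding reg_log_gen_def[abs_def] reg_log1_def reg_log2_def
    by (intro continuous_intros drift_component_continuous diffusion_row_continuous) auto
qed

text \<open>Pairing the factors \<open>x $ i\<close> of drift and noise with the derivatives of
  \<open>reg_log\<close> makes the bound independent of \<open>e\<close>.\<close>

lemma reg_log_gen_bound:
  fixes A :: "real^'n^'n" and i :: 'n
  obtains B where "0 \<le> B" "\<And>e y. y \<in> open_Delta \<Longrightarrow> \<bar>reg_log_gen A \<sigma> i e y\<bar> \<le> B"
proof -
  let ?g = "\<lambda>x. ((A - diagv (sq_vec \<sigma>)) *v x) $ i - x \<bullet> ((A - diagv (sq_vec \<sigma>)) *v x)"
  have "continuous_on UNIV ?g" by (intro continuous_intros)
  then obtain B1 where B1: "0 \<le> B1" "\<And>y. y \<in> open_Delta \<Longrightarrow> norm (?g y) \<le> B1"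
    using bounded_on_open_Delta by blast
  have "continuous_on UNIV (\<lambda>x. (norm (noise_row \<sigma> i x))\<^sup>2 / 2)"
    by (intro continuous_intros noise_row_continuous) auto
  then obtain B2 where B2: "0 \<le> B2" "\<And>y. y \<in> open_Delta \<Longrightarrow> norm ((norm (noise_row \<sigma> i y))\<^sup>2 / 2) \<le> B2"
    using bounded_on_open_Delta by blast
  show thesis
  proof (rule that[of "B1 + B2"])
    fix e and y :: "real^'n" assume y: "y \<in> open_Delta"
    have "\<bar>(y $ i * reg_log1 e (y $ i)) * ?g y\<bar> \<le> 1 * B1"
      unfolding abs_mult[of "y $ i * _"] using reg_log_scaled_bound(1) B1(2)[OF y] by (intro mult_mono) auto
    moreover have "\<bar>((y $ i)\<^sup>2 * reg_log2 e (y $ i)) * ((norm (noise_row \<sigma> i y))\<^sup>2 / 2)\<bar> \<le> 1 * B2"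
      unfolding abs_mult[of "(y $ i)\<^sup>2 * _"] using reg_log_scaled_bound(2) B2(2)[OF y] by (intro mult_mono) auto
    ultimately show "\<bar>reg_log_gen A \<sigma> i e y\<bar> \<le> B1 + B2"
      unfolding reg_log_gen_eq by simp
  qed (use B1 B2 in simp)
qed

lemma reg_log_gen_tendsto:
  assumes y: "y \<in> open_Delta" and e: "e \<longlonglongrightarrow> 0"
  shows "(\<lambda>k. reg_log_gen A \<sigma> i (e k) y) \<longlonglongrightarrow> log_gen A \<sigma> i y"
proof -
  have "0 < y $ i" using y by (simp add: open_Delta_def)
  note lim = reg_log_tendsto(2,3)[OF this e]
  have "(\<lambda>k. reg_log_gen A \<sigma> i (e k) y) \<longlonglongrightarrow>
      (- 1) * (((A - diagv (sq_vec \<sigma>)) *v y) $ i - y \<bullet> ((A - diagv (sq_vec \<sigma>)) *v y))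
      + 1 * (norm (noise_row \<sigma> i y))\<^sup>2 / 2"
    unfolding reg_log_gen_eq by (intro tendsto_intros lim) auto
  then show ?thesis unfolding log_gen_def by simp
qed

section \<open>The dynamics coordinate by coordinate and the entropy estimate\<close>

locale replicator = brownian_motion M F W
  for M :: "'a measure" and F and W :: "real \<Rightarrow> 'a \<Rightarrow> real^'n" +
  fixes A :: "real^'n^'n" and \<sigma> x :: "real^'n" and X :: "real \<Rightarrow> 'a \<Rightarrow> real^'n"
  assumes x_Delta: "x \<in> open_Delta" and sde: "solves_replicator_sde M F W A \<sigma> x X"
begin

lemma X_Delta: "0 \<le> s \<Longrightarrow> \<omega> \<in> space M \<Longrightarrow> X s \<omega> \<in> open_Delta"
  and X_zero: "\<omega> \<in> space M \<Longrightarrow> X 0 \<omega> = x"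
  and X_cont: "\<omega> \<in> space M \<Longrightarrow> continuous_on {0..} (\<lambda>s. X s \<omega>)"
  and X_adapted: "0 \<le> s \<Longrightarrow> X s \<in> borel_measurable (F s)"
  using sde unfolding solves_replicator_sde_def by blast+

lemma X_compose_cont:
  assumes "continuous_on UNIV \<phi>" "\<omega> \<in> space M"
  shows "continuous_on {0..} (\<lambda>s. \<phi> (X s \<omega>))"
  by (rule continuous_on_compose2[OF assms(1) X_cont[OF assms(2)]]) simp

lemma X_compose_adapted:
  assumes "continuous_on UNIV \<phi>" "0 \<le> s"
  shows "(\<lambda>\<omega>. \<phi> (X s \<omega>)) \<in> borel_measurable (F s)"
  by (rule measurable_compose[OF X_adapted[OF assms(2)] borel_measurable_continuous_onI[OF assms(1)]])

lemma time_integral_measurable: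
  fixes \<phi> :: "real^'n \<Rightarrow> real"
  assumes "continuous_on UNIV \<phi>" "0 \<le> r"
  shows "(\<lambda>\<omega>. integral {0..r} (\<lambda>s. \<phi> (X s \<omega>))) \<in> borel_measurable M"
  using assms by (intro filtration_measurable[OF integral_adapted_measurable] X_compose_cont X_compose_adapted)

lemma time_integral_bound:
  fixes \<phi> :: "real^'n \<Rightarrow> real"
  assumes "continuous_on UNIV \<phi>" "0 \<le> r" "\<omega> \<in> space M" "\<And>y. y \<in> open_Delta \<Longrightarrow> \<bar>\<phi> y\<bar> \<le> B"
  shows "\<bar>integral {0..r} (\<lambda>s. \<phi> (X s \<omega>))\<bar> \<le> B * r"
  using abs_integral_le[of 0 r "\<lambda>s. \<phi> (X s \<omega>)" B] assms
    continuous_on_subset[OF X_compose_cont[OF assms(1,3)], of "{0..r}"] X_Delta[of _ \<omega>] by auto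

lemma time_integrable_on:
  fixes \<phi> :: "real^'n \<Rightarrow> real"
  assumes "continuous_on UNIV \<phi>" "\<omega> \<in> space M"
  shows "(\<lambda>s. \<phi> (X s \<omega>)) integrable_on {0..r}"
  by (intro integrable_continuous_interval continuous_on_subset[OF X_compose_cont[OF assms]]) auto

lemma time_integral_integrable:
  fixes \<phi> :: "real^'n \<Rightarrow> real"
  assumes "continuous_on UNIV \<phi>" "0 \<le> r"
  shows "integrable M (\<lambda>\<omega>. integral {0..r} (\<lambda>s. \<phi> (X s \<omega>)))"
proof -
  obtain B where "\<And>y. y \<in> open_Delta \<Longrightarrow> norm (\<phi> y) \<le> B"
    using bounded_on_open_Delta[OF assms(1)] by blast
  then show ?thesis
    using time_integral_bound[OF assms, of _ B] time_integral_measurable[OF assms]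
    by (intro integrable_const_bound[where B = "B * r"]) auto
qed

text \<open>A coordinate of the vector error is at most its norm, and components commute with the
  path integral and with the sums.\<close>

lemma coordinate_mean_square:
  assumes r: "0 < r"
  shows "(\<lambda>N. expectation (\<lambda>\<omega>. (X r \<omega> $ i - x $ i - integral {0..r} (\<lambda>s. drift A \<sigma> (X s \<omega>) $ i)
      - (\<Sum>k<N. diffusion \<sigma> (X (real k * r / real N) \<omega>) $ i \<bullet>
          (W (real (Suc k) * r / real N) \<omega> - W (real k * r / real N) \<omega>)))\<^sup>2)) \<longlonglongrightarrow> 0"
proof -
  define V where "V = (\<lambda>N \<omega>. X r \<omega> - X 0 \<omega> - integral {0..r} (\<lambda>s. drift A \<sigma> (X s \<omega>))
      - ito_riemann_sum (\<lambda>s \<omega>. diffusion \<sigma> (X s \<omega>)) W r N \<omega>)"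
  have int: "\<And>N. integrable M (\<lambda>\<omega>. (norm (V N \<omega>))\<^sup>2)"
    and lim: "(\<lambda>N. expectation (\<lambda>\<omega>. (norm (V N \<omega>))\<^sup>2)) \<longlonglongrightarrow> 0"
    using sde r unfolding solves_replicator_sde_def Let_def V_def by auto
  have dc: "continuous_on UNIV (drift A \<sigma>)"
    using continuous_on_vec_lambda[of UNIV "\<lambda>i y. drift A \<sigma> y $ i", OF drift_component_continuous] by simp
  have eq: "X r \<omega> $ i - x $ i - integral {0..r} (\<lambda>s. drift A \<sigma> (X s \<omega>) $ i)
      - (\<Sum>k<N. diffusion \<sigma> (X (real k * r / real N) \<omega>) $ i \<bullet>
          (W (real (Suc k) * r / real N) \<omega> - W (real k * r / real N) \<omega>)) = V N \<omega> $ i"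
    if "\<omega> \<in> space M" for N \<omega>
  proof -
    have "(\<lambda>s. drift A \<sigma> (X s \<omega>)) integrable_on {0..r}"
      by (intro integrable_continuous_interval continuous_on_subset[OF X_compose_cont[OF dc that]]) auto
    then show ?thesis
      unfolding V_def ito_riemann_sum_def using X_zero[OF that]
      by (simp add: matrix_vector_mul_component sum_component del: of_nat_Suc)
  qed
  have le: "expectation (\<lambda>\<omega>. (V N \<omega> $ i)\<^sup>2) \<le> expectation (\<lambda>\<omega>. (norm (V N \<omega>))\<^sup>2)" for N
  proof (rule integral_mono'[OF int])
    show "(V N \<omega> $ i)\<^sup>2 \<le> (norm (V N \<omega>))\<^sup>2" for \<omega>
      using power_mono[OF component_le_norm_cart[of "V N \<omega>" i], of 2] by simp
  qed simp
  have "(\<lambda>N. expectation (\<lambda>\<omega>. (V N \<omega> $ i)\<^sup>2)) \<longlonglongrightarrow> 0"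
    by (rule tendsto_sandwich[OF _ _ tendsto_const lim]) (use le in auto)
  moreover have "expectation (\<lambda>\<omega>. (X r \<omega> $ i - x $ i - integral {0..r} (\<lambda>s. drift A \<sigma> (X s \<omega>) $ i)
      - (\<Sum>k<N. diffusion \<sigma> (X (real k * r / real N) \<omega>) $ i \<bullet>
          (W (real (Suc k) * r / real N) \<omega> - W (real k * r / real N) \<omega>)))\<^sup>2)
      = expectation (\<lambda>\<omega>. (V N \<omega> $ i)\<^sup>2)" for N
    by (intro Bochner_Integration.integral_cong refl arg_cong[where f = "\<lambda>z. z\<^sup>2"] eq)
  ultimately show ?thesis by (simp only:)
qed

lemma coordinate_ito_process:
  obtains K where "ito_process M F W (\<lambda>s \<omega>. X s \<omega> $ i) (\<lambda>s \<omega>. drift A \<sigma> (X s \<omega>) $ i)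
    (\<lambda>s \<omega>. diffusion \<sigma> (X s \<omega>) $ i) (x $ i) K"
proof -
  have nc: "continuous_on UNIV (\<lambda>y::real^'n. y $ i)" by (intro continuous_intros)
  obtain B1 where B1: "\<And>y. y \<in> open_Delta \<Longrightarrow> norm (drift A \<sigma> y $ i) \<le> B1"
    using bounded_on_open_Delta[OF drift_component_continuous] by blast
  obtain B2 where B2: "\<And>y. y \<in> open_Delta \<Longrightarrow> norm (diffusion \<sigma> y $ i) \<le> B2"
    using bounded_on_open_Delta[OF diffusion_row_continuous] by blast
  \<comment> \<open>The 1 bounds the coordinate itself, \<open>B1\<close> and \<open>B2\<close> its
    drift and noise; the locale takes one constant for all three.\<close>
  define K where "K = max 1 (max B1 B2)"
  have "ito_process M F W (\<lambda>s \<omega>. X s \<omega> $ i) (\<lambda>s \<omega>. drift A \<sigma> (X s \<omega>) $ i)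
    (\<lambda>s \<omega>. diffusion \<sigma> (X s \<omega>) $ i) (x $ i) K"
  proof unfold_locales
    show "X 0 \<omega> $ i = x $ i" if "\<omega> \<in> space M" for \<omega> using X_zero[OF that] by simp
    show "continuous_on {0..} (\<lambda>s. X s \<omega> $ i)" if "\<omega> \<in> space M" for \<omega>
      by (rule X_compose_cont[OF nc that])
    show "continuous_on {0..} (\<lambda>s. drift A \<sigma> (X s \<omega>) $ i)" if "\<omega> \<in> space M" for \<omega>
      by (rule X_compose_cont[OF drift_component_continuous that])
    show "continuous_on {0..} (\<lambda>s. diffusion \<sigma> (X s \<omega>) $ i)" if "\<omega> \<in> space M" for \<omega>
      by (rule X_compose_cont[OF diffusion_row_continuous that])
    fix s :: real assume s: "0 \<le> s"
    show "(\<lambda>\<omega>. X s \<omega> $ i) \<in> borel_measurable (F s)" by (rule X_compose_adapted[OF nc s])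
    show "(\<lambda>\<omega>. drift A \<sigma> (X s \<omega>) $ i) \<in> borel_measurable (F s)"
      by (rule X_compose_adapted[OF drift_component_continuous s])
    show "(\<lambda>\<omega>. diffusion \<sigma> (X s \<omega>) $ i) \<in> borel_measurable (F s)"
      by (rule X_compose_adapted[OF diffusion_row_continuous s])
    fix \<omega> assume w: "\<omega> \<in> space M"
    note D = X_Delta[OF s w]
    have "0 < X s \<omega> $ i" "X s \<omega> $ i < 1" using D by (auto simp: open_Delta_def)
    then show "\<bar>X s \<omega> $ i\<bar> \<le> K" unfolding K_def by simp
    show "\<bar>drift A \<sigma> (X s \<omega>) $ i\<bar> \<le> K" using B1[OF D] unfolding K_def by simp
    show "norm (diffusion \<sigma> (X s \<omega>) $ i) \<le> K" using B2[OF D] unfolding K_def by simp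
  qed (fact coordinate_mean_square)
  then show thesis by (rule that)
qed

lemma reg_log_ito:
  assumes e: "0 < e" and r: "0 < r"
  shows "integrable M (\<lambda>\<omega>. reg_log e (X r \<omega> $ i))"
    and "expectation (\<lambda>\<omega>. reg_log e (X r \<omega> $ i)) = reg_log e (x $ i)
      + expectation (\<lambda>\<omega>. integral {0..r} (\<lambda>s. reg_log_gen A \<sigma> i e (X s \<omega>)))"
proof -
  obtain K where "ito_process M F W (\<lambda>s \<omega>. X s \<omega> $ i) (\<lambda>s \<omega>. drift A \<sigma> (X s \<omega>) $ i)
    (\<lambda>s \<omega>. diffusion \<sigma> (X s \<omega>) $ i) (x $ i) K"
    by (rule coordinate_ito_process)
  then interpret P: ito_process M F W "\<lambda>s \<omega>. X s \<omega> $ i" "\<lambda>s \<omega>. drift A \<sigma> (X s \<omega>) $ i"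
    "\<lambda>s \<omega>. diffusion \<sigma> (X s \<omega>) $ i" "x $ i" K .
  show "integrable M (\<lambda>\<omega>. reg_log e (X r \<omega> $ i))"
    using P.f_integrable[OF reg_log_deriv[OF e] reg_log_deriv_bound[OF e] P.Y_square_integrable, of r] r by simp
  show "expectation (\<lambda>\<omega>. reg_log e (X r \<omega> $ i)) = reg_log e (x $ i)
      + expectation (\<lambda>\<omega>. integral {0..r} (\<lambda>s. reg_log_gen A \<sigma> i e (X s \<omega>)))"
    using P.ito_formula[OF reg_log_deriv[OF e] reg_log_deriv_bound[OF e] r]
    unfolding reg_log_gen_def .
qed

text \<open>Dominated convergence twice, first in time along each path and then over the paths, with
  the same bound \<open>B\<close> independent of \<open>e\<close>.\<close>

lemma reg_log_gen_integral_tendsto: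
  assumes r: "0 \<le> r" and e: "e \<longlonglongrightarrow> 0" "\<And>k. 0 < e k"
  shows "(\<lambda>k. expectation (\<lambda>\<omega>. integral {0..r} (\<lambda>s. reg_log_gen A \<sigma> i (e k) (X s \<omega>))))
    \<longlonglongrightarrow> expectation (\<lambda>\<omega>. integral {0..r} (\<lambda>s. log_gen A \<sigma> i (X s \<omega>)))"
proof -
  obtain B where B: "0 \<le> B" "\<And>e y. y \<in> open_Delta \<Longrightarrow> \<bar>reg_log_gen A \<sigma> i e y\<bar> \<le> B"
    using reg_log_gen_bound[where A = A and \<sigma> = \<sigma> and i = i] by blast
  show ?thesis
  proof (rule integral_dominated_convergence[where w = "\<lambda>_. B * r"])
    show "(\<lambda>\<omega>. integral {0..r} (\<lambda>s. log_gen A \<sigma> i (X s \<omega>))) \<in> borel_measurable M"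
      using log_gen_continuous r by (rule time_integral_measurable)
    show "(\<lambda>\<omega>. integral {0..r} (\<lambda>s. reg_log_gen A \<sigma> i (e k) (X s \<omega>))) \<in> borel_measurable M" for k
      using reg_log_gen_continuous[OF e(2)] r by (rule time_integral_measurable)
    show "AE \<omega> in M. norm (integral {0..r} (\<lambda>s. reg_log_gen A \<sigma> i (e k) (X s \<omega>))) \<le> B * r" for k
      using time_integral_bound[OF reg_log_gen_continuous[OF e(2)] r _ B(2)] by (intro AE_I2) simp
    show "AE \<omega> in M. (\<lambda>k. integral {0..r} (\<lambda>s. reg_log_gen A \<sigma> i (e k) (X s \<omega>)))
        \<longlonglongrightarrow> integral {0..r} (\<lambda>s. log_gen A \<sigma> i (X s \<omega>))"
    proof (rule AE_I2)
      fix \<omega> assume w: "\<omega> \<in> space M"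
      show "(\<lambda>k. integral {0..r} (\<lambda>s. reg_log_gen A \<sigma> i (e k) (X s \<omega>)))
        \<longlonglongrightarrow> integral {0..r} (\<lambda>s. log_gen A \<sigma> i (X s \<omega>))"
      proof (rule dominated_convergence(2)[where h = "\<lambda>_. B"])
        show "(\<lambda>s. reg_log_gen A \<sigma> i (e k) (X s \<omega>)) integrable_on {0..r}" for k
          using reg_log_gen_continuous[OF e(2)] w by (rule time_integrable_on)
        show "(\<lambda>_. B) integrable_on {0..r}" by (rule integrable_const_ivl)
        show "norm (reg_log_gen A \<sigma> i (e k) (X s \<omega>)) \<le> B" if "s \<in> {0..r}" for k s
          using B(2)[OF X_Delta[OF _ w]] that by simp
        show "(\<lambda>k. reg_log_gen A \<sigma> i (e k) (X s \<omega>)) \<longlonglongrightarrow> log_gen A \<sigma> i (X s \<omega>)" if "s \<in> {0..r}" for s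
          using that by (intro reg_log_gen_tendsto X_Delta w e) simp
      qed
    qed
  qed simp
qed

text \<open>Expresses that the expected entropy at time \<open>r\<close> is nonnegative, without
  mentioning that expectation: \<open>reg_log_gibbs\<close> bounds its regularised version from
  below, Ito's formula rewrites it, and only then does \<open>e\<close> tend to 0.\<close>

lemma entropy_inequality:
  assumes p: "p \<in> cl_Delta" and r: "0 < r"
  shows "0 \<le> rel_entropy x p + expectation (\<lambda>\<omega>. integral {0..r} (\<lambda>s. \<Sum>i\<in>UNIV. p $ i * log_gen A \<sigma> i (X s \<omega>)))"
proof -
  let ?P = "{i. 0 < p $ i}"
  define e where "e = (\<lambda>k. 1 / real (Suc k))"
  have e: "e \<longlonglongrightarrow> 0" "\<And>k. 0 < e k"
    unfolding e_def using LIMSEQ_inverse_real_of_nat by (simp_all add: inverse_eq_divide)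
  define J where "J = (\<lambda>i. expectation (\<lambda>\<omega>. integral {0..r} (\<lambda>s. log_gen A \<sigma> i (X s \<omega>))))"
  define Je where "Je = (\<lambda>i k. expectation (\<lambda>\<omega>. integral {0..r} (\<lambda>s. reg_log_gen A \<sigma> i (e k) (X s \<omega>))))"
  have x0: "0 < x $ i" for i using x_Delta by (simp add: open_Delta_def)
  have le: "- (real CARD('n) * e k) \<le> (\<Sum>i\<in>?P. p $ i * (reg_log (e k) (x $ i) + Je i k + ln (p $ i)))" for k
  proof -
    have int: "integrable M (\<lambda>\<omega>. p $ i * (reg_log (e k) (X r \<omega> $ i) + ln (p $ i)))" for i
      using reg_log_ito(1)[OF e(2) r] by simp
    have "- (real CARD('n) * e k) = expectation (\<lambda>_. - (real CARD('n) * e k))"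
      by (simp add: prob_space)
    also have "\<dots> \<le> expectation (\<lambda>\<omega>. \<Sum>i\<in>?P. p $ i * (reg_log (e k) (X r \<omega> $ i) + ln (p $ i)))"
      using r by (intro integral_mono reg_log_gibbs X_Delta Bochner_Integration.integrable_sum int
          integrable_const e(2) p) auto
    also have "\<dots> = (\<Sum>i\<in>?P. p $ i * (expectation (\<lambda>\<omega>. reg_log (e k) (X r \<omega> $ i)) + ln (p $ i)))"
      using int reg_log_ito(1)[OF e(2) r] by (simp add: Bochner_Integration.integral_sum prob_space)
    also have "\<dots> = (\<Sum>i\<in>?P. p $ i * (reg_log (e k) (x $ i) + Je i k + ln (p $ i)))"
      unfolding reg_log_ito(2)[OF e(2) r] Je_def ..
    finally show ?thesis .
  qed
  have 1: "(\<lambda>k. - (real CARD('n) * e k)) \<longlonglongrightarrow> - (real CARD('n) * 0)"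
    by (intro tendsto_intros e)
  have 2: "(\<lambda>k. \<Sum>i\<in>?P. p $ i * (reg_log (e k) (x $ i) + Je i k + ln (p $ i)))
      \<longlonglongrightarrow> (\<Sum>i\<in>?P. p $ i * (- ln (x $ i) + J i + ln (p $ i)))"
    unfolding Je_def J_def using r
    by (intro tendsto_intros reg_log_tendsto(1)[OF x0 e(1)] reg_log_gen_integral_tendsto e) simp
  have "- (real CARD('n) * 0) \<le> (\<Sum>i\<in>?P. p $ i * (- ln (x $ i) + J i + ln (p $ i)))"
    by (rule LIMSEQ_le[OF 1 2]) (use le in blast)
  also have "\<dots> = rel_entropy x p + (\<Sum>i\<in>?P. p $ i * J i)"
    unfolding rel_entropy_def sum.distrib[symmetric] using x0
    by (intro sum.cong) (auto simp: ln_div order_less_imp_not_eq2[OF x0] algebra_simps)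
  \<comment> \<open>Outside the support the weight \<open>p $ i\<close> is 0, so the sum may run
    over all coordinates.\<close>
  also have "(\<Sum>i\<in>?P. p $ i * J i) = (\<Sum>i\<in>UNIV. p $ i * J i)"
    using p by (intro sum.mono_neutral_left) (auto simp: cl_Delta_def not_less intro: antisym)
  also have "\<dots> = expectation (\<lambda>\<omega>. \<Sum>i\<in>UNIV. p $ i * integral {0..r} (\<lambda>s. log_gen A \<sigma> i (X s \<omega>)))"
    unfolding J_def using time_integral_integrable[OF log_gen_continuous, of r] r
    by (simp add: Bochner_Integration.integral_sum)
  also have "\<dots> = expectation (\<lambda>\<omega>. integral {0..r} (\<lambda>s. \<Sum>i\<in>UNIV. p $ i * log_gen A \<sigma> i (X s \<omega>)))"
  proof (intro Bochner_Integration.integral_cong refl)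
    fix \<omega> assume w: "\<omega> \<in> space M"
    have "(\<lambda>s. p $ i * log_gen A \<sigma> i (X s \<omega>)) integrable_on {0..r}" for i
      using time_integrable_on[OF log_gen_continuous w, where r = r] by (rule integrable_on_mult_right)
    then have "integral {0..r} (\<lambda>s. \<Sum>i\<in>UNIV. p $ i * log_gen A \<sigma> i (X s \<omega>))
        = (\<Sum>i\<in>UNIV. integral {0..r} (\<lambda>s. p $ i * log_gen A \<sigma> i (X s \<omega>)))"
      by (intro Henstock_Kurzweil_Integration.integral_sum) auto
    then show "(\<Sum>i\<in>UNIV. p $ i * integral {0..r} (\<lambda>s. log_gen A \<sigma> i (X s \<omega>)))
        = integral {0..r} (\<lambda>s. \<Sum>i\<in>UNIV. p $ i * log_gen A \<sigma> i (X s \<omega>))"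
      by simp
  qed
  finally show ?thesis by simp
qed

text \<open>Bounding the generator pointwise by \<open>l * (norm (y - p))\<^sup>2 + q\<close> turns
  the entropy inequality into \<open>0 \<le> rel_entropy x p + l * D + r * q\<close>; since
  \<open>l < 0\<close>, this can be solved for \<open>D\<close>.\<close>

lemma mean_square_deviation_bound:
  assumes ess: "is_ESS (A - diagv (sq_vec \<sigma>)) p"
    and quad: "\<And>y. ones \<bullet> y = 0 \<Longrightarrow> y \<bullet> ((A - diagv ((1/2) *\<^sub>R sq_vec \<sigma>)) *v y) \<le> l * (norm y)\<^sup>2"
    and l: "l < 0" and r: "0 < r"
  shows "expectation (\<lambda>\<omega>. (1/r) * integral {0..r} (\<lambda>s. (norm (X s \<omega> - p))\<^sup>2))
    \<le> (1 / \<bar>l\<bar>) * (rel_entropy x p / r + (1/2) * (\<Sum>j\<in>UNIV. p $ j * (1 - p $ j) * (\<sigma> $ j)\<^sup>2))"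
proof -
  define q where "q = (1/2) * (\<Sum>j\<in>UNIV. p $ j * (1 - p $ j) * (\<sigma> $ j)\<^sup>2)"
  define D where "D = expectation (\<lambda>\<omega>. integral {0..r} (\<lambda>s. (norm (X s \<omega> - p))\<^sup>2))"
  have p: "p \<in> cl_Delta" using ess by (simp add: is_ESS_def)
  have c1: "continuous_on UNIV (\<lambda>y. \<Sum>i\<in>UNIV. p $ i * log_gen A \<sigma> i y)"
    by (intro continuous_intros log_gen_continuous)
  have c2: "continuous_on UNIV (\<lambda>y. (norm (y - p))\<^sup>2)"
    by (intro continuous_intros)
  have c3: "continuous_on UNIV (\<lambda>y. l * (norm (y - p))\<^sup>2 + q)"
    by (intro continuous_intros)
  have le: "(\<Sum>i\<in>UNIV. p $ i * log_gen A \<sigma> i y) \<le> l * (norm (y - p))\<^sup>2 + q" if y: "y \<in> open_Delta" for y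
  proof -
    have yc: "y \<in> cl_Delta" using y by (auto simp: open_Delta_def cl_Delta_def less_imp_le)
    have "ones \<bullet> (y - p) = 0"
      using yc p by (simp add: ones_inner cl_Delta_def sum_subtractf)
    from quad[OF this] sum_log_gen_le[OF ess yc] show ?thesis unfolding q_def by linarith
  qed
  have "0 \<le> rel_entropy x p + expectation (\<lambda>\<omega>. integral {0..r} (\<lambda>s. \<Sum>i\<in>UNIV. p $ i * log_gen A \<sigma> i (X s \<omega>)))"
    using p r by (rule entropy_inequality)
  also have "expectation (\<lambda>\<omega>. integral {0..r} (\<lambda>s. \<Sum>i\<in>UNIV. p $ i * log_gen A \<sigma> i (X s \<omega>)))
      \<le> expectation (\<lambda>\<omega>. integral {0..r} (\<lambda>s. l * (norm (X s \<omega> - p))\<^sup>2 + q))"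
  proof (rule integral_mono)
    show "integrable M (\<lambda>\<omega>. integral {0..r} (\<lambda>s. \<Sum>i\<in>UNIV. p $ i * log_gen A \<sigma> i (X s \<omega>)))"
      using c1 r by (intro time_integral_integrable) auto
    show "integrable M (\<lambda>\<omega>. integral {0..r} (\<lambda>s. l * (norm (X s \<omega> - p))\<^sup>2 + q))"
      using c3 r by (intro time_integral_integrable) auto
    fix \<omega> assume w: "\<omega> \<in> space M"
    show "integral {0..r} (\<lambda>s. \<Sum>i\<in>UNIV. p $ i * log_gen A \<sigma> i (X s \<omega>))
        \<le> integral {0..r} (\<lambda>s. l * (norm (X s \<omega> - p))\<^sup>2 + q)"
      by (intro integral_le time_integrable_on[OF c1 w] time_integrable_on[OF c3 w] le X_Delta w) simp
  qed
  also have "expectation (\<lambda>\<omega>. integral {0..r} (\<lambda>s. l * (norm (X s \<omega> - p))\<^sup>2 + q))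
      = expectation (\<lambda>\<omega>. l * integral {0..r} (\<lambda>s. (norm (X s \<omega> - p))\<^sup>2) + r * q)"
  proof (intro Bochner_Integration.integral_cong refl)
    fix \<omega> assume w: "\<omega> \<in> space M"
    have "integral {0..r} (\<lambda>s. l * (norm (X s \<omega> - p))\<^sup>2 + q)
        = integral {0..r} (\<lambda>s. l * (norm (X s \<omega> - p))\<^sup>2) + integral {0..r} (\<lambda>_. q)"
      using time_integrable_on[OF c2 w, where r = r]
      by (intro Henstock_Kurzweil_Integration.integral_add integrable_on_mult_right integrable_const_ivl)
    then show "integral {0..r} (\<lambda>s. l * (norm (X s \<omega> - p))\<^sup>2 + q)
        = l * integral {0..r} (\<lambda>s. (norm (X s \<omega> - p))\<^sup>2) + r * q"
      using r by simp
  qed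
  also have "\<dots> = l * D + r * q"
    unfolding D_def using time_integral_integrable[OF c2, of r] r by (simp add: prob_space)
  finally have "\<bar>l\<bar> * D \<le> rel_entropy x p + r * q" using l by simp
  then have "(1 / (\<bar>l\<bar> * r)) * (\<bar>l\<bar> * D) \<le> (1 / (\<bar>l\<bar> * r)) * (rel_entropy x p + r * q)"
    using r by (intro mult_left_mono divide_nonneg_nonneg mult_nonneg_nonneg) auto
  then have "(1/r) * D \<le> (1 / \<bar>l\<bar>) * (rel_entropy x p / r + q)"
    using l r by (simp add: field_simps)
  then show ?thesis unfolding D_def q_def by simp
qed

end

theorem theorem2p2:
  fixes M :: "'a measure" and F :: "real \<Rightarrow> 'a measure"
    and W :: "real \<Rightarrow> 'a \<Rightarrow> real^'n" and X :: "real \<Rightarrow> 'a \<Rightarrow> real^'n"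
    and A :: "real^'n^'n" and \<sigma> :: "real^'n" and p x :: "real^'n" and t :: real
  assumes "CARD('n) \<ge> 2"
    and "\<forall>i. \<sigma> $ i > 0"
    and "prob_space M"
    and "is_filtration M F"
    and "is_brownian_motion M F W"
    and "x \<in> open_Delta"
    and "solves_replicator_sde M F W A \<sigma> x X"
    and "is_ESS (A - diagv (sq_vec \<sigma>)) p"
    and "cond_neg_def (A - diagv ((1/2) *\<^sub>R sq_vec \<sigma>))"
    and "t > 0"
  shows "(let Abar = (1/2) *\<^sub>R (A + transpose A - diagv (sq_vec \<sigma>));
              J = outer ones ones;
              n = real CARD('n);
              S = Abar - (1/n) *\<^sub>R (Abar ** J) - (1/n) *\<^sub>R (J ** Abar)
                  + ((ones \<bullet> (Abar *v ones)) / n^2) *\<^sub>R J;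
              lam2 = second_largest_eigenvalue S
          in integral\<^sup>L M (\<lambda>\<omega>. (1/t) * integral {0..t} (\<lambda>s. (norm (X s \<omega> - p))^2))
             \<le> (1 / \<bar>lam2\<bar>) * (rel_entropy x p / t
                  + (1/2) * (\<Sum>j\<in>UNIV. p $ j * (1 - p $ j) * (\<sigma> $ j)^2)))"
proof -
  interpret replicator M F W A \<sigma> x X
    using assms by (intro replicator.intro brownian_motion.intro brownian_motion_axioms.intro
        replicator_axioms.intro)
  note bound = centred_matrix_bound[OF assms(1,9)]
  show ?thesis
    unfolding Let_def
    by (rule mean_square_deviation_bound[OF assms(8) bound(2) bound(1) assms(10)])
qed

end
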